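(* Let $H$ be an $n\times n$ matrix with entries in $\mathbb Q$, all of whose submatrices have maximal rank. Let $m_1,\dots,m_n,r_1,\dots,r_n$ be pairwise coprime positive integers. Then the germ $f\colon(\mathbb C^n,0)\to(\mathbb C^{2n},0)$ given by $$x\mapsto\bigl(x_1^{m_1},\dots,x_n^{m_n},(Hx)_1^{r_1},\dots,(Hx)_n^{r_n}\bigr)$$ is $\mathcal A$-finite.
   Context: Here $(Hx)_i$ is the $i$th entry of $Hx$. "All submatrices have maximal rank" means that every submatrix (obtained by choosing any nonempty set of rows and any nonempty set of columns) of size $a\times b$ has rank $\min(a,b)$. "Pairwise coprime" means that any two members of the list $m_1,\dots,m_n,r_1,\dots,r_n$ (with different positions in the list) are coprime. Two (multi-)germs $f,f'$ are $\mathcal A$-equivalent if $f'=\psi\circ f\circ\phi$ for germs of biholomorphisms $\phi,\psi$ of source and target. An unfolding of a (multi-)germ $f\colon(\mathbb C^n,S)\to(\mathbb C^p,0)$ is a (multi-)germ $F(t,x)=(t,f_t(x))\colon(\mathbb C^{r}\times\mathbb C^n,\{0\}\times S)\to(\mathbb C^{r}\times\mathbb C^p,0)$ with $f_0=f$. It is trivial if it is $\mathcal A$-equivalent to $\mathrm{id}_{\mathbb C^r}\times f$ via biholomorphisms that are themselves unfoldings of the identities of $\mathbb C^n$ and $\mathbb C^p$. A (multi-)germ is stable if each of its unfoldings is trivial. A finite germ $f\colon(\mathbb C^n,0)\to(\mathbb C^p,0)$ is $\mathcal A$-finite if it has a small representative for which stability fails at most over the origin, i.e. the multi-germ of the representative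 at $f^{-1}(y)$ is stable for all $y\ne0$. *)

theory Defs
  imports "HOL-Analysis.Analysis" "Jordan_Normal_Form.DL_Rank_Submatrix"
begin

text \<open>As in \<^const>\<open>Euclidean_space\<close>, the space \<open>C^d\<close>, for an arbitrary number \<open>d\<close>, is the set
  of sequences vanishing from index \<open>d\<close> on. The subspace topology induced by the product topology
  is the usual one. Coordinates are numbered from \<open>0\<close>.\<close>

definition Cspace :: "nat \<Rightarrow> (nat \<Rightarrow> complex) set"
  where "Cspace d = {x. \<forall>i\<ge>d. x i = 0}"

abbreviation open_in_C :: "nat \<Rightarrow> (nat \<Rightarrow> complex) set \<Rightarrow> bool"
  where "open_in_C d \<equiv> openin (top_of_set (Cspace d))"

definition complex_differentiable_at ::
    "nat \<Rightarrow> ((nat \<Rightarrow> complex) \<Rightarrow> complex) \<Rightarrow> (nat \<Rightarrow> complex) \<Rightarrow> bool"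
  where "complex_differentiable_at d g x \<longleftrightarrow>
    (\<exists>L :: nat \<Rightarrow> complex.
      ((\<lambda>y. (g y - g x - (\<Sum>i<d. L i * (y i - x i)))
             / of_real (L2_set (\<lambda>i. cmod (y i - x i)) {..<d}))
        \<longlongrightarrow> 0) (at x within Cspace d))"

definition holomorphic_map ::
    "nat \<Rightarrow> nat \<Rightarrow> (nat \<Rightarrow> complex) set \<Rightarrow> ((nat \<Rightarrow> complex) \<Rightarrow> nat \<Rightarrow> complex) \<Rightarrow> bool"
  where "holomorphic_map n p U f \<longleftrightarrow>
    open_in_C n U \<and> f ` U \<subseteq> Cspace p \<and>
    (\<forall>x\<in>U. \<forall>j<p. complex_differentiable_at n (\<lambda>y. f y j) x)"

text \<open>A multi-germ \<open>(C^n,S) \<rightarrow> (C^p,T)\<close> is represented by a total function, of which only the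
  values near \<open>S\<close> matter. The target \<open>T\<close> is a single point, except for identities and coordinate
  changes of the source, where it is the set of source points.\<close>

definition germ_eq ::
    "nat \<Rightarrow> (nat \<Rightarrow> complex) set \<Rightarrow> ((nat \<Rightarrow> complex) \<Rightarrow> nat \<Rightarrow> complex)
      \<Rightarrow> ((nat \<Rightarrow> complex) \<Rightarrow> nat \<Rightarrow> complex) \<Rightarrow> bool"
  where "germ_eq n S f g \<longleftrightarrow> (\<exists>U. open_in_C n U \<and> S \<subseteq> U \<and> (\<forall>x\<in>U. f x = g x))"

definition multigerm ::
    "nat \<Rightarrow> nat \<Rightarrow> (nat \<Rightarrow> complex) set \<Rightarrow> (nat \<Rightarrow> complex) set
      \<Rightarrow> ((nat \<Rightarrow> complex) \<Rightarrow> nat \<Rightarrow> complex) \<Rightarrow> bool"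
  where "multigerm n p S T f \<longleftrightarrow>
    finite S \<and> S \<subseteq> Cspace n \<and> T \<subseteq> Cspace p \<and> f ` S \<subseteq> T \<and>
    (\<exists>U. S \<subseteq> U \<and> holomorphic_map n p U f)"

definition biholomorphic_germ ::
    "nat \<Rightarrow> (nat \<Rightarrow> complex) set \<Rightarrow> (nat \<Rightarrow> complex) set
      \<Rightarrow> ((nat \<Rightarrow> complex) \<Rightarrow> nat \<Rightarrow> complex) \<Rightarrow> bool"
  where "biholomorphic_germ d S T \<phi> \<longleftrightarrow>
    \<phi> ` S = T \<and>
    (\<exists>U. S \<subseteq> U \<and> inj_on \<phi> U \<and> holomorphic_map d d U \<phi> \<and>
         holomorphic_map d d (\<phi> ` U) (inv_into U \<phi>))"

text \<open>\<open>f' = \<psi> \<circ> f \<circ> \<phi>\<close> as germs, where \<open>f: (C^n,S) \<rightarrow> (C^p,T)\<close> and \<open>f': (C^n,S') \<rightarrow> (C^p,T')\<close>.\<close>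

definition A_equivalent_via ::
    "nat \<Rightarrow> nat \<Rightarrow> (nat \<Rightarrow> complex) set \<Rightarrow> (nat \<Rightarrow> complex) set
      \<Rightarrow> ((nat \<Rightarrow> complex) \<Rightarrow> nat \<Rightarrow> complex)
      \<Rightarrow> (nat \<Rightarrow> complex) set \<Rightarrow> (nat \<Rightarrow> complex) set
      \<Rightarrow> ((nat \<Rightarrow> complex) \<Rightarrow> nat \<Rightarrow> complex)
      \<Rightarrow> ((nat \<Rightarrow> complex) \<Rightarrow> nat \<Rightarrow> complex)
      \<Rightarrow> ((nat \<Rightarrow> complex) \<Rightarrow> nat \<Rightarrow> complex) \<Rightarrow> bool"
  where "A_equivalent_via n p S T f S' T' f' \<phi> \<psi> \<longleftrightarrow>
    biholomorphic_germ n S' S \<phi> \<and> biholomorphic_germ p T T' \<psi> \<and>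
    germ_eq n S' f' (\<psi> \<circ> f \<circ> \<phi>)"

text \<open>The point \<open>(t,x)\<close> of \<open>C^r \<times> C^n = C^(r+n)\<close>. Entries of \<open>t\<close> from index \<open>r\<close> on are ignored.\<close>

definition pair :: "nat \<Rightarrow> (nat \<Rightarrow> complex) \<Rightarrow> (nat \<Rightarrow> complex) \<Rightarrow> (nat \<Rightarrow> complex)"
  where "pair r t x = (\<lambda>i. if i < r then t i else x (i - r))"

definition zero_times :: "nat \<Rightarrow> (nat \<Rightarrow> complex) set \<Rightarrow> (nat \<Rightarrow> complex) set"
  where "zero_times r S = pair r (\<lambda>_. 0) ` S"

definition id_times ::
    "nat \<Rightarrow> ((nat \<Rightarrow> complex) \<Rightarrow> nat \<Rightarrow> complex) \<Rightarrow> (nat \<Rightarrow> complex) \<Rightarrow> nat \<Rightarrow> complex"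
  where "id_times r f = (\<lambda>z. pair r z (f (\<lambda>i. z (r + i))))"

definition unfolding_of ::
    "nat \<Rightarrow> nat \<Rightarrow> nat \<Rightarrow> (nat \<Rightarrow> complex) set \<Rightarrow> (nat \<Rightarrow> complex) set
      \<Rightarrow> ((nat \<Rightarrow> complex) \<Rightarrow> nat \<Rightarrow> complex)
      \<Rightarrow> ((nat \<Rightarrow> complex) \<Rightarrow> nat \<Rightarrow> complex) \<Rightarrow> bool"
  where "unfolding_of r n p S T f F \<longleftrightarrow>
    multigerm (r + n) (r + p) (zero_times r S) (zero_times r T) F \<and>
    (\<exists>W fam. open_in_C (r + n) W \<and> zero_times r S \<subseteq> W \<and>
       (\<forall>t\<in>Cspace r. \<forall>x\<in>Cspace n. pair r t x \<in> W \<longrightarrow> F (pair r t x) = pair r t (fam t x)) \<and>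
       germ_eq n S (fam (\<lambda>_. 0)) f)"

definition trivial_unfolding ::
    "nat \<Rightarrow> nat \<Rightarrow> nat \<Rightarrow> (nat \<Rightarrow> complex) set \<Rightarrow> (nat \<Rightarrow> complex) set
      \<Rightarrow> ((nat \<Rightarrow> complex) \<Rightarrow> nat \<Rightarrow> complex)
      \<Rightarrow> ((nat \<Rightarrow> complex) \<Rightarrow> nat \<Rightarrow> complex) \<Rightarrow> bool"
  where "trivial_unfolding r n p S T f F \<longleftrightarrow>
    (\<exists>\<Phi> \<Psi>. unfolding_of r n n S S id \<Phi> \<and> unfolding_of r p p T T id \<Psi> \<and>
       A_equivalent_via (r + n) (r + p) (zero_times r S) (zero_times r T) (id_times r f)
         (zero_times r S) (zero_times r T) F \<Phi> \<Psi>)"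

definition stable_multigerm ::
    "nat \<Rightarrow> nat \<Rightarrow> (nat \<Rightarrow> complex) set \<Rightarrow> (nat \<Rightarrow> complex)
      \<Rightarrow> ((nat \<Rightarrow> complex) \<Rightarrow> nat \<Rightarrow> complex) \<Rightarrow> bool"
  where "stable_multigerm n p S y f \<longleftrightarrow>
    multigerm n p S {y} f \<and>
    (\<forall>r F. unfolding_of r n p S {y} f F \<longrightarrow> trivial_unfolding r n p S {y} f F)"

text \<open>A representative \<open>f: U \<rightarrow> V\<close> of a germ at the origin that is a finite map, that is, closed
  with finite fibres.\<close>

definition finite_representative ::
    "nat \<Rightarrow> nat \<Rightarrow> ((nat \<Rightarrow> complex) \<Rightarrow> nat \<Rightarrow> complex)
      \<Rightarrow> (nat \<Rightarrow> complex) set \<Rightarrow> (nat \<Rightarrow> complex) set \<Rightarrow> bool"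
  where "finite_representative n p f U V \<longleftrightarrow>
    (\<lambda>_. 0) \<in> U \<and> (\<lambda>_. 0) \<in> V \<and> open_in_C p V \<and> holomorphic_map n p U f \<and> f ` U \<subseteq> V \<and>
    closed_map (top_of_set U) (top_of_set V) f \<and>
    (\<forall>y\<in>V. finite {x\<in>U. f x = y})"

definition finite_germ :: "nat \<Rightarrow> nat \<Rightarrow> ((nat \<Rightarrow> complex) \<Rightarrow> nat \<Rightarrow> complex) \<Rightarrow> bool"
  where "finite_germ n p f \<longleftrightarrow>
    multigerm n p {\<lambda>_. 0} {\<lambda>_. 0} f \<and> (\<exists>U V. finite_representative n p f U V)"

text \<open>``Small representative'': the domain can be chosen inside any given neighbourhood \<open>N\<close> of the
  origin.\<close>

definition A_finite :: "nat \<Rightarrow> nat \<Rightarrow> ((nat \<Rightarrow> complex) \<Rightarrow> nat \<Rightarrow> complex) \<Rightarrow> bool"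
  where "A_finite n p f \<longleftrightarrow>
    finite_germ n p f \<and>
    (\<forall>N. open_in_C n N \<and> (\<lambda>_. 0) \<in> N \<longrightarrow>
      (\<exists>U V. U \<subseteq> N \<and> finite_representative n p f U V \<and>
        (\<forall>y\<in>V. y \<noteq> (\<lambda>_. 0) \<longrightarrow> stable_multigerm n p {x\<in>U. f x = y} y f)))"

definition all_submatrices_maximal_rank :: "'a :: field mat \<Rightarrow> bool"
  where "all_submatrices_maximal_rank A \<longleftrightarrow>
    (\<forall>I J. I \<subseteq> {..<dim_row A} \<and> J \<subseteq> {..<dim_col A} \<and> I \<noteq> {} \<and> J \<noteq> {} \<longrightarrow>
      vec_space.rank (card I) (submatrix A I J) = min (card I) (card J))"

text \<open>\<open>x \<mapsto> (x_1^m_1, \<dots>, x_n^m_n, (Hx)_1^r_1, \<dots>, (Hx)_n^r_n)\<close>\<close>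

definition power_map ::
    "nat \<Rightarrow> rat mat \<Rightarrow> nat list \<Rightarrow> nat list \<Rightarrow> (nat \<Rightarrow> complex) \<Rightarrow> nat \<Rightarrow> complex"
  where "power_map n H m r x = (\<lambda>i.
    if i < n then x i ^ (m ! i)
    else if i < 2 * n then (\<Sum>j<n. of_rat (H $$ (i - n, j)) * x j) ^ (r ! (i - n))
    else 0)"

end

theory Submission
  imports
    Defs
    "Jordan_Normal_Form.Char_Poly"
    "HOL-Complex_Analysis.Conformal_Mappings"
    "HOL-Number_Theory.Cong"
begin

text \<open>Let \<open>l\<^sub>1, \<dots>, l\<^sub>2\<^sub>n\<close> be the linear forms \<open>x\<^sub>1, \<dots>, x\<^sub>n, (Hx)\<^sub>1, \<dots>, (Hx)\<^sub>n\<close> and \<open>d\<^sub>k\<close> the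
exponent of \<open>l\<^sub>k\<close> in the map \<open>f\<close>. The rank condition says that any \<open>n\<close> of the \<open>2n\<close> forms are
linearly independent (\<open>general_position_forms\<close>). The map \<open>f\<close> turns out to have no double points at
all: away from the origin it is an injective immersion, and for such a map stability can be checked
by hand.

\<^bold>\<open>Injectivity.\<close> If \<open>f(x) = f(x')\<close>, then \<open>l\<^sub>k(x') = \<zeta>\<^sub>k l\<^sub>k(x)\<close> for roots of unity with
\<open>\<zeta>\<^sub>k^d\<^sub>k = 1\<close>. Put \<open>w = x' - x\<close>. If fewer than \<open>n\<close> of the \<open>\<zeta>\<^sub>k\<close> differ from \<open>1\<close>, then \<open>n\<close> forms
vanish on \<open>w\<close>, and \<open>w = 0\<close>. Otherwise \<open>l\<^sub>k(w) = (\<zeta>\<^sub>k - 1) l\<^sub>k(x)\<close> is a square linear system for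
\<open>(x, w)\<close>, and its determinant is shown to be nonzero by induction on the number of \<open>k\<close> with
\<open>\<zeta>\<^sub>k \<noteq> 1\<close> (\<open>double_point_matrix_nonsingular\<close>). When this number is \<open>n\<close>, general position gives
\<open>w = 0\<close> and then \<open>x = 0\<close>. When it is larger, some \<open>\<zeta>\<^sub>k\<close> satisfies \<open>\<zeta>\<^sub>k\<^sup>2 \<noteq> 1\<close>, because at most one of
the pairwise coprime exponents is even. By the induction hypothesis the determinant, an affine
function of \<open>\<zeta>\<^sub>k\<close>, is nonzero if \<open>\<zeta>\<^sub>k\<close> is replaced by \<open>1\<close>. It has rational coefficients in the
\<open>\<zeta>\<close>s, and since the exponents are pairwise coprime a Galois automorphism inverts \<open>\<zeta>\<^sub>k\<close> and fixes the
others; so if it vanished at \<open>\<zeta>\<^sub>k\<close>, it would also vanish at \<open>1/\<zeta>\<^sub>k \<noteq> \<zeta>\<^sub>k\<close> and hence identically.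
The Galois argument is \<open>root_of_unity_conjugate\<close>, the irreducibility of cyclotomic polynomials in
Landau's form.

\<^bold>\<open>Immersivity.\<close> At a point other than the origin fewer than \<open>n\<close> forms vanish, so \<open>n\<close> of them do
not. These are linear coordinates, which are recovered from the values of \<open>f\<close> by local branches of
roots. This gives a holomorphic local left inverse \<open>g\<close> of \<open>f\<close>
(\<open>power_map_local_left_inverse\<close>).

\<^bold>\<open>Stability.\<close> An unfolding \<open>F(t,x) = (t, f\<^sub>t(x))\<close> of a germ with a left inverse \<open>g\<close> is
\<open>\<Psi> \<circ> (id \<times> f)\<close> for \<open>\<Psi>(t,y) = (t, y + f\<^sub>t(g(y)) - f\<^sub>0(g(y)))\<close>, so it is trivial as soon as \<open>\<Psi>\<close> is
biholomorphic (\<open>stable_of_left_inverse\<close>). The perturbation \<open>u = \<Psi> - id\<close> vanishes for \<open>t = 0\<close>; it is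
therefore small on polydiscs that are thin in the directions of \<open>t\<close>, and Schwarz's lemma turns this
into a Lipschitz constant \<open>1/2\<close> for a norm that gives a large weight to \<open>t\<close>
(\<open>parametric_perturbation_biholomorphic\<close>). Banach's fixed point argument then inverts \<open>\<Psi>\<close>
(\<open>near_identity_biholomorphic\<close>).

\<^bold>\<open>Finiteness.\<close> The first \<open>n\<close> components of \<open>f(x)\<close> bound \<open>x\<close>, so \<open>f\<close> is proper, and the
preimages of small polydiscs are arbitrarily small domains of finite representatives.\<close>

section \<open>Galois conjugates of roots of unity\<close>

abbreviation ev :: "int poly \<Rightarrow> complex \<Rightarrow> complex"
  where "ev P w \<equiv> poly (map_poly of_int P) w"

lemma ev_add: "ev (P + Q) w = ev P w + ev Q w"
  by (simp add: hom_distribs)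

lemma ev_diff: "ev (P - Q) w = ev P w - ev Q w"
  by (simp add: hom_distribs)

lemma ev_smult: "ev (Polynomial.smult a P) w = of_int a * ev P w"
  by (simp add: hom_distribs)

lemma ev_mult: "ev (P * Q) w = ev P w * ev Q w"
  by (simp add: hom_distribs)

lemma ev_pCons: "ev (Polynomial.pCons a P) w = of_int a + w * ev P w"
  by (simp add: hom_distribs)

lemma ev_monom: "ev (Polynomial.monom a k) w = of_int a * w ^ k"
  by (simp add: poly_monom)

lemma ev_power: "ev (P ^ k) w = ev P w ^ k"
  by (induction k) (simp_all add: ev_mult)

lemma ev_pcompose_monom: "ev (pcompose P (Polynomial.monom 1 k)) w = ev P (w ^ k)"
  by (induction P) (simp_all add: pcompose_pCons ev_add ev_mult ev_monom ev_pCons poly_monom)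

lemma prime_dvd_power_add_diff:
  fixes a b :: "'a :: comm_ring_1"
  assumes "prime p"
  shows "of_nat p dvd (a + b) ^ p - a ^ p - b ^ p"
proof -
  have p: "p > 0" using assms prime_gt_0_nat by blast
  have "(a + b) ^ p = (\<Sum>k\<le>p. of_nat (p choose k) * a ^ k * b ^ (p - k))"
    by (rule binomial_ring)
  also have "{..p} = insert 0 (insert p {1..<p})"
    using p by auto
  also have "(\<Sum>k\<in>insert 0 (insert p {1..<p}). of_nat (p choose k) * a ^ k * b ^ (p - k)) =
      b ^ p + a ^ p + (\<Sum>k\<in>{1..<p}. of_nat (p choose k) * a ^ k * b ^ (p - k))"
    using p by simp
  finally have "(a + b) ^ p - a ^ p - b ^ p = (\<Sum>k\<in>{1..<p}. of_nat (p choose k) * a ^ k * b ^ (p - k))"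
    by simp
  also have "of_nat p dvd \<dots>"
  proof (rule dvd_sum)
    fix k assume "k \<in> {1..<p}"
    then have "p dvd (p choose k)"
      using assms p by (intro dvd_choose_prime) auto
    then obtain c where "p choose k = p * c" by blast
    then show "of_nat p dvd of_nat (p choose k) * a ^ k * b ^ (p - k)"
      by (simp add: mult.assoc)
  qed
  finally show ?thesis .
qed

lemma prime_dvd_power_diff_self:
  assumes p: "prime p"
  shows "int p dvd a ^ p - a"
proof -
  have p0: "p > 0" using p by (rule prime_gt_0_nat)
  have nat_case: "int p dvd int b ^ p - int b" for b
  proof (induction b)
    case 0
    then show ?case using p0 by (simp add: zero_power)
  next
    case (Suc b)
    have "int p dvd (int b + 1) ^ p - int b ^ p - 1 ^ p"
      using prime_dvd_power_add_diff[OF p, of "int b" 1] by simp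
    then have "int p dvd ((int b + 1) ^ p - int b ^ p - 1 ^ p) + (int b ^ p - int b)"
      using Suc by (rule dvd_add)
    then show ?case by (simp add: algebra_simps)
  qed
  define b where "b = nat (a mod int p)"
  have b: "int b = a mod int p" using p0 by (simp add: b_def)
  have "[a = int b] (mod int p)" by (simp add: b cong_def)
  then have "[a ^ p - a = int b ^ p - int b] (mod int p)"
    by (intro cong_diff cong_pow)
  then show ?thesis using nat_case[of b] by (simp add: cong_dvd_iff)
qed

text \<open>Modulo a prime, the Frobenius map is additive and fixes the integers, so raising a polynomial
to the power \<open>p\<close> amounts to raising its variable to the power \<open>p\<close>.\<close>
lemma frobenius_poly:
  fixes P :: "int poly"
  assumes p: "prime p"
  shows "of_nat p dvd P ^ p - pcompose P (Polynomial.monom 1 p)"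
proof (induction P)
  case 0
  then show ?case using prime_gt_0_nat[OF p] by (simp add: zero_power)
next
  case (pCons a P)
  have eq: "pCons a P = [:a:] + Polynomial.monom 1 1 * P"
    by (simp add: monom_altdef)
  have 1: "of_nat p dvd (pCons a P) ^ p - [:a:] ^ p - (Polynomial.monom 1 1 * P) ^ p"
    unfolding eq by (rule prime_dvd_power_add_diff[OF p])
  have "[:int p:] dvd [:a ^ p - a:]"
    using prime_dvd_power_diff_self[OF p, of a] by (auto simp: const_poly_dvd_const_poly_iff)
  then have 2: "of_nat p dvd [:a:] ^ p - [:a:]"
    by (simp add: of_nat_poly poly_const_pow)
  have "of_nat p dvd Polynomial.monom 1 p * (P ^ p - pcompose P (Polynomial.monom 1 p))"
    using pCons.IH by simp
  then have 3: "of_nat p dvd (Polynomial.monom 1 1 * P) ^ p - Polynomial.monom 1 p * pcompose P (Polynomial.monom 1 p)"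
    by (simp add: power_mult_distrib monom_power right_diff_distrib)
  have "(pCons a P) ^ p - pcompose (pCons a P) (Polynomial.monom 1 p) =
    ((pCons a P) ^ p - [:a:] ^ p - (Polynomial.monom 1 1 * P) ^ p) + ([:a:] ^ p - [:a:])
    + ((Polynomial.monom 1 1 * P) ^ p - Polynomial.monom 1 p * pcompose P (Polynomial.monom 1 p))"
    by (simp add: pcompose_pCons)
  with 1 2 3 show ?case by (metis dvd_add)
qed

lemma ev_prime_power_divisible:
  assumes p: "prime p" and "ev P w = 0"
  shows "\<exists>Q. ev P (w ^ p) = of_nat p * ev Q w"
proof -
  obtain Q where Q: "P ^ p - pcompose P (Polynomial.monom 1 p) = of_nat p * Q"
    using frobenius_poly[OF p, of P] by blast
  have "P ^ p = Polynomial.smult (int p) Q + pcompose P (Polynomial.monom 1 p)"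
    using Q by (simp add: of_nat_poly algebra_simps)
  then have "ev P w ^ p = of_nat p * ev Q w + ev P (w ^ p)"
    by (simp only: ev_add ev_smult ev_pcompose_monom of_int_of_nat_eq flip: ev_power)
  then have "ev P (w ^ p) = of_nat p * ev (Polynomial.smult (- 1) Q) w"
    using assms prime_gt_0_nat[OF p] unfolding ev_smult by (simp add: zero_power eq_neg_iff_add_eq_0 add.commute)
  then show ?thesis by blast
qed

text \<open>The ring \<open>\<int>[w]\<close> of an algebraic number \<open>w\<close> need not be free over a power basis, because a
polynomial \<open>G\<close> of least degree that vanishes at \<open>w\<close> need not be monic over the integers. Pseudo-division
by \<open>G\<close> still writes every element as a polynomial in \<open>w\<close> of degree less than that of \<open>G\<close>, in a unique
way up to a power of the leading coefficient \<open>c\<close> of \<open>G\<close>. A prime that divides the element and not \<open>c\<close>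
must then divide the coefficients of that polynomial.\<close>
lemma ev_finitely_many_prime_divisors:
  assumes w: "ev F w = 0" "F \<noteq> 0" and nz: "ev P w \<noteq> 0"
  shows "\<exists>A. \<forall>p Q. prime p \<longrightarrow> ev P w = of_nat p * ev Q w \<longrightarrow> p \<le> A"
proof -
  define d where "d = (LEAST d. \<exists>G. ev G w = 0 \<and> G \<noteq> 0 \<and> degree G = d)"
  have "\<exists>G. ev G w = 0 \<and> G \<noteq> 0 \<and> degree G = d"
    unfolding d_def by (rule LeastI_ex) (use w in blast)
  then obtain G where G: "ev G w = 0" "G \<noteq> 0" "degree G = d" by blast
  have small: "R = 0" if "ev R w = 0" "degree R < d \<or> R = 0" for R
    using that not_less_Least[of "degree R" "\<lambda>d. \<exists>G. ev G w = 0 \<and> G \<noteq> 0 \<and> degree G = d"]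
    unfolding d_def by blast
  define c where "c = lead_coeff G"
  have c: "c \<noteq> 0" using G(2) by (simp add: c_def)
  have red: "\<exists>k R. of_int (c ^ k) * ev Q w = ev R w \<and> (degree R < d \<or> R = 0)" for Q
  proof -
    obtain q r where qr: "pseudo_divmod Q G = (q, r)" by force
    have "Polynomial.smult (c ^ (Suc (degree Q) - degree G)) Q = G * q + r" "r = 0 \<or> degree r < d"
      using pseudo_divmod[OF G(2) qr] G(3) by (auto simp: c_def)
    then show ?thesis
      using G(1) by (metis ev_smult ev_add ev_mult mult_zero_left add_0)
  qed
  obtain k0 R0 where R0: "of_int (c ^ k0) * ev P w = ev R0 w" "degree R0 < d \<or> R0 = 0"
    using red by blast
  have R0nz: "R0 \<noteq> 0" using R0(1) nz c by auto
  have "p \<le> nat (max \<bar>c\<bar> \<bar>lead_coeff R0\<bar>)"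
    if p: "prime p" and PQ: "ev P w = of_nat p * ev Q w" for p Q
  proof -
    obtain k R where R: "of_int (c ^ k) * ev Q w = ev R w" "degree R < d \<or> R = 0"
      using red by blast
    have "ev (Polynomial.smult (c ^ k) R0 - Polynomial.smult (int p * c ^ k0) R) w = 0"
      unfolding ev_diff ev_smult R(1)[symmetric] R0(1)[symmetric] PQ
      by simp
    moreover have "degree (Polynomial.smult (c ^ k) R0 - Polynomial.smult (int p * c ^ k0) R) < d
        \<or> Polynomial.smult (c ^ k) R0 - Polynomial.smult (int p * c ^ k0) R = 0"
      using R(2) R0(2) R0nz by (cases "R = 0") (auto intro!: degree_diff_less)
    ultimately have "Polynomial.smult (c ^ k) R0 = Polynomial.smult (int p * c ^ k0) R"
      using small by fastforce
    then have "c ^ k * lead_coeff R0 = int p * c ^ k0 * poly.coeff R (degree R0)"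
      by (simp only: coeff_smult[symmetric])
    then have "int p dvd c ^ k * lead_coeff R0" by (simp add: mult.assoc)
    then have "int p dvd c \<or> int p dvd lead_coeff R0"
      using p by (auto simp: prime_dvd_mult_iff intro: prime_dvd_power[of "int p" c k])
    then have "int p \<le> \<bar>c\<bar> \<or> int p \<le> \<bar>lead_coeff R0\<bar>"
      using c R0nz dvd_imp_le_int[of c "int p"] dvd_imp_le_int[of "lead_coeff R0" "int p"] by auto
    then show ?thesis by linarith
  qed
  then show ?thesis by blast
qed

lemma ev_subst_power: "\<exists>Q'. ev Q (w ^ k) = ev Q' w"
  using ev_pcompose_monom by metis

text \<open>Landau's proof. If \<open>P\<close> vanishes at \<open>w^i\<close>, then \<open>P(w^(i*p))\<close> is divisible by the prime \<open>p\<close> in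
\<open>\<int>[w]\<close>. Among the finitely many numbers \<open>P(w^a)\<close> the nonzero ones have only finitely many prime divisors,
so \<open>P(w^(i*p)) = 0\<close> for all large \<open>p\<close>. Hence \<open>P(w^j) = 0\<close> whenever all prime factors of \<open>j\<close> are large,
and every residue class prime to \<open>N\<close> contains such a \<open>j\<close>.\<close>
lemma root_of_unity_conjugate:
  assumes N: "N > 0" and w: "w ^ N = 1" and P: "ev P w = 0" and j: "coprime j N"
  shows "ev P (w ^ j) = 0"
proof -
  define F :: "int poly" where "F = Polynomial.monom 1 N - 1"
  have F: "F \<noteq> 0" using N unfolding F_def
    by (auto simp: poly_eq_iff intro!: exI[of _ N])
  have evF: "ev F w = 0" using w
    by (simp add: F_def ev_diff ev_monom poly_monom)
  have wmod: "w ^ a = w ^ (a mod N)" for a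
  proof -
    have "w ^ a = w ^ (a mod N + N * (a div N))" by simp
    also have "\<dots> = w ^ (a mod N)" using w by (simp only: power_add power_mult) simp
    finally show ?thesis .
  qed
  have "\<exists>A. \<forall>p Q. prime p \<longrightarrow> ev P (w ^ a) \<noteq> 0 \<longrightarrow> ev P (w ^ a) = of_nat p * ev Q w \<longrightarrow> p \<le> A" for a
  proof -
    obtain P' where "ev P (w ^ a) = ev P' w" using ev_subst_power by blast
    then show ?thesis using ev_finitely_many_prime_divisors[OF evF F, of P'] by metis
  qed
  then obtain A where A: "\<And>a p Q. prime p \<Longrightarrow> ev P (w ^ a) \<noteq> 0 \<Longrightarrow>
      ev P (w ^ a) = of_nat p * ev Q w \<Longrightarrow> p \<le> A a"
    by metis
  define B where "B = Max (A ` {..<N})"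
  have B: "p \<le> B" if "prime p" "ev P (w ^ a) \<noteq> 0" "ev P (w ^ a) = of_nat p * ev Q w" for a p Q
  proof -
    have "p \<le> A (a mod N)" using that A[of p "a mod N"] wmod by metis
    also have "\<dots> \<le> B" unfolding B_def using N by (intro Max_ge) auto
    finally show ?thesis .
  qed
  have step: "ev P (w ^ (i * p)) = 0" if h: "ev P (w ^ i) = 0" "prime p" "p > B" for i p
  proof (rule ccontr)
    assume ne: "ev P (w ^ (i * p)) \<noteq> 0"
    obtain Q where "ev P ((w ^ i) ^ p) = of_nat p * ev Q (w ^ i)"
      using ev_prime_power_divisible[OF h(2,1)] by blast
    then show False using B[OF h(2) ne] ev_subst_power[of Q w i] h(3)
      by (metis not_le power_mult)
  qed
  have large: "ev P (w ^ i) = 0" if "i > 0" "\<And>p. prime p \<Longrightarrow> p dvd i \<Longrightarrow> p > B" for i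
    using that
  proof (induction i rule: less_induct)
    case (less i)
    show ?case
    proof (cases "i = 1")
      case True
      then show ?thesis using P by simp
    next
      case False
      obtain p where p: "prime p" "p dvd i" using False prime_factor_nat by blast
      then obtain i' where i': "i = i' * p" by (metis dvd_div_mult_self)
      have "i' < i" "i' > 0" using i' p less.prems(1) prime_gt_1_nat by auto
      then have "ev P (w ^ i') = 0" using less i' by auto
      then show ?thesis using step i' less.prems(2) p by blast
    qed
  qed
  \<comment> \<open>No small prime divides \<open>j + N * t\<close>: it divides exactly one of \<open>j\<close> and \<open>N * t\<close>.\<close>
  define t where "t = \<Prod>{q. prime q \<and> q \<le> B \<and> \<not> q dvd j}"
  have fin: "finite {q. prime q \<and> q \<le> B \<and> \<not> q dvd j}" by (rule finite_subset[of _ "{..B}"]) auto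
  have t0: "t > 0" unfolding t_def by (rule prod_pos) (auto simp: prime_gt_0_nat)
  have "p > B" if p: "prime p" "p dvd j + N * t" for p
  proof (rule ccontr)
    assume "\<not> p > B"
    show False
    proof (cases "p dvd j")
      case True
      then have "p dvd N * t" using p by (simp add: dvd_add_right_iff)
      moreover have "\<not> p dvd N" using True j p(1)
        using coprime_common_divisor not_prime_unit by blast
      ultimately have "p dvd t" using p prime_dvd_mult_iff by blast
      then obtain q where "q \<in> {q. prime q \<and> q \<le> B \<and> \<not> q dvd j}" "p dvd q"
        unfolding t_def using prime_dvd_prod_iff[OF fin, of p id] p(1) by auto
      then show False using p True primes_dvd_imp_eq by auto
    next
      case False
      then have "p dvd t" unfolding t_def using fin p \<open>\<not> p > B\<close> by (intro dvd_prodI) auto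
      then show False using p False by (simp add: dvd_add_left_iff)
    qed
  qed
  then have "ev P (w ^ (j + N * t)) = 0" using N t0 by (intro large) auto
  then show ?thesis using w by (simp add: power_add power_mult)
qed

section \<open>The matrix of a double point\<close>

lemma det_eq_0_iff_kernel:
  fixes a :: "nat \<Rightarrow> nat \<Rightarrow> 'a :: field"
  shows "det (mat n n (\<lambda>(i, j). a i j)) = 0 \<longleftrightarrow>
    (\<exists>x. (\<exists>j<n. x j \<noteq> 0) \<and> (\<forall>i<n. (\<Sum>j<n. a i j * x j) = 0))"
proof -
  let ?A = "mat n n (\<lambda>(i, j). a i j)"
  have mv: "?A *\<^sub>v vec n x = 0\<^sub>v n \<longleftrightarrow> (\<forall>i<n. (\<Sum>j<n. a i j * x j) = 0)" for x
  proof -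
    have "(?A *\<^sub>v vec n x) $ i = (\<Sum>j<n. a i j * x j)" if "i < n" for i
      using that by (auto simp: scalar_prod_def lessThan_atLeast0 intro!: sum.cong)
    then show ?thesis by (auto simp: vec_eq_iff)
  qed
  have nz: "vec n x \<noteq> 0\<^sub>v n \<longleftrightarrow> (\<exists>j<n. x j \<noteq> 0)" for x :: "nat \<Rightarrow> 'a"
    by (auto simp: vec_eq_iff)
  have "det ?A = 0 \<longleftrightarrow> (\<exists>v. v \<in> carrier_vec n \<and> v \<noteq> 0\<^sub>v n \<and> ?A *\<^sub>v v = 0\<^sub>v n)"
    by (intro det_0_iff_vec_prod_zero_field) auto
  also have "\<dots> \<longleftrightarrow> (\<exists>x. vec n x \<noteq> 0\<^sub>v n \<and> ?A *\<^sub>v vec n x = 0\<^sub>v n)"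
  proof (safe, goal_cases)
    case (1 v)
    then have "vec n (\<lambda>i. v $ i) = v" by (auto simp: vec_eq_iff)
    with 1 show ?case by (intro exI[of _ "\<lambda>i. v $ i"]) simp
  next
    case (2 x)
    then show ?case by (intro exI[of _ "vec n x"]) auto
  qed
  finally show ?thesis unfolding mv nz .
qed

definition general_position :: "nat \<Rightarrow> (nat \<Rightarrow> nat \<Rightarrow> complex) \<Rightarrow> bool"
  where "general_position n L \<longleftrightarrow> (\<forall>A x. A \<subseteq> {..<2 * n} \<and> card A = n \<and>
    (\<forall>k\<in>A. (\<Sum>j<n. L k j * x j) = 0) \<longrightarrow> (\<forall>j<n. x j = 0))"

lemma general_positionD:
  assumes "general_position n L" "A \<subseteq> {..<2 * n}" "card A = n"
    and "\<And>k. k \<in> A \<Longrightarrow> (\<Sum>j<n. L k j * x j) = 0" "j < n"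
  shows "x j = 0"
  using assms unfolding general_position_def by blast

text \<open>Row \<open>k\<close> encodes the equation \<open>L\<^sub>k(w) = (\<zeta>\<^sub>k - 1) L\<^sub>k(x)\<close>, that is, \<open>L\<^sub>k(x') = \<zeta>\<^sub>k L\<^sub>k(x)\<close> for
\<open>x' = x + w\<close>; the first \<open>n\<close> columns belong to \<open>x\<close> and the last \<open>n\<close> to \<open>w\<close>. The difference \<open>w\<close> is
used in place of \<open>x'\<close> because the rows with \<open>\<zeta>\<^sub>k = 1\<close> then involve \<open>w\<close> alone.\<close>
definition double_point_matrix :: "nat \<Rightarrow> (nat \<Rightarrow> nat \<Rightarrow> 'a :: comm_ring_1) \<Rightarrow> (nat \<Rightarrow> 'a) \<Rightarrow> 'a mat"
  where "double_point_matrix n L \<zeta> = mat (2 * n) (2 * n)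
    (\<lambda>(k, j). if j < n then (1 - \<zeta> k) * L k j else L k (j - n))"

lemma sum_two_blocks:
  fixes f g :: "nat \<Rightarrow> 'a :: comm_monoid_add"
  shows "(\<Sum>j<2 * n. if j < n then f j else g (j - n)) = (\<Sum>j<n. f j) + (\<Sum>j<n. g j)"
proof -
  let ?F = "\<lambda>j. if j < n then f j else g (j - n)"
  have "sum ?F {..<2 * n} = sum ?F ({..<n} \<union> {n..<2 * n})"
    by (rule arg_cong[of _ _ "sum ?F"]) auto
  also have "\<dots> = sum ?F {..<n} + sum ?F {n..<2 * n}"
    by (rule sum.union_disjoint) auto
  also have "sum ?F {..<n} = (\<Sum>j<n. f j)"
    by (rule sum.cong) auto
  also have "sum ?F {n..<2 * n} = (\<Sum>j<n. g j)"
    by (rule sum.reindex_bij_witness[of _ "\<lambda>j. n + j" "\<lambda>j. j - n"]) auto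
  finally show ?thesis .
qed

lemma double_point_matrix_singular_iff:
  fixes L :: "nat \<Rightarrow> nat \<Rightarrow> 'a :: field"
  shows "det (double_point_matrix n L \<zeta>) = 0 \<longleftrightarrow>
    (\<exists>x w. (\<exists>j<n. x j \<noteq> 0 \<or> w j \<noteq> 0) \<and>
      (\<forall>k<2 * n. (\<Sum>j<n. L k j * w j) = (\<zeta> k - 1) * (\<Sum>j<n. L k j * x j)))"
    (is "_ \<longleftrightarrow> ?rhs")
proof -
  define y :: "(nat \<Rightarrow> 'a) \<Rightarrow> (nat \<Rightarrow> 'a) \<Rightarrow> nat \<Rightarrow> 'a"
    where "y x w = (\<lambda>j. if j < n then x j else w (j - n))" for x w
  have prod: "(\<Sum>j<2 * n. (if j < n then (1 - \<zeta> k) * L k j else L k (j - n)) * y x w j) =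
      (\<Sum>j<n. L k j * w j) - (\<zeta> k - 1) * (\<Sum>j<n. L k j * x j)" for k x w
  proof -
    have "(\<Sum>j<2 * n. (if j < n then (1 - \<zeta> k) * L k j else L k (j - n)) * y x w j) =
      (\<Sum>j<2 * n. if j < n then (1 - \<zeta> k) * L k j * x j else L k (j - n) * w (j - n))"
      by (rule sum.cong) (auto simp: y_def)
    also have "\<dots> = (\<Sum>j<n. (1 - \<zeta> k) * L k j * x j) + (\<Sum>j<n. L k j * w j)"
      by (rule sum_two_blocks)
    also have "(\<Sum>j<n. (1 - \<zeta> k) * L k j * x j) = - ((\<zeta> k - 1) * (\<Sum>j<n. L k j * x j))"
      by (simp add: sum_distrib_left sum_negf[symmetric] algebra_simps)
    finally show ?thesis by simp
  qed
  have surj: "\<exists>x w. \<forall>j<2 * n. z j = y x w j" for z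
    by (intro exI[of _ z] exI[of _ "\<lambda>j. z (n + j)"]) (auto simp: y_def)
  have nz: "(\<exists>j<2 * n. y x w j \<noteq> 0) \<longleftrightarrow> (\<exists>j<n. x j \<noteq> 0 \<or> w j \<noteq> 0)" for x w
  proof
    assume "\<exists>j<n. x j \<noteq> 0 \<or> w j \<noteq> 0"
    then obtain j where "j < n" "x j \<noteq> 0 \<or> w j \<noteq> 0" by blast
    then show "\<exists>j<2 * n. y x w j \<noteq> 0"
      by (intro exI[of _ "if x j \<noteq> 0 then j else n + j"]) (auto simp: y_def)
  next
    assume "\<exists>j<2 * n. y x w j \<noteq> 0"
    then obtain j where "j < 2 * n" "y x w j \<noteq> 0" by blast
    then show "\<exists>j<n. x j \<noteq> 0 \<or> w j \<noteq> 0"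
      by (intro exI[of _ "if j < n then j else j - n"]) (auto simp: y_def split: if_splits)
  qed
  have "det (double_point_matrix n L \<zeta>) = 0 \<longleftrightarrow> (\<exists>z. (\<exists>j<2 * n. z j \<noteq> 0) \<and>
      (\<forall>k<2 * n. (\<Sum>j<2 * n. (if j < n then (1 - \<zeta> k) * L k j else L k (j - n)) * z j) = 0))"
    unfolding double_point_matrix_def by (rule det_eq_0_iff_kernel)
  also have "\<dots> \<longleftrightarrow> (\<exists>x w. (\<exists>j<2 * n. y x w j \<noteq> 0) \<and>
      (\<forall>k<2 * n. (\<Sum>j<2 * n. (if j < n then (1 - \<zeta> k) * L k j else L k (j - n)) * y x w j) = 0))"
  proof (safe, goal_cases)
    case (1 z j)
    obtain x w where xw: "\<forall>j<2 * n. z j = y x w j" using surj by blast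
    then have "(\<Sum>j<2 * n. (if j < n then (1 - \<zeta> k) * L k j else L k (j - n)) * z j) =
      (\<Sum>j<2 * n. (if j < n then (1 - \<zeta> k) * L k j else L k (j - n)) * y x w j)" for k
      by (intro sum.cong) auto
    with 1 xw show ?case by (intro exI[of _ x] exI[of _ w]) auto
  next
    case (2 x w j)
    then show ?case by (intro exI[of _ "y x w"]) auto
  qed
  also have "\<dots> \<longleftrightarrow> ?rhs"
    unfolding prod nz by simp
  finally show ?thesis .
qed

text \<open>The \<open>n\<close> rows with \<open>\<zeta>\<^sub>k = 1\<close> force \<open>w = 0\<close>, and the other \<open>n\<close> rows then force \<open>x = 0\<close>.\<close>
lemma double_point_matrix_nonsingular_minimal:
  assumes gp: "general_position n L" and c: "card {k. k < 2 * n \<and> \<zeta> k \<noteq> 1} = n"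
  shows "det (double_point_matrix n L \<zeta>) \<noteq> 0"
proof
  assume "det (double_point_matrix n L \<zeta>) = 0"
  then obtain x w j where j: "j < n" "x j \<noteq> 0 \<or> w j \<noteq> 0"
    and eq: "\<And>k. k < 2 * n \<Longrightarrow> (\<Sum>j<n. L k j * w j) = (\<zeta> k - 1) * (\<Sum>j<n. L k j * x j)"
    unfolding double_point_matrix_singular_iff by blast
  let ?B = "{k. k < 2 * n \<and> \<zeta> k \<noteq> 1}"
  have zero: "\<forall>j<n. y j = 0"
    if "A \<subseteq> {..<2 * n}" "card A = n" "\<And>k. k \<in> A \<Longrightarrow> (\<Sum>j<n. L k j * y j) = 0" for A y
    using gp that unfolding general_position_def by blast
  have "card ({..<2 * n} - ?B) = 2 * n - n"
    using c by (subst card_Diff_subset) auto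
  then have w: "\<forall>j<n. w j = 0"
    by (intro zero[of "{..<2 * n} - ?B"]) (auto simp: eq)
  have "(\<Sum>j<n. L k j * x j) = 0" if "k \<in> ?B" for k
    using eq[of k] that w by simp
  then have "\<forall>j<n. x j = 0"
    using c by (intro zero[of ?B]) auto
  then show False using j w by auto
qed

text \<open>Only the row \<open>k0\<close> depends on \<open>\<zeta>\<^sub>k\<^sub>0\<close>, and it does so in an affine way.\<close>
lemma double_point_matrix_affine:
  assumes k0: "k0 < 2 * n"
  shows "\<exists>\<alpha> \<beta>. \<forall>s. det (double_point_matrix n L (\<zeta>(k0 := s))) = \<alpha> * s + \<beta>"
proof -
  let ?M = "\<lambda>s. double_point_matrix n L (\<zeta>(k0 := s))"
  have car: "?M s \<in> carrier_mat (2 * n) (2 * n)" for s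
    by (simp add: double_point_matrix_def)
  have del: "mat_delete (?M s) k0 j = mat_delete (?M 0) k0 j" for s j
    unfolding mat_delete_def double_point_matrix_def using k0
    by (intro eq_matI) auto
  have cof: "cofactor (?M s) k0 j = cofactor (?M 0) k0 j" for s j
    unfolding cofactor_def del[of s j] ..
  have entry: "?M s $$ (k0, j) = (if j < n then L k0 j else L k0 (j - n)) - (if j < n then L k0 j else 0) * s"
    if "j < 2 * n" for s j
    using that k0 by (simp add: double_point_matrix_def algebra_simps)
  have "det (?M s) = (\<Sum>j<2 * n. ?M s $$ (k0, j) * cofactor (?M 0) k0 j)" for s
    unfolding laplace_expansion_row[OF car[of s] k0] cof[of s] ..
  also have "(\<Sum>j<2 * n. ?M s $$ (k0, j) * cofactor (?M 0) k0 j) =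
     (\<Sum>j<2 * n. - (if j < n then L k0 j else 0) * cofactor (?M 0) k0 j) * s +
     (\<Sum>j<2 * n. (if j < n then L k0 j else L k0 (j - n)) * cofactor (?M 0) k0 j)" for s
    unfolding sum_distrib_right sum.distrib[symmetric]
  proof (rule sum.cong[OF refl])
    fix j assume "j \<in> {..<2 * n}"
    then have j: "j < 2 * n" by simp
    show "?M s $$ (k0, j) * cofactor (?M 0) k0 j = - (if j < n then L k0 j else 0) * cofactor (?M 0) k0 j * s +
        (if j < n then L k0 j else L k0 (j - n)) * cofactor (?M 0) k0 j"
      unfolding entry[OF j] by (simp add: algebra_simps)
  qed
  finally show ?thesis by blast
qed

lemma ev_comm_ring_hom: "comm_ring_hom (\<lambda>P. ev P w)"
  by unfold_locales (simp_all add: ev_add ev_mult)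

text \<open>All \<open>\<zeta>\<^sub>k\<close> are powers of one root of unity \<open>\<omega>\<close> of order \<open>N\<close>, so the determinant is the value at \<open>\<omega>\<close>
of an integer polynomial.\<close>
lemma double_point_matrix_conjugate:
  fixes L :: "nat \<Rightarrow> nat \<Rightarrow> int"
  assumes N: "N > 0" and \<zeta>: "\<And>k. k < 2 * n \<Longrightarrow> \<zeta> k ^ N = 1" and j: "coprime j N"
    and det0: "det (double_point_matrix n (\<lambda>k i. complex_of_int (L k i)) \<zeta>) = 0"
  shows "det (double_point_matrix n (\<lambda>k i. complex_of_int (L k i)) (\<lambda>k. \<zeta> k ^ j)) = 0"
proof -
  define \<omega> where "\<omega> = exp (2 * of_real pi * \<i> / of_nat N)"
  have \<omega>: "\<omega> ^ N = 1" using N by (simp add: \<omega>_def flip: exp_of_nat_mult)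
  have "\<exists>a. \<zeta> k = \<omega> ^ a" if "k < 2 * n" for k
  proof -
    have "\<zeta> k \<in> {z. z ^ N = 1}" using \<zeta> that by simp
    then obtain a :: nat where "\<zeta> k = exp (2 * of_real pi * \<i> * of_nat a / of_nat N)"
      using complex_roots_unity[of N] N by auto
    also have "\<dots> = \<omega> ^ a"
      unfolding \<omega>_def exp_of_nat_mult[symmetric] by (simp add: mult_ac)
    finally show ?thesis by blast
  qed
  then obtain a where a: "\<And>k. k < 2 * n \<Longrightarrow> \<zeta> k = \<omega> ^ a k" by metis
  define M where "M = double_point_matrix n (\<lambda>k i. [:L k i:]) (\<lambda>k. Polynomial.monom 1 (a k))"
  have "ev (det M) w = det (double_point_matrix n (\<lambda>k i. complex_of_int (L k i)) (\<lambda>k. w ^ a k))" for w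
  proof -
    interpret comm_ring_hom "\<lambda>P. ev P w" by (rule ev_comm_ring_hom)
    have "map_mat (\<lambda>P. ev P w) M = double_point_matrix n (\<lambda>k i. complex_of_int (L k i)) (\<lambda>k. w ^ a k)"
      unfolding M_def double_point_matrix_def
      by (intro eq_matI) (auto simp: ev_diff ev_mult ev_smult ev_monom hom_distribs poly_monom)
    then show ?thesis using hom_det[of M] by simp
  qed
  moreover have "double_point_matrix n (\<lambda>k i. complex_of_int (L k i)) (\<lambda>k. \<omega> ^ a k) =
    double_point_matrix n (\<lambda>k i. complex_of_int (L k i)) \<zeta>"
    unfolding double_point_matrix_def using a by (intro eq_matI) auto
  moreover have "double_point_matrix n (\<lambda>k i. complex_of_int (L k i)) (\<lambda>k. (\<omega> ^ j) ^ a k) =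
    double_point_matrix n (\<lambda>k i. complex_of_int (L k i)) (\<lambda>k. \<zeta> k ^ j)"
    unfolding double_point_matrix_def using a
    by (intro eq_matI) (auto simp: power_mult[symmetric] mult.commute)
  ultimately show ?thesis
    using det0 root_of_unity_conjugate[OF N \<omega> _ j, of "det M"] by metis
qed

text \<open>The exponent \<open>j\<close> with \<open>j = -1\<close> modulo \<open>d\<^sub>k\<^sub>0\<close> and \<open>j = 1\<close> modulo the product of the other \<open>d\<^sub>k\<close>,
which exists by the Chinese remainder theorem, inverts \<open>\<zeta>\<^sub>k\<^sub>0\<close> and fixes the other \<open>\<zeta>\<^sub>k\<close>.\<close>
lemma double_point_matrix_invert_one:
  fixes L :: "nat \<Rightarrow> nat \<Rightarrow> int" and d :: "nat \<Rightarrow> nat"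
  assumes d: "\<And>k. k < 2 * n \<Longrightarrow> d k > 0"
    and cop: "\<And>k l. k < 2 * n \<Longrightarrow> l < 2 * n \<Longrightarrow> k \<noteq> l \<Longrightarrow> coprime (d k) (d l)"
    and \<zeta>: "\<And>k. k < 2 * n \<Longrightarrow> \<zeta> k ^ d k = 1" and k0: "k0 < 2 * n"
    and det0: "det (double_point_matrix n (\<lambda>k i. complex_of_int (L k i)) \<zeta>) = 0"
  shows "det (double_point_matrix n (\<lambda>k i. complex_of_int (L k i)) (\<zeta>(k0 := inverse (\<zeta> k0)))) = 0"
proof -
  define M where "M = (\<Prod>k\<in>{..<2 * n} - {k0}. d k)"
  define N where "N = d k0 * M"
  have M: "M > 0" using d by (auto simp: M_def intro!: prod_pos)
  have N: "N > 0" using M d k0 by (simp add: N_def)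
  have dM: "d k dvd M" if "k < 2 * n" "k \<noteq> k0" for k
    unfolding M_def using that by (intro dvd_prodI) auto
  have copM: "coprime (d k0) M"
    unfolding M_def using cop k0 by (intro prod_coprime_right) auto
  obtain j where j: "[j = d k0 - 1] (mod d k0)" "[j = 1] (mod M)"
    using binary_chinese_remainder_nat[OF copM] by blast
  have "[j + 1 = (d k0 - 1) + 1] (mod d k0)" using j(1) cong_add cong_refl by blast
  then have j1: "d k0 dvd j + 1" using d[OF k0] by (simp add: cong_0_iff[symmetric] cong_def)
  have "coprime j (d k0)"
    using j1 by (metis coprime_add_one_right coprime_divisors dvd_refl)
  moreover have "coprime j M" using j(2) by (metis cong_imp_coprime cong_sym coprime_1_left)
  ultimately have "coprime j N" by (simp add: N_def)
  moreover have "\<zeta> k ^ N = 1" if "k < 2 * n" for k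
  proof -
    have "d k dvd N" using dM that by (cases "k = k0") (auto simp: N_def)
    then obtain c where "N = d k * c" by blast
    then show ?thesis using \<zeta>[OF that] by (simp add: power_mult)
  qed
  ultimately have "det (double_point_matrix n (\<lambda>k i. complex_of_int (L k i)) (\<lambda>k. \<zeta> k ^ j)) = 0"
    using double_point_matrix_conjugate[OF N _ _ det0] by blast
  moreover have "\<zeta> k ^ j = (\<zeta>(k0 := inverse (\<zeta> k0))) k" if k: "k < 2 * n" for k
  proof (cases "k = k0")
    case True
    obtain c where "j + 1 = d k0 * c" using j1 by blast
    then have "\<zeta> k0 ^ (j + 1) = 1" using \<zeta>[OF k0] by (simp only: power_mult) simp
    then have "\<zeta> k0 * \<zeta> k0 ^ j = 1" by simp
    then show ?thesis using True by (simp add: inverse_unique)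
  next
    case False
    have "[j = 1] (mod d k)" by (rule cong_dvd_modulus_nat[OF j(2) dM[OF k False]])
    then have "j mod d k = 1 mod d k" by (simp add: cong_def)
    moreover have "\<zeta> k ^ i = \<zeta> k ^ (i mod d k)" for i
    proof -
      have "\<zeta> k ^ i = \<zeta> k ^ (i mod d k + d k * (i div d k))" by simp
      also have "\<dots> = \<zeta> k ^ (i mod d k)" using \<zeta>[OF k] by (simp only: power_add power_mult) simp
      finally show ?thesis .
    qed
    ultimately have "\<zeta> k ^ j = \<zeta> k ^ 1" by metis
    then show ?thesis using False by simp
  qed
  then have "double_point_matrix n (\<lambda>k i. complex_of_int (L k i)) (\<lambda>k. \<zeta> k ^ j) =
    double_point_matrix n (\<lambda>k i. complex_of_int (L k i)) (\<zeta>(k0 := inverse (\<zeta> k0)))"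
    unfolding double_point_matrix_def by (intro eq_matI) auto
  ultimately show ?thesis by simp
qed

text \<open>Setting one \<open>\<zeta>\<^sub>k\<^sub>0\<close> with \<open>\<zeta>\<^sub>k\<^sub>0\<^sup>2 \<noteq> 1\<close> equal to \<open>1\<close> gives a nonzero determinant by induction. As an affine
function of \<open>\<zeta>\<^sub>k\<^sub>0\<close> the determinant cannot vanish both at \<open>\<zeta>\<^sub>k\<^sub>0\<close> and at its inverse without vanishing
at \<open>1\<close>.\<close>
lemma double_point_matrix_nonsingular:
  fixes L :: "nat \<Rightarrow> nat \<Rightarrow> int" and d :: "nat \<Rightarrow> nat"
  assumes gp: "general_position n (\<lambda>k i. complex_of_int (L k i))"
    and d: "\<And>k. k < 2 * n \<Longrightarrow> d k > 0"
    and cop: "\<And>k l. k < 2 * n \<Longrightarrow> l < 2 * n \<Longrightarrow> k \<noteq> l \<Longrightarrow> coprime (d k) (d l)"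
    and \<zeta>: "\<And>k. k < 2 * n \<Longrightarrow> \<zeta> k ^ d k = 1"
    and c: "card {k. k < 2 * n \<and> \<zeta> k \<noteq> 1} \<ge> n"
  shows "det (double_point_matrix n (\<lambda>k i. complex_of_int (L k i)) \<zeta>) \<noteq> 0"
  using \<zeta> c
proof (induction "card {k. k < 2 * n \<and> \<zeta> k \<noteq> 1}" arbitrary: \<zeta> rule: less_induct)
  case less
  let ?B = "{k. k < 2 * n \<and> \<zeta> k \<noteq> 1}"
  let ?D = "\<lambda>\<zeta>. det (double_point_matrix n (\<lambda>k i. complex_of_int (L k i)) \<zeta>)"
  show ?case
  proof (cases "card ?B = n")
    case True
    then show ?thesis using double_point_matrix_nonsingular_minimal[OF gp] by blast
  next
    case False
    then have B: "card ?B > n" using less.prems by simp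
    have "card ?B \<le> card {..<2 * n}" by (intro card_mono) auto
    then have "n \<ge> 1" using B by simp
    then have "card ?B \<ge> 2" using B by simp
    then obtain k l where kl: "k \<in> ?B" "l \<in> ?B" "k \<noteq> l"
      by (meson card_2_iff' ex_card subset_iff)
    \<comment> \<open>A root of unity \<open>-1\<close> needs an even exponent, and two coprime exponents are not both even.\<close>
    have "\<zeta> k ^ 2 \<noteq> 1 \<or> \<zeta> l ^ 2 \<noteq> 1"
    proof (rule ccontr)
      assume "\<not> (\<zeta> k ^ 2 \<noteq> 1 \<or> \<zeta> l ^ 2 \<noteq> 1)"
      then have sq: "\<zeta> i ^ 2 = 1" if "i = k \<or> i = l" for i using that by blast
      have ev: "even (d i)" if i: "i = k \<or> i = l" for i
      proof (rule ccontr)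
        assume "odd (d i)"
        then obtain b where "d i = 2 * b + 1" by (elim oddE)
        then have "\<zeta> i ^ d i = \<zeta> i" using sq[OF i] by (simp add: power_mult)
        then show False using less.prems(1)[of i] i kl by auto
      qed
      have "coprime (d k) (d l)" using cop kl by blast
      then show False using ev[of k] ev[of l] by (auto dest: coprime_common_divisor)
    qed
    then obtain k0 where k0: "k0 \<in> ?B" "\<zeta> k0 ^ 2 \<noteq> 1" using kl by blast
    define \<zeta>1 where "\<zeta>1 = \<zeta>(k0 := 1)"
    have B1: "{k. k < 2 * n \<and> \<zeta>1 k \<noteq> 1} = ?B - {k0}" by (auto simp: \<zeta>1_def)
    have "card {k. k < 2 * n \<and> \<zeta>1 k \<noteq> 1} = card ?B - 1"
      unfolding B1 using k0 by (simp add: card_Diff_singleton)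
    then have nz: "?D \<zeta>1 \<noteq> 0"
      using B less.prems(1) by (intro less.hyps) (auto simp: \<zeta>1_def)
    obtain \<alpha> \<beta> where aff: "\<And>s. ?D (\<zeta>(k0 := s)) = \<alpha> * s + \<beta>"
      using double_point_matrix_affine[of k0 n _ \<zeta>] k0 by blast
    show ?thesis
    proof
      assume z: "?D \<zeta> = 0"
      then have "?D (\<zeta>(k0 := inverse (\<zeta> k0))) = 0"
        using less.prems k0 by (intro double_point_matrix_invert_one[OF d cop]) auto
      then have 1: "\<alpha> * inverse (\<zeta> k0) + \<beta> = 0" unfolding aff .
      have 2: "\<alpha> * \<zeta> k0 + \<beta> = 0" using aff[of "\<zeta> k0"] z by simp
      have "\<zeta> k0 \<noteq> 0" using less.prems(1)[of k0] k0 d[of k0] by (auto simp: zero_power)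
      then have "\<zeta> k0 - inverse (\<zeta> k0) \<noteq> 0" using k0(2) by (simp add: field_simps power2_eq_square)
      moreover have "\<alpha> * (\<zeta> k0 - inverse (\<zeta> k0)) = (\<alpha> * \<zeta> k0 + \<beta>) - (\<alpha> * inverse (\<zeta> k0) + \<beta>)"
        by (simp only: right_diff_distrib) simp
      then have "\<alpha> * (\<zeta> k0 - inverse (\<zeta> k0)) = 0" using 1 2 by simp
      ultimately have "\<alpha> = 0" by (simp only: mult_eq_0_iff) blast
      then have "\<beta> = 0" using 2 by simp
      then show False using nz aff[of 1] \<open>\<alpha> = 0\<close> by (simp add: \<zeta>1_def)
    qed
  qed
qed

section \<open>Injectivity of the power map\<close>

definition form_coeff :: "nat \<Rightarrow> rat mat \<Rightarrow> nat \<Rightarrow> nat \<Rightarrow> rat"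
  where "form_coeff n H k j = (if k < n then of_bool (j = k) else H $$ (k - n, j))"

definition lin_form :: "nat \<Rightarrow> rat mat \<Rightarrow> nat \<Rightarrow> (nat \<Rightarrow> complex) \<Rightarrow> complex"
  where "lin_form n H k x = (\<Sum>j<n. of_rat (form_coeff n H k j) * x j)"

lemma lin_form_coordinate: "k < n \<Longrightarrow> lin_form n H k x = x k"
  unfolding lin_form_def form_coeff_def by (subst sum.remove[of _ k]) (auto intro!: sum.neutral)

lemma lin_form_diff: "lin_form n H k (\<lambda>j. x j - y j) = lin_form n H k x - lin_form n H k y"
  by (simp add: lin_form_def right_diff_distrib sum_subtractf)

lemma power_map_eq_lin_form_power:
  assumes "length m = n" "length r = n" "k < 2 * n"
  shows "power_map n H m r x k = lin_form n H k x ^ ((m @ r) ! k)"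
proof (cases "k < n")
  case True
  then show ?thesis using assms by (simp add: power_map_def lin_form_coordinate nth_append)
next
  case False
  then show ?thesis using assms
    by (simp add: power_map_def lin_form_def form_coeff_def nth_append)
qed

lemma bij_betw_pick_card:
  assumes "finite I"
  shows "bij_betw (pick I) {..<card I} I"
proof -
  have "pick I ` {..<card I} \<subseteq> I" using pick_in_set_le by auto
  moreover have "I \<subseteq> pick I ` {..<card I}"
  proof
    fix i assume i: "i \<in> I"
    then have "card {a\<in>I. a < i} < card I" using assms by (intro psubset_card_mono) auto
    then show "i \<in> pick I ` {..<card I}"
      by (intro image_eqI[of _ _ "card {a\<in>I. a < i}"]) (simp_all add: pick_card_in_set[OF i])
  qed
  ultimately have "pick I ` {..<card I} = I" by blast
  then show ?thesis unfolding bij_betw_def by (auto intro: eq_card_imp_inj_on)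
qed

text \<open>Let \<open>n\<close> of the forms vanish at \<open>x\<close>. The coordinate functions among them kill all coordinates outside a
set \<open>J\<close> of indices, and the remaining ones are the rows of \<open>H\<close> in a set \<open>I\<close> of the same size as \<open>J\<close>.
The square submatrix of \<open>H\<close> with rows \<open>I\<close> and columns \<open>J\<close> is invertible, so \<open>x = 0\<close>.\<close>
lemma general_position_forms:
  assumes H: "H \<in> carrier_mat n n" and rk: "all_submatrices_maximal_rank H"
  shows "general_position n (\<lambda>k j. of_rat (form_coeff n H k j))"
  unfolding general_position_def
proof (intro allI impI; elim conjE)
  fix A and x :: "nat \<Rightarrow> complex" and j
  assume A: "A \<subseteq> {..<2 * n}" "card A = n" and j: "j < n"
    and zero: "\<forall>k\<in>A. (\<Sum>j<n. of_rat (form_coeff n H k j) * x j) = 0"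
  define J where "J = {..<n} - A"
  define I where "I = {i. i < n \<and> n + i \<in> A}"
  have fin: "finite A" "finite I" "finite J"
    using A finite_subset by (auto simp: I_def J_def)
  have x0: "x k = 0" if "k < n" "k \<in> A" for k
    using zero that lin_form_coordinate[of k n H x] by (auto simp: lin_form_def)
  have "A = (A \<inter> {..<n}) \<union> ((+) n) ` I"
  proof
    show "A \<subseteq> (A \<inter> {..<n}) \<union> ((+) n) ` I"
    proof
      fix k assume k: "k \<in> A"
      show "k \<in> (A \<inter> {..<n}) \<union> ((+) n) ` I"
      proof (cases "k < n")
        case False
        then have "k - n \<in> I" "k = n + (k - n)" using k A by (auto simp: I_def)
        then show ?thesis by blast
      qed (use k in auto)
    qed
  qed (auto simp: I_def)
  then have "card A = card ((A \<inter> {..<n}) \<union> ((+) n) ` I)" by simp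
  also have "\<dots> = card (A \<inter> {..<n}) + card (((+) n) ` I)"
    using fin by (intro card_Un_disjoint) auto
  also have "card (((+) n) ` I) = card I" by (simp add: card_image)
  finally have "card I = n - card (A \<inter> {..<n})" using A by simp
  also have "\<dots> = card J" unfolding J_def
    by (simp add: card_Diff_subset_Int Int_commute)
  finally have IJ: "card I = card J" .
  show "x j = 0"
  proof (rule ccontr)
    assume xj: "x j \<noteq> 0"
    then have jJ: "j \<in> J" using x0 j by (auto simp: J_def)
    then have ne: "J \<noteq> {}" "I \<noteq> {}" using IJ fin by auto
    have dims: "dim_row H = n" "dim_col H = n" using H by auto
    let ?S = "submatrix H I J"
    have cI: "{i. i < dim_row H \<and> i \<in> I} = I" "{j. j < dim_col H \<and> j \<in> J} = J"
      using dims by (auto simp: I_def J_def)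
    have S: "?S = mat (card J) (card J) (\<lambda>(i, j). H $$ (pick I i, pick J j))"
      unfolding submatrix_def cI IJ ..
    have "I \<subseteq> {..<dim_row H}" "J \<subseteq> {..<dim_col H}" using dims by (auto simp: I_def J_def)
    then have "vec_space.rank (card I) ?S = min (card I) (card J)"
      using rk ne unfolding all_submatrices_maximal_rank_def by blast
    then have "vec_space.rank (card J) ?S = card J" using IJ by simp
    then have "det ?S \<noteq> 0"
      using vec_space.det_rank_iff[of ?S "card J"] unfolding S by auto
    moreover have "det (map_mat of_rat ?S :: complex mat) = of_rat (det ?S)"
      by (rule comm_ring_hom.hom_det) (unfold_locales; simp add: of_rat_add of_rat_mult)
    moreover have "map_mat of_rat ?S = mat (card J) (card J) (\<lambda>(i, j). complex_of_rat (H $$ (pick I i, pick J j)))"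
      unfolding S by (intro eq_matI) auto
    ultimately have "det (mat (card J) (card J) (\<lambda>(i, j). complex_of_rat (H $$ (pick I i, pick J j)))) \<noteq> 0"
      by simp
    moreover have "\<exists>l<card J. x (pick J l) \<noteq> 0"
    proof -
      have "j \<in> pick J ` {..<card J}"
        using bij_betw_pick_card[OF fin(3)] jJ by (simp add: bij_betw_def)
      then obtain l where "l < card J" "pick J l = j" by auto
      then show ?thesis using xj by blast
    qed
    moreover have "(\<Sum>l<card J. complex_of_rat (H $$ (pick I i, pick J l)) * x (pick J l)) = 0"
      if "i < card J" for i
    proof -
      have iI: "pick I i \<in> I" using that IJ pick_in_set_le by auto
      have "(\<Sum>l<card J. complex_of_rat (H $$ (pick I i, pick J l)) * x (pick J l)) =
          (\<Sum>j\<in>J. complex_of_rat (H $$ (pick I i, j)) * x j)"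
        by (rule sum.reindex_bij_betw[OF bij_betw_pick_card[OF fin(3)]])
      also have "\<dots> = (\<Sum>j<n. complex_of_rat (H $$ (pick I i, j)) * x j)"
        by (rule sum.mono_neutral_left) (auto simp: J_def x0)
      also have "\<dots> = (\<Sum>j<n. of_rat (form_coeff n H (n + pick I i) j) * x j)"
        by (simp add: form_coeff_def)
      also have "\<dots> = 0" using iI zero by (simp add: I_def)
      finally show ?thesis .
    qed
    ultimately show False
      unfolding det_eq_0_iff_kernel by (elim notE, intro exI[of _ "\<lambda>l. x (pick J l)"]) simp
  qed
qed

lemma common_denominator:
  fixes q :: "nat \<Rightarrow> nat \<Rightarrow> rat"
  shows "\<exists>c::int. c \<noteq> 0 \<and> (\<forall>k<K. \<forall>j<n. \<exists>z. of_int c * q k j = of_int z)"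
proof -
  define D where "D p = snd (quotient_of (q (fst p) (snd p)))" for p
  define c where "c = prod D ({..<K} \<times> {..<n})"
  have Dpos: "D p > 0" for p
    unfolding D_def by (rule quotient_of_denom_pos[OF prod.collapse[symmetric]])
  have "\<exists>z. of_int c * q k j = of_int z" if "k < K" "j < n" for k j
  proof -
    have "D (k, j) dvd c" unfolding c_def using that by (intro dvd_prodI) auto
    then obtain e where e: "c = D (k, j) * e" by blast
    have "q k j = of_int (fst (quotient_of (q k j))) / of_int (D (k, j))"
      unfolding D_def fst_conv snd_conv by (rule quotient_of_div[OF prod.collapse[symmetric]])
    then have "of_int c * q k j = of_int (e * fst (quotient_of (q k j)))"
      using Dpos[of "(k, j)"] unfolding e by (simp add: field_simps)
    then show ?thesis by blast
  qed
  moreover have "c \<noteq> 0" unfolding c_def using Dpos by (simp add: less_imp_neq[symmetric])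
  ultimately show ?thesis by blast
qed

lemma equal_powers_imp_root_of_unity_multiple:
  fixes d :: nat
  assumes "u ^ d = (v :: complex) ^ d" "d > 0"
  shows "\<exists>\<zeta>. \<zeta> ^ d = 1 \<and> v = \<zeta> * u"
proof (cases "u = 0")
  case True
  then show ?thesis using assms by (intro exI[of _ 1]) (auto simp: zero_power)
next
  case False
  then have "(v / u) ^ d = 1" using assms(1) by (simp add: power_divide flip: assms(1))
  then show ?thesis using False by (intro exI[of _ "v / u"]) simp
qed

text \<open>The rational forms are multiplied by a common denominator, which changes neither the solutions of the
double point equations nor general position, so that the result for integer forms applies.\<close>
lemma power_map_injective:
  assumes H: "H \<in> carrier_mat n n" and rk: "all_submatrices_maximal_rank H"
    and len: "length m = n" "length r = n"
    and pos: "\<forall>k < length (m @ r). (m @ r) ! k > 0"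
    and cop: "\<forall>k < length (m @ r). \<forall>l < length (m @ r). k \<noteq> l \<longrightarrow> coprime ((m @ r) ! k) ((m @ r) ! l)"
    and x: "x \<in> Cspace n" "x' \<in> Cspace n" and eq: "power_map n H m r x = power_map n H m r x'"
  shows "x = x'"
proof -
  define d where "d k = (m @ r) ! k" for k
  have d: "d k > 0" if "k < 2 * n" for k using pos len that by (simp add: d_def)
  have dcop: "coprime (d k) (d l)" if "k < 2 * n" "l < 2 * n" "k \<noteq> l" for k l
    using cop len that by (simp add: d_def)
  have "lin_form n H k x ^ d k = lin_form n H k x' ^ d k" if "k < 2 * n" for k
    using arg_cong[OF eq, of "\<lambda>y. y k"] power_map_eq_lin_form_power[OF len that] by (simp add: d_def)
  then have "\<exists>\<zeta>. \<zeta> ^ d k = 1 \<and> lin_form n H k x' = \<zeta> * lin_form n H k x" if "k < 2 * n" for k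
    using equal_powers_imp_root_of_unity_multiple d that by blast
  then obtain \<zeta> where \<zeta>: "\<And>k. k < 2 * n \<Longrightarrow> \<zeta> k ^ d k = 1"
      "\<And>k. k < 2 * n \<Longrightarrow> lin_form n H k x' = \<zeta> k * lin_form n H k x"
    by metis
  define w where "w j = x' j - x j" for j
  have w: "lin_form n H k w = (\<zeta> k - 1) * lin_form n H k x" if "k < 2 * n" for k
    unfolding w_def lin_form_diff \<zeta>(2)[OF that] by (simp add: algebra_simps)
  have gp: "general_position n (\<lambda>k j. of_rat (form_coeff n H k j))"
    by (rule general_position_forms[OF H rk])
  let ?B = "{k. k < 2 * n \<and> \<zeta> k \<noteq> 1}"
  have "\<forall>j<n. w j = 0"
  proof (cases "card ?B \<ge> n")
    case True
    obtain c :: int where c: "c \<noteq> 0" "\<forall>k<2 * n. \<forall>j<n. \<exists>z. of_int c * form_coeff n H k j = of_int z"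
      using common_denominator by blast
    then obtain L where L: "\<And>k j. k < 2 * n \<Longrightarrow> j < n \<Longrightarrow> of_int c * form_coeff n H k j = of_int (L k j)"
      by metis
    have LL: "(\<Sum>j<n. complex_of_int (L k j) * y j) = of_int c * lin_form n H k y" if "k < 2 * n" for k y
    proof -
      have "complex_of_int (L k j) = of_int c * of_rat (form_coeff n H k j)" if "j < n" for j
        using arg_cong[OF L[OF \<open>k < 2 * n\<close> that], of complex_of_rat] by (simp add: of_rat_mult)
      then show ?thesis unfolding lin_form_def sum_distrib_left
        by (intro sum.cong) (auto simp: mult.assoc)
    qed
    have gpL: "general_position n (\<lambda>k j. complex_of_int (L k j))"
      unfolding general_position_def
    proof (intro allI impI; elim conjE)
      fix A y j assume "A \<subseteq> {..<2 * n}" "card A = n" "j < n"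
        "\<forall>k\<in>A. (\<Sum>j<n. complex_of_int (L k j) * y j) = 0"
      note A = this
      then have zero: "\<forall>k\<in>A. lin_form n H k y = 0"
        using LL c(1) by (auto simp: subset_iff)
      show "y j = 0"
        by (rule general_positionD[OF gp A(1,2) _ A(3)]) (use zero in \<open>simp add: lin_form_def\<close>)
    qed
    have "det (double_point_matrix n (\<lambda>k i. complex_of_int (L k i)) \<zeta>) \<noteq> 0"
      by (rule double_point_matrix_nonsingular[OF gpL d dcop \<zeta>(1) True])
    moreover have "(\<Sum>j<n. complex_of_int (L k j) * w j) =
        (\<zeta> k - 1) * (\<Sum>j<n. complex_of_int (L k j) * x j)" if "k < 2 * n" for k
      unfolding LL[OF that] w[OF that] by simp
    ultimately show ?thesis unfolding double_point_matrix_singular_iff by blast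
  next
    case False
    have "card ({..<2 * n} - ?B) = 2 * n - card ?B"
      by (subst card_Diff_subset) auto
    then have "n \<le> card ({..<2 * n} - ?B)" using False by linarith
    then obtain A where A: "A \<subseteq> {..<2 * n} - ?B" "card A = n"
      by (rule obtain_subset_with_card_n)
    have zero: "lin_form n H k w = 0" if "k \<in> A" for k
      using A(1) that w[of k] by auto
    show ?thesis
    proof (intro allI impI)
      fix j assume "j < n"
      then show "w j = 0" using A(1) zero
        by (intro general_positionD[OF gp _ A(2), of w]) (auto simp: lin_form_def)
    qed
  qed
  then have "x j = x' j" for j
    using x by (cases "j < n") (auto simp: w_def Cspace_def)
  then show ?thesis by (rule ext)
qed

section \<open>Weighted distances on complex coordinate space\<close>

text \<open>A weighted sum distance. All positive weights give the usual topology and the same derivatives;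
being able to choose them is what makes the perturbation \<open>\<Psi> - id\<close> of an unfolding a contraction.\<close>
definition wdist :: "(nat \<Rightarrow> real) \<Rightarrow> nat \<Rightarrow> (nat \<Rightarrow> complex) \<Rightarrow> (nat \<Rightarrow> complex) \<Rightarrow> real"
  where "wdist w d x y = (\<Sum>i<d. w i * cmod (y i - x i))"

definition positive_weights :: "nat \<Rightarrow> (nat \<Rightarrow> real) \<Rightarrow> bool"
  where "positive_weights d w \<longleftrightarrow> (\<forall>i<d. w i > 0)"

lemma positive_weights_one [simp]: "positive_weights d (\<lambda>_. 1)"
  by (simp add: positive_weights_def)

lemma wdist_nonneg: "positive_weights d w \<Longrightarrow> wdist w d x y \<ge> 0"
  unfolding wdist_def positive_weights_def by (intro sum_nonneg) (simp add: less_imp_le)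

lemma wdist_commute: "wdist w d x y = wdist w d y x"
  by (simp add: wdist_def norm_minus_commute)

lemma wdist_same [simp]: "wdist w d x x = 0"
  by (simp add: wdist_def)

lemma wdist_triangle:
  assumes "positive_weights d w"
  shows "wdist w d x z \<le> wdist w d x y + wdist w d y z"
  unfolding wdist_def sum.distrib[symmetric]
proof (rule sum_mono)
  fix i assume "i \<in> {..<d}"
  then have "w i \<ge> 0" using assms by (simp add: positive_weights_def less_imp_le)
  moreover have "cmod (z i - x i) \<le> cmod (y i - x i) + cmod (z i - y i)"
    using norm_triangle_ineq[of "y i - x i" "z i - y i"] by simp
  ultimately show "w i * cmod (z i - x i) \<le> w i * cmod (y i - x i) + w i * cmod (z i - y i)"
    by (metis distrib_left mult_left_mono)
qed

lemma coordinate_le_wdist: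
  assumes w: "positive_weights d w" and "i < d"
  shows "w i * cmod (y i - x i) \<le> wdist w d x y"
  unfolding wdist_def using assms
  by (intro member_le_sum[of i "{..<d}" "\<lambda>i. w i * cmod (y i - x i)"])
     (auto simp: positive_weights_def less_imp_le)

lemma wdist_eq_0_imp_eq:
  assumes w: "positive_weights d w" and x: "x \<in> Cspace d" "y \<in> Cspace d" and 0: "wdist w d x y \<le> 0"
  shows "x = y"
proof
  fix i show "x i = y i"
  proof (cases "i < d")
    case True
    then have "w i * cmod (y i - x i) \<le> 0" using coordinate_le_wdist[OF w True, of y x] 0 by linarith
    moreover have "w i > 0" using w True by (simp add: positive_weights_def)
    ultimately show ?thesis by (simp add: mult_le_0_iff)
  qed (use x in \<open>simp add: Cspace_def\<close>)
qed

lemma wdist_le_L2_set: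
  assumes "positive_weights d w"
  shows "wdist w d x y \<le> (\<Sum>i<d. w i) * L2_set (\<lambda>i. cmod (y i - x i)) {..<d}"
  unfolding wdist_def sum_distrib_right
  using assms by (intro sum_mono mult_left_mono member_le_L2_set) (auto simp: positive_weights_def less_imp_le)

lemma L2_set_le_wdist:
  assumes w: "positive_weights d w"
  shows "L2_set (\<lambda>i. cmod (y i - x i)) {..<d} \<le> (\<Sum>i<d. 1 / w i) * wdist w d x y"
proof -
  have "L2_set (\<lambda>i. cmod (y i - x i)) {..<d} \<le> (\<Sum>i<d. cmod (y i - x i))"
    by (rule L2_set_le_sum) simp
  also have "\<dots> \<le> (\<Sum>i<d. 1 / w i * wdist w d x y)"
  proof (rule sum_mono)
    fix i assume "i \<in> {..<d}"
    then have "w i > 0" "w i * cmod (y i - x i) \<le> wdist w d x y"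
      using coordinate_le_wdist[OF w, of i y x] w by (auto simp: positive_weights_def)
    then show "cmod (y i - x i) \<le> 1 / w i * wdist w d x y" by (simp add: field_simps)
  qed
  finally show ?thesis by (simp add: sum_distrib_right)
qed

text \<open>An open set of the product topology restricts only finitely many coordinates of a point, and on
\<open>Cspace d\<close> the coordinates from \<open>d\<close> on are constant.\<close>
lemma open_in_C_iff:
  assumes w: "positive_weights d w"
  shows "open_in_C d U \<longleftrightarrow> U \<subseteq> Cspace d \<and>
    (\<forall>x\<in>U. \<exists>e>0. \<forall>y\<in>Cspace d. wdist w d x y < e \<longrightarrow> y \<in> U)"
proof (intro iffI conjI ballI)
  assume U: "open_in_C d U"
  then show "U \<subseteq> Cspace d" using openin_imp_subset by blast
  fix x assume x: "x \<in> U"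
  obtain T where T: "open T" "U = Cspace d \<inter> T"
    using U by (auto simp: openin_open)
  have "openin (product_topology (\<lambda>_. euclidean) UNIV) T"
    using T(1) by (simp add: euclidean_product_topology)
  then obtain X where X: "finite {i. X i \<noteq> (UNIV :: complex set)}" "\<And>i. open (X i)"
      "x \<in> Pi\<^sub>E UNIV X" "Pi\<^sub>E UNIV X \<subseteq> T"
    using x T(2) unfolding openin_product_topology_alt by auto
  have "\<exists>e>0. ball (x i) e \<subseteq> X i" for i
    using X(2)[of i] X(3) by (auto simp: open_contains_ball PiE_def)
  then obtain e where e: "\<And>i. e i > 0" "\<And>i. ball (x i) (e i) \<subseteq> X i" by metis
  define E where "E = Min (insert 1 ((\<lambda>i. w i * e i) ` {..<d}))"
  have "E > 0" unfolding E_def using e w by (subst Min_gr_iff) (auto simp: positive_weights_def)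
  moreover have "y \<in> U" if y: "y \<in> Cspace d" "wdist w d x y < E" for y
  proof -
    have "y i \<in> X i" for i
    proof (cases "i < d")
      case True
      have wi: "w i > 0" using w True by (simp add: positive_weights_def)
      have "w i * cmod (y i - x i) < E" using coordinate_le_wdist[OF w True, of y x] y(2) by linarith
      also have "E \<le> w i * e i" unfolding E_def using True by (intro Min_le) auto
      finally have "cmod (y i - x i) < e i" using wi by simp
      then have "y i \<in> ball (x i) (e i)" by (simp add: dist_norm norm_minus_commute)
      then show ?thesis using e(2) by blast
    next
      case False
      then have "y i = x i" using y x T by (auto simp: Cspace_def)
      then show ?thesis using X(3) by (auto simp: PiE_def)
    qed
    then have "y \<in> T" using X(4) by (auto simp: PiE_def)
    then show ?thesis using y T by simp
  qed
  ultimately show "\<exists>e>0. \<forall>y\<in>Cspace d. wdist w d x y < e \<longrightarrow> y \<in> U" by blast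
next
  assume U: "U \<subseteq> Cspace d \<and> (\<forall>x\<in>U. \<exists>e>0. \<forall>y\<in>Cspace d. wdist w d x y < e \<longrightarrow> y \<in> U)"
  show "open_in_C d U"
  proof (subst openin_subopen, intro ballI)
    fix x assume x: "x \<in> U"
    then obtain e where e: "e > 0" "\<And>y. y \<in> Cspace d \<Longrightarrow> wdist w d x y < e \<Longrightarrow> y \<in> U"
      using U by blast
    have "continuous_on UNIV (\<lambda>y. wdist w d x y)"
      unfolding wdist_def by (intro continuous_intros continuous_on_product_coordinates)
    then have "open {y. wdist w d x y < e}"
      by (intro open_Collect_less continuous_on_const) 
    then have "open_in_C d (Cspace d \<inter> {y. wdist w d x y < e})"
      by (rule openin_open_Int)
    moreover have "x \<in> Cspace d \<inter> {y. wdist w d x y < e}" using x U e by auto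
    moreover have "Cspace d \<inter> {y. wdist w d x y < e} \<subseteq> U" using e by auto
    ultimately show "\<exists>T. open_in_C d T \<and> x \<in> T \<and> T \<subseteq> U" by blast
  qed
qed

definition wball :: "(nat \<Rightarrow> real) \<Rightarrow> nat \<Rightarrow> (nat \<Rightarrow> complex) \<Rightarrow> real \<Rightarrow> (nat \<Rightarrow> complex) set"
  where "wball w d x e = {y \<in> Cspace d. wdist w d x y < e}"

lemma open_in_C_wball:
  assumes w: "positive_weights d w"
  shows "open_in_C d (wball w d x e)"
  unfolding open_in_C_iff[OF w]
proof (intro conjI ballI)
  fix y assume y: "y \<in> wball w d x e"
  show "\<exists>e'>0. \<forall>z\<in>Cspace d. wdist w d y z < e' \<longrightarrow> z \<in> wball w d x e"
  proof (intro exI[of _ "e - wdist w d x y"] conjI ballI impI)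
    fix z assume "z \<in> Cspace d" "wdist w d y z < e - wdist w d x y"
    then show "z \<in> wball w d x e"
      using wdist_triangle[OF w, of x z y] by (simp add: wball_def)
  qed (use y in \<open>simp add: wball_def\<close>)
qed (auto simp: wball_def)

lemma open_in_C_contains_wball:
  assumes "positive_weights d w" "open_in_C d U" "x \<in> U"
  obtains e where "e > 0" "wball w d x e \<subseteq> U"
  using assms unfolding open_in_C_iff[OF assms(1)] wball_def by blast

lemma eventually_at_Cspace:
  assumes w: "positive_weights d w" and x: "x \<in> Cspace d"
  shows "(\<forall>\<^sub>F y in at x within Cspace d. P y) \<longleftrightarrow>
    (\<exists>e>0. \<forall>y\<in>wball w d x e. y \<noteq> x \<longrightarrow> P y)"
proof
  assume "\<forall>\<^sub>F y in at x within Cspace d. P y"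
  then obtain T where T: "open T" "x \<in> T" "\<forall>y\<in>T. y \<noteq> x \<longrightarrow> y \<in> Cspace d \<longrightarrow> P y"
    by (auto simp: eventually_at_topological)
  have "open_in_C d (Cspace d \<inter> T)" using T(1) by (rule openin_open_Int)
  then obtain e where "e > 0" "wball w d x e \<subseteq> Cspace d \<inter> T"
    using open_in_C_contains_wball[OF w] x T(2) by blast
  then show "\<exists>e>0. \<forall>y\<in>wball w d x e. y \<noteq> x \<longrightarrow> P y" using T(3) by blast
next
  assume "\<exists>e>0. \<forall>y\<in>wball w d x e. y \<noteq> x \<longrightarrow> P y"
  then obtain e where e: "e > 0" "\<forall>y\<in>wball w d x e. y \<noteq> x \<longrightarrow> P y" by blast
  obtain T where T: "open T" "wball w d x e = Cspace d \<inter> T"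
    using open_in_C_wball[OF w, of x e] by (auto simp: openin_open)
  have "x \<in> wball w d x e" using e x by (simp add: wball_def)
  then show "\<forall>\<^sub>F y in at x within Cspace d. P y"
    using T e by (auto simp: eventually_at_topological intro!: exI[of _ T])
qed

text \<open>The Frechet derivative, with \<open>L\<close> as its vector of partial derivatives. It is spelled out in terms of the
weighted distance because the type of all sequences carries no norm.\<close>
definition has_C_derivative :: "(nat \<Rightarrow> real) \<Rightarrow> nat \<Rightarrow> ((nat \<Rightarrow> complex) \<Rightarrow> complex)
    \<Rightarrow> (nat \<Rightarrow> complex) \<Rightarrow> (nat \<Rightarrow> complex) \<Rightarrow> bool"
  where "has_C_derivative w d g L x \<longleftrightarrow> (\<forall>e>0. \<exists>\<delta>>0. \<forall>y\<in>wball w d x \<delta>.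
    cmod (g y - g x - (\<Sum>i<d. L i * (y i - x i))) \<le> e * wdist w d x y)"

text \<open>The Euclidean length of \<open>y - x\<close> and the weighted distance bound each other up to constants.\<close>
lemma complex_differentiable_at_iff:
  assumes w: "positive_weights d w" and x: "x \<in> Cspace d"
  shows "complex_differentiable_at d g x \<longleftrightarrow> (\<exists>L. has_C_derivative w d g L x)"
proof -
  have "((\<lambda>y. (g y - g x - (\<Sum>i<d. L i * (y i - x i)))
             / of_real (L2_set (\<lambda>i. cmod (y i - x i)) {..<d})) \<longlongrightarrow> 0) (at x within Cspace d)
    \<longleftrightarrow> has_C_derivative w d g L x" (is "?lhs \<longleftrightarrow> _") for L
  proof -
    define R where "R y = g y - g x - (\<Sum>i<d. L i * (y i - x i))" for y
    define N where "N y = L2_set (\<lambda>i. cmod (y i - x i)) {..<d}" for y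
    define a where "a = (\<Sum>i<d. w i) + 1"
    define b where "b = (\<Sum>i<d. 1 / w i) + 1"
    have ge: "(\<Sum>i<d. w i) \<ge> 0" "(\<Sum>i<d. 1 / w i) \<ge> 0"
      using w by (auto intro!: sum_nonneg simp: positive_weights_def less_imp_le)
    then have ab: "a > 0" "b > 0" by (auto simp: a_def b_def)
    have N0: "N y \<ge> 0" for y by (simp add: N_def)
    have Na: "wdist w d x y \<le> a * N y" for y
      using wdist_le_L2_set[OF w, of x y] N0[of y] unfolding a_def N_def distrib_right by linarith
    have Nb: "N y \<le> b * wdist w d x y" for y
      using L2_set_le_wdist[OF w, of y x] wdist_nonneg[OF w, of x y] unfolding b_def N_def distrib_right by linarith
    have Npos: "N y > 0" if "y \<in> Cspace d" "y \<noteq> x" for y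
    proof (rule ccontr)
      assume "\<not> N y > 0"
      then have "wdist w d x y \<le> 0" using Na[of y] ab N0[of y] by simp
      then show False using wdist_eq_0_imp_eq[OF w x that(1)] that(2) by blast
    qed
    have Rx: "R x = 0" by (simp add: R_def)
    have "?lhs \<longleftrightarrow> (\<forall>e>0. \<exists>\<delta>>0. \<forall>y\<in>wball w d x \<delta>. y \<noteq> x \<longrightarrow> cmod (R y / of_real (N y)) < e)"
      unfolding tendsto_iff eventually_at_Cspace[OF w x] by (simp add: dist_norm R_def N_def)
    also have "\<dots> \<longleftrightarrow> (\<forall>e>0. \<exists>\<delta>>0. \<forall>y\<in>wball w d x \<delta>. cmod (R y) \<le> e * wdist w d x y)"
    proof (intro iffI allI impI)
      fix e :: real assume e: "e > 0"
      assume "\<forall>e>0. \<exists>\<delta>>0. \<forall>y\<in>wball w d x \<delta>. y \<noteq> x \<longrightarrow> cmod (R y / of_real (N y)) < e"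
      then obtain \<delta> where \<delta>: "\<delta> > 0" "\<forall>y\<in>wball w d x \<delta>. y \<noteq> x \<longrightarrow> cmod (R y / of_real (N y)) < e / b"
        using e ab by (metis divide_pos_pos)
      have "cmod (R y) \<le> e * wdist w d x y" if y: "y \<in> wball w d x \<delta>" for y
      proof (cases "y = x")
        case False
        then have "N y > 0" using Npos y by (simp add: wball_def)
        then have "cmod (R y) < e / b * N y" using \<delta>(2) y False by (auto simp: norm_divide field_simps)
        also have "\<dots> \<le> e / b * (b * wdist w d x y)" using e ab by (intro mult_left_mono Nb) auto
        finally show ?thesis using ab by simp
      qed (simp add: Rx)
      then show "\<exists>\<delta>>0. \<forall>y\<in>wball w d x \<delta>. cmod (R y) \<le> e * wdist w d x y" using \<delta>(1) by blast
    next
      fix e :: real assume e: "e > 0"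
      assume "\<forall>e>0. \<exists>\<delta>>0. \<forall>y\<in>wball w d x \<delta>. cmod (R y) \<le> e * wdist w d x y"
      moreover have "e / (2 * a) > 0" using e ab by simp
      ultimately obtain \<delta> where \<delta>: "\<delta> > 0" "\<forall>y\<in>wball w d x \<delta>. cmod (R y) \<le> e / (2 * a) * wdist w d x y"
        by blast
      have "cmod (R y / of_real (N y)) < e" if y: "y \<in> wball w d x \<delta>" "y \<noteq> x" for y
      proof -
        have N: "N y > 0" using Npos y by (simp add: wball_def)
        have "cmod (R y) \<le> e / (2 * a) * (a * N y)"
          using \<delta>(2) y Na[of y] e ab by (meson divide_nonneg_pos less_imp_le mult_left_mono order_trans zero_less_mult_iff zero_less_numeral)
        also have "\<dots> = e / 2 * N y" using ab by simp
        also have "\<dots> < e * N y" using e N by simp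
        finally show ?thesis using N by (simp add: norm_divide field_simps)
      qed
      then show "\<exists>\<delta>>0. \<forall>y\<in>wball w d x \<delta>. y \<noteq> x \<longrightarrow> cmod (R y / of_real (N y)) < e"
        using \<delta>(1) by blast
    qed
    finally show ?thesis by (simp add: has_C_derivative_def R_def)
  qed
  then show ?thesis unfolding complex_differentiable_at_def by blast
qed

section \<open>Calculus of complex derivatives\<close>

lemma wballI: "y \<in> Cspace d \<Longrightarrow> wdist w d x y < e \<Longrightarrow> y \<in> wball w d x e"
  by (simp add: wball_def)

lemma wball_mono: "e \<le> e' \<Longrightarrow> wball w d x e \<subseteq> wball w d x e'"
  by (auto simp: wball_def)

lemma has_C_derivativeE:
  assumes "has_C_derivative w d g L x" "e > 0"
  obtains \<delta> where "\<delta> > 0"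
    "\<forall>y\<in>wball w d x \<delta>. cmod (g y - g x - (\<Sum>i<d. L i * (y i - x i))) \<le> e * wdist w d x y"
  using assms unfolding has_C_derivative_def by blast

lemma has_C_derivative_const: "has_C_derivative w d (\<lambda>_. c) (\<lambda>_. 0) x" if "positive_weights d w"
  unfolding has_C_derivative_def using wdist_nonneg[OF that]
  by (intro allI impI exI[of _ 1]) simp

lemma has_C_derivative_coordinate:
  assumes "positive_weights d w" and i: "i < d"
  shows "has_C_derivative w d (\<lambda>y. y i) (\<lambda>j. of_bool (j = i)) x"
proof -
  have "(\<Sum>j<d. of_bool (j = i) * (y j - x j)) = y i - x i" for y
    using i by (subst sum.remove[of _ i]) (auto intro!: sum.neutral)
  then show ?thesis
    unfolding has_C_derivative_def using wdist_nonneg[OF assms(1)]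
    by (intro allI impI exI[of _ 1]) simp
qed

lemma has_C_derivative_add:
  assumes "has_C_derivative w d f A x" "has_C_derivative w d g B x"
  shows "has_C_derivative w d (\<lambda>y. f y + g y) (\<lambda>i. A i + B i) x"
  unfolding has_C_derivative_def
proof (intro allI impI)
  fix e :: real assume "e > 0"
  then have "e / 2 > 0" by simp
  then obtain \<delta>1 \<delta>2 where
    \<delta>1: "\<delta>1 > 0" "\<forall>y\<in>wball w d x \<delta>1. cmod (f y - f x - (\<Sum>i<d. A i * (y i - x i))) \<le> e / 2 * wdist w d x y" and
    \<delta>2: "\<delta>2 > 0" "\<forall>y\<in>wball w d x \<delta>2. cmod (g y - g x - (\<Sum>i<d. B i * (y i - x i))) \<le> e / 2 * wdist w d x y"
    using assms unfolding has_C_derivative_def by blast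
  have "cmod (f y + g y - (f x + g x) - (\<Sum>i<d. (A i + B i) * (y i - x i))) \<le> e * wdist w d x y"
    if y: "y \<in> wball w d x (min \<delta>1 \<delta>2)" for y
  proof -
    have "f y + g y - (f x + g x) - (\<Sum>i<d. (A i + B i) * (y i - x i)) =
        (f y - f x - (\<Sum>i<d. A i * (y i - x i))) + (g y - g x - (\<Sum>i<d. B i * (y i - x i)))"
      by (simp add: distrib_right sum.distrib)
    also have "cmod \<dots> \<le> e / 2 * wdist w d x y + e / 2 * wdist w d x y"
      using y \<delta>1(2) \<delta>2(2) by (intro norm_triangle_mono) (auto simp: wball_def)
    finally show ?thesis by simp
  qed
  then show "\<exists>\<delta>>0. \<forall>y\<in>wball w d x \<delta>. cmod (f y + g y - (f x + g x) - (\<Sum>i<d. (A i + B i) * (y i - x i)))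
      \<le> e * wdist w d x y"
    using \<delta>1 \<delta>2 by (intro exI[of _ "min \<delta>1 \<delta>2"]) auto
qed

lemma has_C_derivative_lipschitz:
  assumes w: "positive_weights d w" and g: "has_C_derivative w d g L x"
  obtains C \<delta> where "C > 0" "\<delta> > 0" "\<forall>y\<in>wball w d x \<delta>. cmod (g y - g x) \<le> C * wdist w d x y"
proof -
  have one: "(0 :: real) < 1" by simp
  obtain \<delta> where \<delta>: "\<delta> > 0"
    "\<forall>y\<in>wball w d x \<delta>. cmod (g y - g x - (\<Sum>i<d. L i * (y i - x i))) \<le> 1 * wdist w d x y"
    by (rule has_C_derivativeE[OF g one])
  define C where "C = 1 + (\<Sum>i<d. cmod (L i) / w i)"
  have "(\<Sum>i<d. cmod (L i) / w i) \<ge> 0"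
    using w by (intro sum_nonneg) (auto simp: positive_weights_def less_imp_le)
  then have "C > 0" by (simp add: C_def)
  moreover have "cmod (g y - g x) \<le> C * wdist w d x y" if y: "y \<in> wball w d x \<delta>" for y
  proof -
    have "cmod (\<Sum>i<d. L i * (y i - x i)) \<le> (\<Sum>i<d. cmod (L i) / w i * wdist w d x y)"
    proof (rule sum_norm_le)
      fix i assume "i \<in> {..<d}"
      then have i: "w i > 0" "w i * cmod (y i - x i) \<le> wdist w d x y"
        using coordinate_le_wdist[OF w, of i y x] w by (auto simp: positive_weights_def)
      have "cmod (L i * (y i - x i)) = cmod (L i) / w i * (w i * cmod (y i - x i))"
        using i(1) by (simp add: norm_mult)
      also have "\<dots> \<le> cmod (L i) / w i * wdist w d x y"
        using i by (intro mult_left_mono) auto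
      finally show "cmod (L i * (y i - x i)) \<le> cmod (L i) / w i * wdist w d x y" .
    qed
    then have 1: "cmod (\<Sum>i<d. L i * (y i - x i)) \<le> (\<Sum>i<d. cmod (L i) / w i) * wdist w d x y"
      by (simp only: sum_distrib_right)
    have 2: "cmod (g y - g x - (\<Sum>i<d. L i * (y i - x i))) \<le> wdist w d x y"
      using \<delta>(2) y by simp
    have "cmod (g y - g x) \<le> cmod (g y - g x - (\<Sum>i<d. L i * (y i - x i))) + cmod (\<Sum>i<d. L i * (y i - x i))"
      using norm_triangle_ineq[of "g y - g x - (\<Sum>i<d. L i * (y i - x i))" "\<Sum>i<d. L i * (y i - x i)"] by simp
    also have "\<dots> \<le> C * wdist w d x y" using 1 2 unfolding C_def distrib_right by linarith
    finally show ?thesis .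
  qed
  ultimately show thesis using \<delta>(1) by (intro that[of C \<delta>]) auto
qed

lemma has_C_derivative_compose_field:
  assumes w: "positive_weights d w" and g: "has_C_derivative w d g L x"
    and \<phi>: "(\<phi> has_field_derivative D) (at (g x))"
  shows "has_C_derivative w d (\<lambda>y. \<phi> (g y)) (\<lambda>i. D * L i) x"
  unfolding has_C_derivative_def
proof (intro allI impI)
  fix e :: real assume e: "e > 0"
  obtain C \<delta>1 where C: "C > 0" "\<delta>1 > 0" "\<forall>y\<in>wball w d x \<delta>1. cmod (g y - g x) \<le> C * wdist w d x y"
    by (rule has_C_derivative_lipschitz[OF w g])
  define e1 where "e1 = e / (2 * C)"
  define e2 where "e2 = e / (2 * (cmod D + 1))"
  have e12: "e1 > 0" "e2 > 0"
    using e C(1) by (auto simp: e1_def e2_def intro!: divide_pos_pos mult_pos_pos add_nonneg_pos)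
  obtain \<delta>2 where \<delta>2: "\<delta>2 > 0"
    "\<forall>z. cmod (z - g x) < \<delta>2 \<longrightarrow> cmod (\<phi> z - \<phi> (g x) - D * (z - g x)) \<le> e1 * cmod (z - g x)"
    using \<phi> e12(1) unfolding has_field_derivative_def has_derivative_at_alt by blast
  obtain \<delta>3 where \<delta>3: "\<delta>3 > 0"
    "\<forall>y\<in>wball w d x \<delta>3. cmod (g y - g x - (\<Sum>i<d. L i * (y i - x i))) \<le> e2 * wdist w d x y"
    by (rule has_C_derivativeE[OF g e12(2)])
  define \<delta> where "\<delta> = min (min \<delta>1 \<delta>3) (\<delta>2 / C)"
  have "cmod (\<phi> (g y) - \<phi> (g x) - (\<Sum>i<d. D * L i * (y i - x i))) \<le> e * wdist w d x y"
    if y: "y \<in> wball w d x \<delta>" for y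
  proof -
    have y': "y \<in> wball w d x \<delta>1" "y \<in> wball w d x \<delta>3" "wdist w d x y < \<delta>2 / C"
      using y by (auto simp: wball_def \<delta>_def)
    have gy: "cmod (g y - g x) \<le> C * wdist w d x y" using C(3) y' by blast
    also have "\<dots> < \<delta>2" using y'(3) C(1) by (simp add: field_simps)
    finally have "cmod (\<phi> (g y) - \<phi> (g x) - D * (g y - g x)) \<le> e1 * cmod (g y - g x)"
      using \<delta>2(2) by blast
    also have "\<dots> \<le> e1 * (C * wdist w d x y)" using gy e12 by (intro mult_left_mono) auto
    also have "\<dots> = e / 2 * wdist w d x y" using C(1) by (simp add: e1_def)
    finally have 1: "cmod (\<phi> (g y) - \<phi> (g x) - D * (g y - g x)) \<le> e / 2 * wdist w d x y" .
    have "cmod (D * (g y - g x - (\<Sum>i<d. L i * (y i - x i)))) \<le> (cmod D + 1) * (e2 * wdist w d x y)"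
      unfolding norm_mult using \<delta>3(2) y'(2) by (intro mult_mono) auto
    also have "\<dots> = e / 2 * wdist w d x y"
      using add_nonneg_pos[of "cmod D" 1] by (simp add: e2_def field_simps)
    finally have 2: "cmod (D * (g y - g x - (\<Sum>i<d. L i * (y i - x i)))) \<le> e / 2 * wdist w d x y" .
    have "\<phi> (g y) - \<phi> (g x) - (\<Sum>i<d. D * L i * (y i - x i)) =
        (\<phi> (g y) - \<phi> (g x) - D * (g y - g x)) + D * (g y - g x - (\<Sum>i<d. L i * (y i - x i)))"
      by (simp add: right_diff_distrib sum_distrib_left mult.assoc)
    also have "cmod \<dots> \<le> e / 2 * wdist w d x y + e / 2 * wdist w d x y"
      by (rule norm_triangle_mono[OF 1 2])
    finally show ?thesis by simp
  qed
  moreover have "\<delta> > 0" using C \<delta>2 \<delta>3 by (simp add: \<delta>_def)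
  ultimately show "\<exists>\<delta>>0. \<forall>y\<in>wball w d x \<delta>.
      cmod (\<phi> (g y) - \<phi> (g x) - (\<Sum>i<d. D * L i * (y i - x i))) \<le> e * wdist w d x y" by blast
qed

lemma has_C_derivative_cmult:
  assumes w: "positive_weights d w" and g: "has_C_derivative w d g L x"
  shows "has_C_derivative w d (\<lambda>y. c * g y) (\<lambda>i. c * L i) x"
  by (rule has_C_derivative_compose_field[OF w g]) (auto intro!: derivative_eq_intros)

lemma has_C_derivative_sum:
  assumes w: "positive_weights d w"
    and g: "\<And>k. k \<in> K \<Longrightarrow> has_C_derivative w d (g k) (L k) x"
  shows "has_C_derivative w d (\<lambda>y. \<Sum>k\<in>K. g k y) (\<lambda>i. \<Sum>k\<in>K. L k i) x"
  using g
proof (induction K rule: infinite_finite_induct)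
  case (insert k K)
  then show ?case using has_C_derivative_add[of w d "g k" "L k" x] by simp
qed (simp_all add: has_C_derivative_const[OF w])

lemma has_C_derivative_map_lipschitz:
  assumes w: "positive_weights n w" "positive_weights p w'" and x: "x \<in> Cspace n"
    and h: "\<And>j. j < p \<Longrightarrow> has_C_derivative w n (\<lambda>y. h y j) (L j) x"
  obtains C \<delta> where "C > 0" "\<delta> > 0"
    "\<forall>y\<in>wball w n x \<delta>. wdist w' p (h x) (h y) \<le> C * wdist w n x y"
proof -
  have "\<exists>C \<delta>. C > 0 \<and> \<delta> > 0 \<and> (\<forall>y\<in>wball w n x \<delta>. cmod (h y j - h x j) \<le> C * wdist w n x y)" if "j < p" for j
    by (rule has_C_derivative_lipschitz[OF w(1) h[OF that]]) blast
  then obtain C \<delta> where C: "\<And>j. j < p \<Longrightarrow> C j > 0" "\<And>j. j < p \<Longrightarrow> \<delta> j > 0"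
      "\<And>j y. j < p \<Longrightarrow> y \<in> wball w n x (\<delta> j) \<Longrightarrow> cmod (h y j - h x j) \<le> C j * wdist w n x y"
    by metis
  define D where "D = Min (insert 1 (\<delta> ` {..<p}))"
  define E where "E = 1 + (\<Sum>j<p. w' j * C j)"
  have D: "D > 0" unfolding D_def using C by (subst Min_gr_iff) auto
  have Dle: "D \<le> \<delta> j" if "j < p" for j unfolding D_def using that by (intro Min_le) auto
  have "(\<Sum>j<p. w' j * C j) \<ge> 0" using w C by (intro sum_nonneg) (auto simp: positive_weights_def less_imp_le)
  then have E: "E > 0" by (simp add: E_def)
  have "wdist w' p (h x) (h y) \<le> E * wdist w n x y" if y: "y \<in> wball w n x D" for y
  proof -
    have "wdist w' p (h x) (h y) \<le> (\<Sum>j<p. w' j * C j * wdist w n x y)"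
      unfolding wdist_def[of w' p]
    proof (rule sum_mono)
      fix j assume "j \<in> {..<p}"
      then have j: "j < p" by simp
      have "y \<in> wball w n x (\<delta> j)" using y wball_mono[OF Dle[OF j]] by blast
      then have "w' j * cmod (h y j - h x j) \<le> w' j * (C j * wdist w n x y)"
        using C(3) w(2) j by (intro mult_left_mono) (auto simp: positive_weights_def less_imp_le)
      then show "w' j * cmod (h y j - h x j) \<le> w' j * C j * wdist w n x y" by (simp add: mult.assoc)
    qed
    also have "\<dots> \<le> E * wdist w n x y"
      using wdist_nonneg[OF w(1), of x y] unfolding E_def sum_distrib_right[symmetric] by (simp add: distrib_right)
    finally show ?thesis .
  qed
  then show thesis by (intro that[OF E D] ballI)
qed

lemma has_C_derivative_compose:
  assumes w: "positive_weights n w" "positive_weights p w'" and x: "x \<in> Cspace n"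
    and h: "\<And>j. j < p \<Longrightarrow> has_C_derivative w n (\<lambda>y. h y j) (L j) x"
    and into: "e0 > 0" "\<And>y. y \<in> wball w n x e0 \<Longrightarrow> h y \<in> Cspace p"
    and g: "has_C_derivative w' p g G (h x)"
  shows "has_C_derivative w n (\<lambda>y. g (h y)) (\<lambda>i. \<Sum>j<p. G j * L j i) x"
  unfolding has_C_derivative_def
proof (intro allI impI)
  fix e :: real assume e: "e > 0"
  obtain C \<delta>1 where C: "C > 0" "\<delta>1 > 0"
    "\<forall>y\<in>wball w n x \<delta>1. wdist w' p (h x) (h y) \<le> C * wdist w n x y"
    by (rule has_C_derivative_map_lipschitz[OF w x, where h = h and L = L, OF h])
  have "e / (2 * C) > 0" using e C(1) by simp
  then obtain \<delta>2 where \<delta>2: "\<delta>2 > 0"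
    "\<forall>z\<in>wball w' p (h x) \<delta>2. cmod (g z - g (h x) - (\<Sum>j<p. G j * (z j - h x j))) \<le> e / (2 * C) * wdist w' p (h x) z"
    by (rule has_C_derivativeE[OF g])
  have lin: "has_C_derivative w n (\<lambda>y. \<Sum>j<p. G j * h y j) (\<lambda>i. \<Sum>j<p. G j * L j i) x"
    using h by (intro has_C_derivative_sum has_C_derivative_cmult w) auto
  have "e / 2 > 0" using e by simp
  then obtain \<delta>3 where \<delta>3: "\<delta>3 > 0" "\<forall>y\<in>wball w n x \<delta>3.
    cmod ((\<Sum>j<p. G j * h y j) - (\<Sum>j<p. G j * h x j) - (\<Sum>i<n. (\<Sum>j<p. G j * L j i) * (y i - x i))) \<le> e / 2 * wdist w n x y"
    by (rule has_C_derivativeE[OF lin])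
  define \<delta> where "\<delta> = min (min \<delta>1 \<delta>3) (min e0 (\<delta>2 / C))"
  have "cmod (g (h y) - g (h x) - (\<Sum>i<n. (\<Sum>j<p. G j * L j i) * (y i - x i))) \<le> e * wdist w n x y"
    if y: "y \<in> wball w n x \<delta>" for y
  proof -
    have y': "y \<in> wball w n x \<delta>1" "y \<in> wball w n x \<delta>3" "y \<in> wball w n x e0" "wdist w n x y < \<delta>2 / C"
      using y by (auto simp: wball_def \<delta>_def)
    have hy: "wdist w' p (h x) (h y) \<le> C * wdist w n x y" using C(3) y' by blast
    also have "\<dots> < \<delta>2" using y'(4) C(1) by (simp add: field_simps)
    finally have "h y \<in> wball w' p (h x) \<delta>2" using into(2)[OF y'(3)] by (intro wballI)
    then have "cmod (g (h y) - g (h x) - (\<Sum>j<p. G j * (h y j - h x j))) \<le> e / (2 * C) * wdist w' p (h x) (h y)"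
      using \<delta>2(2) by blast
    also have "\<dots> \<le> e / (2 * C) * (C * wdist w n x y)" using hy e C(1) by (intro mult_left_mono) auto
    also have "\<dots> = e / 2 * wdist w n x y" using C(1) by simp
    finally have 1: "cmod (g (h y) - g (h x) - (\<Sum>j<p. G j * (h y j - h x j))) \<le> e / 2 * wdist w n x y" .
    have 2: "cmod ((\<Sum>j<p. G j * h y j) - (\<Sum>j<p. G j * h x j) - (\<Sum>i<n. (\<Sum>j<p. G j * L j i) * (y i - x i)))
        \<le> e / 2 * wdist w n x y"
      using \<delta>3(2) y'(2) by blast
    have eq: "g (h y) - g (h x) - (\<Sum>i<n. (\<Sum>j<p. G j * L j i) * (y i - x i)) =
       (g (h y) - g (h x) - (\<Sum>j<p. G j * (h y j - h x j))) +
       ((\<Sum>j<p. G j * h y j) - (\<Sum>j<p. G j * h x j) - (\<Sum>i<n. (\<Sum>j<p. G j * L j i) * (y i - x i)))"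
      by (simp add: right_diff_distrib sum_subtractf)
    show ?thesis
      unfolding eq using norm_triangle_mono[OF 1 2] by linarith
  qed
  moreover have "\<delta> > 0" using C \<delta>2 \<delta>3 into by (simp add: \<delta>_def)
  ultimately show "\<exists>\<delta>>0. \<forall>y\<in>wball w n x \<delta>.
      cmod (g (h y) - g (h x) - (\<Sum>i<n. (\<Sum>j<p. G j * L j i) * (y i - x i))) \<le> e * wdist w n x y" by blast
qed

lemma complex_differentiable_at_iff_one:
  "x \<in> Cspace d \<Longrightarrow> complex_differentiable_at d g x \<longleftrightarrow> (\<exists>L. has_C_derivative (\<lambda>_. 1) d g L x)"
  by (rule complex_differentiable_at_iff) simp

lemma complex_differentiable_const: "x \<in> Cspace d \<Longrightarrow> complex_differentiable_at d (\<lambda>_. c) x"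
  unfolding complex_differentiable_at_iff_one using has_C_derivative_const[of d "\<lambda>_. 1" c x] by auto

lemma complex_differentiable_coordinate:
  assumes "x \<in> Cspace d" "i < d"
  shows "complex_differentiable_at d (\<lambda>y. y i) x"
  using has_C_derivative_coordinate[of d "\<lambda>_. 1" i x] assms
  unfolding complex_differentiable_at_iff_one[OF assms(1)] by auto

lemma complex_differentiable_add:
  assumes "x \<in> Cspace d" "complex_differentiable_at d f x" "complex_differentiable_at d g x"
  shows "complex_differentiable_at d (\<lambda>y. f y + g y) x"
  using assms has_C_derivative_add unfolding complex_differentiable_at_iff_one[OF assms(1)] by blast

lemma complex_differentiable_cmult:
  assumes "x \<in> Cspace d" "complex_differentiable_at d g x"
  shows "complex_differentiable_at d (\<lambda>y. c * g y) x"
  using assms has_C_derivative_cmult[OF positive_weights_one]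
  unfolding complex_differentiable_at_iff_one[OF assms(1)] by blast

lemma complex_differentiable_diff:
  assumes "x \<in> Cspace d" "complex_differentiable_at d f x" "complex_differentiable_at d g x"
  shows "complex_differentiable_at d (\<lambda>y. f y - g y) x"
  using complex_differentiable_add[OF assms(1,2) complex_differentiable_cmult[OF assms(1,3), of "-1"]] by simp

lemma complex_differentiable_sum:
  assumes "x \<in> Cspace d" "\<And>k. k \<in> K \<Longrightarrow> complex_differentiable_at d (g k) x"
  shows "complex_differentiable_at d (\<lambda>y. \<Sum>k\<in>K. g k y) x"
  using assms(2)
proof (induction K rule: infinite_finite_induct)
  case (insert k K)
  then show ?case using complex_differentiable_add[OF assms(1), of "g k"] by simp
qed (simp_all add: complex_differentiable_const[OF assms(1)])

text \<open>Powers and branches of roots enter the proof as functions of one variable composed with a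
differentiable function.\<close>
lemma complex_differentiable_compose_field:
  assumes x: "x \<in> Cspace d" and g: "complex_differentiable_at d g x"
    and \<phi>: "\<phi> field_differentiable (at (g x))"
  shows "complex_differentiable_at d (\<lambda>y. \<phi> (g y)) x"
  using g \<phi> has_C_derivative_compose_field[OF positive_weights_one]
  unfolding complex_differentiable_at_iff_one[OF x] field_differentiable_def by blast

lemma complex_differentiable_compose:
  assumes x: "x \<in> Cspace n" and h: "\<And>j. j < p \<Longrightarrow> complex_differentiable_at n (\<lambda>y. h y j) x"
    and U: "open_in_C n U" "x \<in> U" "h ` U \<subseteq> Cspace p"
    and g: "complex_differentiable_at p g (h x)"
  shows "complex_differentiable_at n (\<lambda>y. g (h y)) x"
proof -
  obtain e where e: "e > 0" "wball (\<lambda>_. 1) n x e \<subseteq> U"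
    using open_in_C_contains_wball[OF positive_weights_one U(1,2)] by blast
  obtain L where L: "\<And>j. j < p \<Longrightarrow> has_C_derivative (\<lambda>_. 1) n (\<lambda>y. h y j) (L j) x"
    using h unfolding complex_differentiable_at_iff_one[OF x] by metis
  have hx: "h x \<in> Cspace p" using U by blast
  obtain G where G: "has_C_derivative (\<lambda>_. 1) p g G (h x)"
    using g unfolding complex_differentiable_at_iff_one[OF hx] by blast
  have "has_C_derivative (\<lambda>_. 1) n (\<lambda>y. g (h y)) (\<lambda>i. \<Sum>j<p. G j * L j i) x"
    using e U(3) by (intro has_C_derivative_compose[OF _ _ x L e(1) _ G]) auto
  then show ?thesis unfolding complex_differentiable_at_iff_one[OF x] by blast
qed

lemma complex_differentiable_cong:
  assumes U: "open_in_C d U" "x \<in> U" and eq: "\<And>y. y \<in> U \<Longrightarrow> f y = g y"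
    and f: "complex_differentiable_at d f x"
  shows "complex_differentiable_at d g x"
proof -
  have x: "x \<in> Cspace d" using U openin_imp_subset by blast
  obtain e where e: "e > 0" "wball (\<lambda>_. 1) d x e \<subseteq> U"
    using open_in_C_contains_wball[OF positive_weights_one U(1,2)] by blast
  obtain L where L: "has_C_derivative (\<lambda>_. 1) d f L x"
    using f unfolding complex_differentiable_at_iff_one[OF x] by blast
  have "has_C_derivative (\<lambda>_. 1) d g L x"
    unfolding has_C_derivative_def
  proof (intro allI impI)
    fix c :: real assume "c > 0"
    then obtain \<delta> where \<delta>: "\<delta> > 0" "\<forall>y\<in>wball (\<lambda>_. 1) d x \<delta>.
        cmod (f y - f x - (\<Sum>i<d. L i * (y i - x i))) \<le> c * wdist (\<lambda>_. 1) d x y"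
      using L unfolding has_C_derivative_def by blast
    have "cmod (g y - g x - (\<Sum>i<d. L i * (y i - x i))) \<le> c * wdist (\<lambda>_. 1) d x y"
      if y: "y \<in> wball (\<lambda>_. 1) d x (min \<delta> e)" for y
    proof -
      have "y \<in> U" "y \<in> wball (\<lambda>_. 1) d x \<delta>" using y e(2) by (auto simp: wball_def)
      then show ?thesis using \<delta>(2) eq U(2) by metis
    qed
    then show "\<exists>\<delta>>0. \<forall>y\<in>wball (\<lambda>_. 1) d x \<delta>.
        cmod (g y - g x - (\<Sum>i<d. L i * (y i - x i))) \<le> c * wdist (\<lambda>_. 1) d x y"
      using \<delta>(1) e(1) by (intro exI[of _ "min \<delta> e"]) auto
  qed
  then show ?thesis unfolding complex_differentiable_at_iff_one[OF x] by blast
qed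

lemma holomorphic_map_open_preimage:
  assumes h: "holomorphic_map n p U h" and V: "open_in_C p V"
  shows "open_in_C n {x\<in>U. h x \<in> V}"
  unfolding open_in_C_iff[OF positive_weights_one]
proof (intro conjI ballI)
  have U: "open_in_C n U" "h ` U \<subseteq> Cspace p" using h by (auto simp: holomorphic_map_def)
  show "{x\<in>U. h x \<in> V} \<subseteq> Cspace n" using U openin_imp_subset by blast
  fix x assume "x \<in> {x\<in>U. h x \<in> V}"
  then have x: "x \<in> U" "h x \<in> V" by auto
  then have xC: "x \<in> Cspace n" using U openin_imp_subset by blast
  obtain e where e: "e > 0" "wball (\<lambda>_. 1) n x e \<subseteq> U"
    using open_in_C_contains_wball[OF positive_weights_one U(1) x(1)] by blast
  obtain e' where e': "e' > 0" "wball (\<lambda>_. 1) p (h x) e' \<subseteq> V"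
    using open_in_C_contains_wball[OF positive_weights_one V x(2)] by blast
  have "\<exists>L. has_C_derivative (\<lambda>_. 1) n (\<lambda>y. h y j) L x" if "j < p" for j
    using h x(1) that xC by (auto simp: holomorphic_map_def complex_differentiable_at_iff_one)
  then obtain L where L: "\<And>j. j < p \<Longrightarrow> has_C_derivative (\<lambda>_. 1) n (\<lambda>y. h y j) (L j) x" by metis
  obtain C \<delta> where C: "C > 0" "\<delta> > 0"
    "\<forall>y\<in>wball (\<lambda>_. 1) n x \<delta>. wdist (\<lambda>_. 1) p (h x) (h y) \<le> C * wdist (\<lambda>_. 1) n x y"
    by (rule has_C_derivative_map_lipschitz[OF positive_weights_one positive_weights_one xC, where h = h and L = L, OF L])
  show "\<exists>e>0. \<forall>y\<in>Cspace n. wdist (\<lambda>_. 1) n x y < e \<longrightarrow> y \<in> {x\<in>U. h x \<in> V}"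
  proof (intro exI[of _ "min (min \<delta> e) (e' / C)"] conjI ballI impI)
    fix y assume y: "y \<in> Cspace n" "wdist (\<lambda>_. 1) n x y < min (min \<delta> e) (e' / C)"
    then have "y \<in> U" using e(2) by (auto simp: wball_def)
    moreover have "wdist (\<lambda>_. 1) p (h x) (h y) \<le> C * wdist (\<lambda>_. 1) n x y"
      using y C(3) by (auto simp: wball_def)
    moreover have "C * wdist (\<lambda>_. 1) n x y < e'" using y C(1) by (simp add: field_simps)
    ultimately have "y \<in> U" "wdist (\<lambda>_. 1) p (h x) (h y) < e'" by linarith+
    then show "y \<in> {x\<in>U. h x \<in> V}" using e'(2) U(2) by (auto simp: wball_def)
  qed (use C e e' in auto)
qed

section \<open>Holomorphic perturbations of the identity\<close>

lemma convergent_of_geometric_steps: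
  fixes s :: "nat \<Rightarrow> complex"
  assumes "\<And>k. cmod (s (Suc k) - s k) \<le> C * (1 / 2) ^ k"
  shows "convergent s"
proof -
  have "summable (\<lambda>k. C * (1 / 2) ^ k :: real)" by (intro summable_mult summable_geometric) simp
  then have "summable (\<lambda>k. s (Suc k) - s k)"
    using assms by (rule summable_comparison_test'[where N = 0])
  then have "(\<lambda>k. \<Sum>i<k. s (Suc i) - s i) \<longlonglongrightarrow> (\<Sum>i. s (Suc i) - s i)"
    by (rule summable_LIMSEQ)
  then have "(\<lambda>k. (s k - s 0) + s 0) \<longlonglongrightarrow> (\<Sum>i. s (Suc i) - s i) + s 0"
    unfolding sum_lessThan_telescope by (intro tendsto_add tendsto_const)
  then show ?thesis by (simp add: convergentI)
qed

lemma wdist_add_le: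
  assumes "positive_weights d w"
  shows "wdist w d (\<lambda>i. a i + b i) (\<lambda>i. a' i + b' i) \<le> wdist w d a a' + wdist w d b b'"
  unfolding wdist_def sum.distrib[symmetric] distrib_left[symmetric]
proof (intro sum_mono mult_left_mono)
  fix i
  show "cmod (a' i + b' i - (a i + b i)) \<le> cmod (a' i - a i) + cmod (b' i - b i)"
    using norm_triangle_ineq[of "a' i - a i" "b' i - b i"] by (simp add: algebra_simps)
qed (use assms in \<open>auto simp: positive_weights_def less_imp_le\<close>)

text \<open>Banach's fixed point theorem for \<open>z \<mapsto> v - u(z)\<close>, with the iteration started at \<open>z0\<close>. The first step has
length less than \<open>R / 2\<close>, so the iterates, whose steps halve each time, do not leave the ball of radius \<open>R\<close>.\<close>
lemma contraction_solution:
  assumes w: "positive_weights d w" and z0: "z0 \<in> Cspace d" and u0: "u z0 = (\<lambda>_. 0)"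
    and into: "\<And>z. z \<in> wball w d z0 R \<Longrightarrow> u z \<in> Cspace d"
    and lip: "\<And>z z'. z \<in> wball w d z0 R \<Longrightarrow> z' \<in> wball w d z0 R \<Longrightarrow>
      wdist w d (u z) (u z') \<le> wdist w d z z' / 2"
    and v: "v \<in> wball w d z0 (R / 2)"
  obtains z where "z \<in> wball w d z0 R" "(\<lambda>i. z i + u z i) = v"
proof -
  define \<delta> where "\<delta> = wdist w d z0 v"
  have \<delta>: "2 * \<delta> < R" "\<delta> \<ge> 0" and vC: "v \<in> Cspace d"
    using v wdist_nonneg[OF w] by (auto simp: wball_def \<delta>_def)
  define s where "s = rec_nat z0 (\<lambda>_ z i. v i - u z i)"
  have s0: "s 0 = z0" and sS: "s (Suc k) = (\<lambda>i. v i - u (s k) i)" for k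
    by (simp_all add: s_def)
  have diff: "wdist w d (s (Suc k)) (s (Suc l)) = wdist w d (u (s k)) (u (s l))" for k l
    by (simp add: sS wdist_def norm_minus_commute)
  have ball: "s k \<in> wball w d z0 R \<and> wdist w d z0 (s k) \<le> 2 * \<delta> * (1 - (1 / 2) ^ k) \<and>
      wdist w d (s k) (s (Suc k)) \<le> \<delta> * (1 / 2) ^ k" for k
  proof (induction k)
    case 0
    have "s (Suc 0) = v" by (simp add: sS s0 u0)
    moreover have "R > 0" using \<delta> by linarith
    ultimately show ?case using z0 by (simp add: s0 wball_def \<delta>_def)
  next
    case (Suc k)
    have d1: "wdist w d z0 (s (Suc k)) \<le> 2 * \<delta> * (1 - (1 / 2) ^ Suc k)"
      using wdist_triangle[OF w, of z0 "s (Suc k)" "s k"] Suc by (simp add: algebra_simps)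
    have "0 \<le> \<delta> * (1 / 2) ^ Suc k" using \<delta> by simp
    then have "2 * \<delta> * (1 - (1 / 2) ^ Suc k) \<le> 2 * \<delta>" by (simp add: algebra_simps)
    then have "wdist w d z0 (s (Suc k)) < R" using d1 \<delta> by linarith
    moreover have "s (Suc k) \<in> Cspace d"
      using into[of "s k"] Suc vC by (auto simp: sS Cspace_def)
    ultimately have b: "s (Suc k) \<in> wball w d z0 R" by (rule wballI[rotated])
    have "wdist w d (s (Suc k)) (s (Suc (Suc k))) \<le> wdist w d (s k) (s (Suc k)) / 2"
      unfolding diff using Suc b by (intro lip) auto
    also have "\<dots> \<le> \<delta> * (1 / 2) ^ Suc k" using Suc by simp
    finally show ?case using b d1 by blast
  qed
  have conv: "convergent (\<lambda>k. s k i)" for i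
  proof (cases "i < d")
    case True
    have "cmod (s (Suc k) i - s k i) \<le> \<delta> / w i * (1 / 2) ^ k" for k
    proof -
      have "w i * cmod (s (Suc k) i - s k i) \<le> \<delta> * (1 / 2) ^ k"
        using coordinate_le_wdist[OF w True, of "s (Suc k)" "s k"] ball[of k] by linarith
      moreover have "w i > 0" using w True by (simp add: positive_weights_def)
      ultimately show ?thesis by (simp add: field_simps)
    qed
    then show ?thesis by (rule convergent_of_geometric_steps)
  next
    case False
    have "s k \<in> Cspace d" for k using ball[of k] by (auto simp: wball_def)
    then have "(\<lambda>k. s k i) = (\<lambda>_. 0)" using False by (auto simp: Cspace_def)
    then show ?thesis by (simp add: convergent_const)
  qed
  define z where "z i = lim (\<lambda>k. s k i)" for i
  have z: "(\<lambda>k. s k i) \<longlonglongrightarrow> z i" for i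
    using conv[of i] by (simp add: z_def convergent_LIMSEQ_iff)
  have lim_dist: "(\<lambda>k. wdist w d (s k) z) \<longlonglongrightarrow> 0"
  proof -
    have "(\<lambda>k. wdist w d (s k) z) \<longlonglongrightarrow> (\<Sum>i<d. w i * cmod (z i - z i))"
      unfolding wdist_def by (intro tendsto_intros z)
    then show ?thesis by simp
  qed
  have zC: "z \<in> Cspace d"
  proof -
    have "z i = 0" if "i \<ge> d" for i
    proof -
      have "s k i = 0" for k using ball[of k] that by (auto simp: wball_def Cspace_def)
      then show ?thesis using z[of i] by (simp add: LIMSEQ_const_iff)
    qed
    then show ?thesis by (simp add: Cspace_def)
  qed
  have "wdist w d z0 z \<le> 2 * \<delta>"
  proof (rule LIMSEQ_le_const)
    show "(\<lambda>k. 2 * \<delta> + wdist w d (s k) z) \<longlonglongrightarrow> 2 * \<delta>"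
      using tendsto_add[OF tendsto_const lim_dist, of "2 * \<delta>"] by simp
    have "wdist w d z0 z \<le> 2 * \<delta> + wdist w d (s k) z" for k
    proof -
      have "0 \<le> \<delta> * (1 / 2) ^ k" using \<delta> by simp
      then have "2 * \<delta> * (1 - (1 / 2) ^ k) \<le> 2 * \<delta>" by (simp add: algebra_simps)
      then show ?thesis using ball[of k] wdist_triangle[OF w, of z0 z "s k"] by linarith
    qed
    then show "\<exists>N. \<forall>k\<ge>N. wdist w d z0 z \<le> 2 * \<delta> + wdist w d (s k) z" by blast
  qed
  then have zB: "z \<in> wball w d z0 R" using zC \<delta> by (intro wballI) auto
  let ?\<Psi> = "\<lambda>i. z i + u z i"
  have "wdist w d ?\<Psi> v \<le> 0"
  proof (rule LIMSEQ_le_const)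
    show "(\<lambda>k. wdist w d (s (Suc k)) z + wdist w d (s k) z / 2) \<longlonglongrightarrow> 0"
      using tendsto_add[OF LIMSEQ_Suc[OF lim_dist] tendsto_divide[OF lim_dist tendsto_const, of 2]] by simp
    have "wdist w d ?\<Psi> v \<le> wdist w d (s (Suc k)) z + wdist w d (s k) z / 2" for k
    proof -
      have "wdist w d ?\<Psi> v = wdist w d ?\<Psi> (\<lambda>i. s (Suc k) i + u (s k) i)" by (simp add: sS)
      also have "\<dots> \<le> wdist w d z (s (Suc k)) + wdist w d (u z) (u (s k))"
        by (rule wdist_add_le[OF w])
      also have "wdist w d (u z) (u (s k)) \<le> wdist w d z (s k) / 2"
        using zB ball[of k] by (intro lip) auto
      finally show ?thesis by (simp add: wdist_commute)
    qed
    then show "\<exists>N. \<forall>k\<ge>N. wdist w d ?\<Psi> v \<le> wdist w d (s (Suc k)) z + wdist w d (s k) z / 2" by blast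
  qed
  moreover have "?\<Psi> \<in> Cspace d" using zC into[OF zB] by (simp add: Cspace_def)
  ultimately have "?\<Psi> = v" using wdist_eq_0_imp_eq[OF w _ vC] by blast
  then show thesis using that[OF zB] by blast
qed

text \<open>Used for the derivative of a local inverse and for recovering a point from \<open>n\<close> of its linear forms.\<close>
lemma left_inverse_of_trivial_kernel:
  fixes a :: "nat \<Rightarrow> nat \<Rightarrow> 'a :: field"
  assumes ker: "\<And>x. (\<And>i. i < n \<Longrightarrow> (\<Sum>j<n. a i j * x j) = 0) \<Longrightarrow> (\<forall>j<n. x j = 0)"
  obtains M where "\<And>x i. i < n \<Longrightarrow> (\<Sum>k<n. M i k * (\<Sum>j<n. a k j * x j)) = x i"
proof -
  let ?A = "mat n n (\<lambda>(i, j). a i j)"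
  have "det ?A \<noteq> 0" unfolding det_eq_0_iff_kernel using ker by blast
  then have "?A \<in> Units (ring_mat TYPE('a) n ())" by (intro det_non_zero_imp_unit) auto
  then obtain B where B: "B \<in> carrier_mat n n" "B * ?A = 1\<^sub>m n"
    by (auto simp: Units_def ring_mat_def)
  have "(\<Sum>k<n. B $$ (i, k) * (\<Sum>j<n. a k j * x j)) = x i" if i: "i < n" for x i
  proof -
    have id: "(\<Sum>k<n. B $$ (i, k) * a k j) = of_bool (j = i)" if "j < n" for j
    proof -
      have "(B * ?A) $$ (i, j) = (\<Sum>k<n. B $$ (i, k) * a k j)"
        using B(1) i that by (auto simp: scalar_prod_def lessThan_atLeast0 intro!: sum.cong)
      then show ?thesis using i that unfolding B(2) by auto
    qed
    have "(\<Sum>k<n. B $$ (i, k) * (\<Sum>j<n. a k j * x j)) = (\<Sum>k<n. \<Sum>j<n. B $$ (i, k) * a k j * x j)"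
      by (simp add: sum_distrib_left mult.assoc)
    also have "\<dots> = (\<Sum>j<n. (\<Sum>k<n. B $$ (i, k) * a k j) * x j)"
      by (subst sum.swap) (simp add: sum_distrib_right)
    also have "\<dots> = (\<Sum>j<n. of_bool (j = i) * x j)"
      by (rule sum.cong) (auto simp: id)
    also have "\<dots> = x i" using i by (subst sum.remove[of _ i]) (auto intro!: sum.neutral)
    finally show ?thesis .
  qed
  then show thesis using that[of "\<lambda>i k. B $$ (i, k)"] by blast
qed

lemma has_C_derivative_uniform:
  fixes p :: nat
  assumes "\<And>j. j < p \<Longrightarrow> has_C_derivative w d (\<lambda>y. u y j) (B j) z" and e: "e > 0"
  obtains \<delta> where "\<delta> > 0" "\<forall>j<p. \<forall>y\<in>wball w d z \<delta>.
    cmod (u y j - u z j - (\<Sum>l<d. B j l * (y l - z l))) \<le> e * wdist w d z y"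
proof -
  have "\<exists>\<delta>>0. \<forall>y\<in>wball w d z \<delta>. cmod (u y j - u z j - (\<Sum>l<d. B j l * (y l - z l))) \<le> e * wdist w d z y"
    if "j < p" for j
    by (rule has_C_derivativeE[OF assms(1)[OF that] e]) blast
  then obtain \<delta> where \<delta>: "\<forall>j<p. \<delta> j > 0 \<and> (\<forall>y\<in>wball w d z (\<delta> j).
      cmod (u y j - u z j - (\<Sum>l<d. B j l * (y l - z l))) \<le> e * wdist w d z y)" by metis
  define D where "D = Min (insert 1 (\<delta> ` {..<p}))"
  have D: "D > 0" unfolding D_def using \<delta> by (subst Min_gr_iff) auto
  have Dle: "D \<le> \<delta> j" if "j < p" for j unfolding D_def using that by (intro Min_le) auto
  have "\<forall>j<p. \<forall>y\<in>wball w d z D. cmod (u y j - u z j - (\<Sum>l<d. B j l * (y l - z l))) \<le> e * wdist w d z y"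
    using \<delta> wball_mono[OF Dle] by blast
  then show thesis by (rule that[OF D])
qed

text \<open>The derivative \<open>B\<close> of a map with Lipschitz constant \<open>1/2\<close> has norm at most \<open>1/2\<close>, so \<open>v = - B v\<close> is
possible only for \<open>v = 0\<close>. The norm of \<open>B\<close> is estimated in the direction of \<open>v\<close> only, with the difference
quotient for a small real step \<open>s\<close>.\<close>
lemma contraction_perturbation_kernel:
  assumes w: "positive_weights d w" and z: "z \<in> Cspace d"
    and B: "\<And>j. j < d \<Longrightarrow> has_C_derivative w d (\<lambda>y. u y j) (B j) z"
    and r: "r > 0" and lip: "\<And>y. y \<in> wball w d z r \<Longrightarrow> wdist w d (u z) (u y) \<le> wdist w d z y / 2"
    and v: "\<And>j. j < d \<Longrightarrow> v j + (\<Sum>l<d. B j l * v l) = 0"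
  shows "\<forall>j<d. v j = 0"
proof (rule ccontr)
  assume "\<not> (\<forall>j<d. v j = 0)"
  then obtain j0 where j0: "j0 < d" "v j0 \<noteq> 0" by blast
  define N where "N = (\<Sum>j<d. w j * cmod (v j))"
  have "w j0 * cmod (v j0) \<le> N" unfolding N_def using w j0
    by (intro member_le_sum[of j0 "{..<d}" "\<lambda>j. w j * cmod (v j)"]) (auto simp: positive_weights_def less_imp_le)
  moreover have "w j0 * cmod (v j0) > 0" using w j0 by (simp add: positive_weights_def)
  ultimately have N: "N > 0" by linarith
  define W where "W = (\<Sum>j<d. w j)"
  have W: "W \<ge> 0" unfolding W_def using w by (intro sum_nonneg) (auto simp: positive_weights_def less_imp_le)
  define e where "e = 1 / (4 * (W + 1))"
  have e: "e > 0" using W by (simp add: e_def)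
  obtain \<delta> where \<delta>: "\<delta> > 0" "\<forall>j<d. \<forall>y\<in>wball w d z \<delta>.
    cmod (u y j - u z j - (\<Sum>l<d. B j l * (y l - z l))) \<le> e * wdist w d z y"
    by (rule has_C_derivative_uniform[where u = u and B = B, OF B e])
  define s where "s = min \<delta> r / (2 * N)"
  have s: "s > 0" "s * N < \<delta>" "s * N < r" using \<delta>(1) r N by (auto simp: s_def min_def field_simps)
  define y where "y i = z i + (if i < d then of_real s * v i else 0)" for i
  have yC: "y \<in> Cspace d" using z by (auto simp: y_def Cspace_def)
  have dist: "wdist w d z y = s * N"
    unfolding wdist_def N_def sum_distrib_left using s(1) by (intro sum.cong) (auto simp: y_def norm_mult)
  have "s * (w j * cmod (v j)) \<le> w j * cmod (u y j - u z j) + w j * (e * (s * N))" if j: "j < d" for j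
  proof -
    have "(\<Sum>l<d. B j l * (y l - z l)) = of_real s * (\<Sum>l<d. B j l * v l)"
      unfolding sum_distrib_left by (rule sum.cong) (auto simp: y_def)
    also have "(\<Sum>l<d. B j l * v l) = - v j" using v[OF j] by (simp add: eq_neg_iff_add_eq_0 add.commute)
    finally have lin: "(\<Sum>l<d. B j l * (y l - z l)) = - (of_real s * v j)" by simp
    have "y \<in> wball w d z \<delta>" using yC dist s by (intro wballI) auto
    then have "cmod (u y j - u z j + of_real s * v j) \<le> e * (s * N)"
      using \<delta>(2) j lin dist by fastforce
    moreover have "cmod (of_real s * v j) \<le> cmod (u y j - u z j + of_real s * v j) + cmod (u y j - u z j)"
      using norm_triangle_ineq4[of "u y j - u z j + of_real s * v j" "u y j - u z j"] by simp
    moreover have "cmod (of_real s * v j) = s * cmod (v j)" using s by (simp add: norm_mult)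
    ultimately have "s * cmod (v j) \<le> cmod (u y j - u z j) + e * (s * N)" by linarith
    moreover have "w j \<ge> 0" using w j by (simp add: positive_weights_def less_imp_le)
    ultimately have "w j * (s * cmod (v j)) \<le> w j * (cmod (u y j - u z j) + e * (s * N))"
      by (rule mult_left_mono)
    then show ?thesis by (simp add: algebra_simps)
  qed
  then have "(\<Sum>j<d. s * (w j * cmod (v j))) \<le> (\<Sum>j<d. w j * cmod (u y j - u z j) + w j * (e * (s * N)))"
    by (intro sum_mono) auto
  then have "s * N \<le> wdist w d (u z) (u y) + W * (e * (s * N))"
    by (simp only: N_def W_def wdist_def sum.distrib sum_distrib_left[symmetric] sum_distrib_right[symmetric])
  moreover have "wdist w d (u z) (u y) \<le> s * N / 2"
    using lip[of y] yC dist s by (simp add: wball_def)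
  moreover have "W * (e * (s * N)) \<le> s * N / 4"
  proof -
    have "W * e \<le> 1 / 4" using W by (simp add: e_def field_simps)
    then have "(W * e) * (s * N) \<le> 1 / 4 * (s * N)" using s N by (intro mult_right_mono) auto
    then show ?thesis by (simp add: mult.assoc)
  qed
  moreover have "s * N > 0" using s N by simp
  ultimately show False by linarith
qed

text \<open>Here \<open>k\<close> is a local inverse of \<open>id + u\<close>. If \<open>M\<close> is the inverse of the derivative \<open>I + B\<close> of \<open>id + u\<close>,
then \<open>k(v) - k(v0) - M (v - v0)\<close> is \<open>- M\<close> applied to the remainder in the definition of \<open>B\<close>, and \<open>k\<close> is
Lipschitz at \<open>v0\<close>.\<close>
lemma inverse_has_C_derivative:
  assumes w: "positive_weights d w" and z: "k v0 \<in> Cspace d"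
    and B: "\<And>j. j < d \<Longrightarrow> has_C_derivative w d (\<lambda>y. u y j) (B j) (k v0)"
    and r: "r > 0" and lip: "\<And>y. y \<in> wball w d (k v0) r \<Longrightarrow> wdist w d (u (k v0)) (u y) \<le> wdist w d (k v0) y / 2"
    and r': "r' > 0" and k: "\<And>v. v \<in> wball w d v0 r' \<Longrightarrow> k v \<in> Cspace d"
      "\<And>v. v \<in> wball w d v0 r' \<Longrightarrow> wdist w d (k v0) (k v) \<le> 2 * wdist w d v0 v"
      "\<And>v i. v \<in> insert v0 (wball w d v0 r') \<Longrightarrow> k v i + u (k v) i = v i"
    and i: "i < d"
  shows "\<exists>L. has_C_derivative w d (\<lambda>v. k v i) L v0"
proof -
  let ?z = "k v0"
  define A where "A j l = of_bool (l = j) + B j l" for j l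
  have A: "(\<Sum>l<d. A j l * x l) = x j + (\<Sum>l<d. B j l * x l)" if "j < d" for j and x :: "nat \<Rightarrow> complex"
  proof -
    have "(\<Sum>l<d. of_bool (l = j) * x l) = x j"
      using that by (subst sum.remove[of _ j]) (auto intro!: sum.neutral)
    then show ?thesis by (simp add: A_def distrib_right sum.distrib)
  qed
  have ker: "\<forall>j<d. x j = 0" if x: "\<And>j. j < d \<Longrightarrow> (\<Sum>l<d. A j l * x l) = 0" for x
    by (rule contraction_perturbation_kernel[OF w z B r lip]) (use x in \<open>auto simp: A\<close>)
  obtain M where M: "\<And>x i. i < d \<Longrightarrow> (\<Sum>l<d. M i l * (\<Sum>m<d. A l m * x m)) = x i"
    by (rule left_inverse_of_trivial_kernel[of d A, OF ker]) (blast, blast)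
  have "has_C_derivative w d (\<lambda>v. k v i) (M i) v0"
    unfolding has_C_derivative_def
  proof (intro allI impI)
    fix e :: real assume e: "e > 0"
    define m where "m = (\<Sum>l<d. cmod (M i l))"
    have m: "m \<ge> 0" by (simp add: m_def sum_nonneg)
    define e1 where "e1 = e / (2 * (m + 1))"
    have e1: "e1 > 0" using e m by (simp add: e1_def)
    obtain \<delta> where \<delta>: "\<delta> > 0" "\<forall>j<d. \<forall>y\<in>wball w d ?z \<delta>.
        cmod (u y j - u ?z j - (\<Sum>l<d. B j l * (y l - ?z l))) \<le> e1 * wdist w d ?z y"
      by (rule has_C_derivative_uniform[where u = u and B = B, OF B e1])
    have "cmod (k v i - k v0 i - (\<Sum>l<d. M i l * (v l - v0 l))) \<le> e * wdist w d v0 v"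
      if v: "v \<in> wball w d v0 (min r' (\<delta> / 2))" for v
    proof -
      have v': "v \<in> wball w d v0 r'" "2 * wdist w d v0 v < \<delta>" using v by (auto simp: wball_def)
      let ?y = "k v"
      define \<rho> where "\<rho> l = u ?y l - u ?z l - (\<Sum>m<d. B l m * (?y m - ?z m))" for l
      have dy: "wdist w d ?z ?y \<le> 2 * wdist w d v0 v" by (rule k(2)[OF v'(1)])
      have "?y \<in> wball w d ?z \<delta>" using k(1)[OF v'(1)] dy v'(2) by (intro wballI) auto
      then have \<rho>: "cmod (\<rho> l) \<le> e1 * wdist w d ?z ?y" if "l < d" for l
        using \<delta>(2) that by (simp add: \<rho>_def)
      have "v l - v0 l = (\<Sum>m<d. A l m * (?y m - ?z m)) + \<rho> l" if "l < d" for l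
        using k(3)[of v l] k(3)[of v0 l] v'(1) unfolding A[OF that] \<rho>_def by (simp add: algebra_simps)
      then have "(\<Sum>l<d. M i l * (v l - v0 l)) =
          (\<Sum>l<d. M i l * (\<Sum>m<d. A l m * (?y m - ?z m)) + M i l * \<rho> l)"
        by (intro sum.cong) (auto simp: distrib_left)
      also have "\<dots> = (?y i - ?z i) + (\<Sum>l<d. M i l * \<rho> l)"
        unfolding sum.distrib M[OF i] ..
      finally have eq: "k v i - k v0 i - (\<Sum>l<d. M i l * (v l - v0 l)) = - (\<Sum>l<d. M i l * \<rho> l)" by simp
      have "cmod (\<Sum>l<d. M i l * \<rho> l) \<le> (\<Sum>l<d. cmod (M i l) * (e1 * wdist w d ?z ?y))"
        using \<rho> by (intro sum_norm_le) (auto simp: norm_mult intro!: mult_left_mono)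
      also have "\<dots> = m * (e1 * wdist w d ?z ?y)" unfolding m_def sum_distrib_right ..
      also have "\<dots> \<le> (m + 1) * (e1 * (2 * wdist w d v0 v))"
        using m e1 dy wdist_nonneg[OF w, of ?z ?y] by (intro mult_mono mult_left_mono) auto
      also have "\<dots> = e * wdist w d v0 v" using m by (simp add: e1_def field_simps)
      finally show ?thesis unfolding eq norm_minus_cancel .
    qed
    then show "\<exists>\<delta>>0. \<forall>v\<in>wball w d v0 \<delta>. cmod (k v i - k v0 i - (\<Sum>l<d. M i l * (v l - v0 l))) \<le> e * wdist w d v0 v"
      using r' \<delta>(1) by (intro exI[of _ "min r' (\<delta> / 2)"]) auto
  qed
  then show ?thesis by blast
qed

text \<open>The inverse function theorem in quantitative form. The domain of the germ is the preimage of the ball of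
radius \<open>R / 2\<close>, on which the equation \<open>z + u(z) = v\<close> can be solved.\<close>
lemma near_identity_biholomorphic:
  assumes w: "positive_weights d w" and z0: "z0 \<in> Cspace d" and R: "R > 0" and u0: "u z0 = (\<lambda>_. 0)"
    and into: "\<And>z. z \<in> wball w d z0 R \<Longrightarrow> u z \<in> Cspace d"
    and lip: "\<And>z z'. z \<in> wball w d z0 R \<Longrightarrow> z' \<in> wball w d z0 R \<Longrightarrow>
      wdist w d (u z) (u z') \<le> wdist w d z z' / 2"
    and diff: "\<And>z i. z \<in> wball w d z0 R \<Longrightarrow> i < d \<Longrightarrow> complex_differentiable_at d (\<lambda>y. u y i) z"
  shows "biholomorphic_germ d {z0} {z0} (\<lambda>z i. z i + u z i)"
proof -
  let ?\<Psi> = "\<lambda>z i. z i + u z i"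
  let ?B = "wball w d z0 R" and ?V = "wball w d z0 (R / 2)"
  define U where "U = {z \<in> ?B. ?\<Psi> z \<in> ?V}"
  have \<Psi>_C: "?\<Psi> z \<in> Cspace d" if "z \<in> ?B" for z
    using into[OF that] that by (simp add: Cspace_def wball_def)
  have expand: "wdist w d z z' \<le> 2 * wdist w d (?\<Psi> z) (?\<Psi> z')" if "z \<in> ?B" "z' \<in> ?B" for z z'
  proof -
    have "wdist w d z z' = wdist w d (\<lambda>i. ?\<Psi> z i + - u z i) (\<lambda>i. ?\<Psi> z' i + - u z' i)" by simp
    also have "\<dots> \<le> wdist w d (?\<Psi> z) (?\<Psi> z') + wdist w d (\<lambda>i. - u z i) (\<lambda>i. - u z' i)"
      by (rule wdist_add_le[OF w])
    also have "wdist w d (\<lambda>i. - u z i) (\<lambda>i. - u z' i) = wdist w d (u z) (u z')"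
      by (simp add: wdist_def norm_minus_commute)
    finally show ?thesis using lip[OF that] by linarith
  qed
  have inj: "inj_on ?\<Psi> ?B"
  proof (rule inj_onI)
    fix z z' assume z: "z \<in> ?B" "z' \<in> ?B" and eq: "?\<Psi> z = ?\<Psi> z'"
    have "wdist w d z z' \<le> 0" using expand[OF z] unfolding eq by simp
    then show "z = z'" using z by (intro wdist_eq_0_imp_eq[OF w]) (auto simp: wball_def)
  qed
  have img: "?\<Psi> ` U = ?V"
  proof
    show "?V \<subseteq> ?\<Psi> ` U"
    proof
      fix v assume v: "v \<in> ?V"
      obtain z where "z \<in> ?B" "?\<Psi> z = v"
        by (rule contraction_solution[where u = u, OF w z0 u0 into lip v])
      then show "v \<in> ?\<Psi> ` U" using v by (auto simp: U_def)
    qed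
  qed (auto simp: U_def)
  have diff\<Psi>: "complex_differentiable_at d (\<lambda>y. ?\<Psi> y i) z" if "z \<in> ?B" "i < d" for z i
    using that diff by (intro complex_differentiable_add complex_differentiable_coordinate) (auto simp: wball_def)
  have holB: "holomorphic_map d d ?B ?\<Psi>"
    unfolding holomorphic_map_def using \<Psi>_C diff\<Psi> open_in_C_wball[OF w] by blast
  then have openU: "open_in_C d U"
    unfolding U_def by (rule holomorphic_map_open_preimage) (rule open_in_C_wball[OF w])
  have "holomorphic_map d d U ?\<Psi>"
    unfolding holomorphic_map_def using \<Psi>_C diff\<Psi> openU by (auto simp: U_def)
  moreover have "holomorphic_map d d (?\<Psi> ` U) (inv_into U ?\<Psi>)"
  proof -
    define k where "k = inv_into U ?\<Psi>"
    have kU: "k v \<in> U" "?\<Psi> (k v) = v" if "v \<in> ?V" for v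
      using that inv_into_into[of v ?\<Psi> U] f_inv_into_f[of v ?\<Psi> U] unfolding img k_def by blast+
    have "complex_differentiable_at d (\<lambda>v. k v i) v0" if v0: "v0 \<in> ?V" and i: "i < d" for v0 i
    proof -
      have v0C: "v0 \<in> Cspace d" using v0 by (simp add: wball_def)
      have kB: "k v0 \<in> ?B" using kU[OF v0] by (simp add: U_def)
      then have kC: "k v0 \<in> Cspace d" by (simp add: wball_def)
      obtain \<rho> where \<rho>: "\<rho> > 0" "wball w d (k v0) \<rho> \<subseteq> ?B"
        using open_in_C_contains_wball[OF w open_in_C_wball[OF w] kB] by blast
      obtain \<rho>' where \<rho>': "\<rho>' > 0" "wball w d v0 \<rho>' \<subseteq> ?V"
        using open_in_C_contains_wball[OF w open_in_C_wball[OF w] v0] by blast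
      have "\<exists>L. has_C_derivative w d (\<lambda>y. u y j) L (k v0)" if "j < d" for j
        using diff[OF kB that] unfolding complex_differentiable_at_iff[OF w kC] .
      then obtain B where B: "\<And>j. j < d \<Longrightarrow> has_C_derivative w d (\<lambda>y. u y j) (B j) (k v0)" by metis
      have "\<exists>L. has_C_derivative w d (\<lambda>v. k v i) L v0"
      proof (rule inverse_has_C_derivative[where k = k and u = u and B = B, OF w kC B \<rho>(1) _ \<rho>'(1) _ _ _ i])
        fix y assume "y \<in> wball w d (k v0) \<rho>"
        then show "wdist w d (u (k v0)) (u y) \<le> wdist w d (k v0) y / 2" using \<rho>(2) kB by (intro lip) auto
      next
        fix v assume "v \<in> wball w d v0 \<rho>'"
        then have v: "v \<in> ?V" using \<rho>' by blast
        have kv: "k v \<in> ?B" using kU[OF v] by (simp add: U_def)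
        then show "k v \<in> Cspace d" by (simp add: wball_def)
        show "wdist w d (k v0) (k v) \<le> 2 * wdist w d v0 v"
          using expand[OF kB kv] unfolding kU(2)[OF v] kU(2)[OF v0] .
      next
        fix v l assume "v \<in> insert v0 (wball w d v0 \<rho>')"
        then have "v \<in> ?V" using \<rho>'(2) v0 by blast
        from fun_cong[OF kU(2)[OF this], of l] show "k v l + u (k v) l = v l" .
      qed
      then show ?thesis unfolding complex_differentiable_at_iff[OF w v0C] .
    qed
    moreover have "k ` ?V \<subseteq> Cspace d" using kU by (auto simp: U_def wball_def)
    ultimately show ?thesis
      unfolding img holomorphic_map_def k_def using open_in_C_wball[OF w] by blast
  qed
  moreover have "inj_on ?\<Psi> U" using inj by (rule inj_on_subset) (auto simp: U_def)
  moreover have "?\<Psi> z0 = z0" by (simp add: u0)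
  moreover have "z0 \<in> U" using z0 R \<open>?\<Psi> z0 = z0\<close> by (simp add: U_def wball_def)
  ultimately show ?thesis unfolding biholomorphic_germ_def by (intro conjI exI[of _ U]) auto
qed

lemma has_field_derivative_line:
  assumes w: "positive_weights d w" and v: "v \<in> Cspace d" and z: "z \<in> Cspace d"
    and g: "has_C_derivative w d g L (\<lambda>i. z i + s * v i)"
  shows "((\<lambda>s. g (\<lambda>i. z i + s * v i)) has_field_derivative (\<Sum>i<d. L i * v i)) (at s)"
  unfolding has_field_derivative_def has_derivative_at_alt
proof (intro conjI allI impI)
  show "bounded_linear ((*) (\<Sum>i<d. L i * v i))" by (rule bounded_linear_mult_right)
  fix e :: real assume e: "e > 0"
  define N where "N = wdist w d (\<lambda>_. 0) v"
  have N: "N \<ge> 0" unfolding N_def by (rule wdist_nonneg[OF w])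
  have "e / (N + 1) > 0" using e N by simp
  then obtain \<delta> where \<delta>: "\<delta> > 0" "\<forall>y\<in>wball w d (\<lambda>i. z i + s * v i) \<delta>.
     cmod (g y - g (\<lambda>i. z i + s * v i) - (\<Sum>i<d. L i * (y i - (z i + s * v i))))
       \<le> e / (N + 1) * wdist w d (\<lambda>i. z i + s * v i) y"
    by (rule has_C_derivativeE[OF g])
  have "cmod (g (\<lambda>i. z i + s' * v i) - g (\<lambda>i. z i + s * v i) - (\<Sum>i<d. L i * v i) * (s' - s)) \<le> e * cmod (s' - s)"
    if s': "cmod (s' - s) < \<delta> / (N + 1)" for s'
  proof -
    have dist: "wdist w d (\<lambda>i. z i + s * v i) (\<lambda>i. z i + s' * v i) = cmod (s' - s) * N"
      unfolding wdist_def N_def sum_distrib_left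
    proof (rule sum.cong[OF refl])
      fix i
      have "z i + s' * v i - (z i + s * v i) = (s' - s) * v i" by (simp add: algebra_simps)
      then show "w i * cmod (z i + s' * v i - (z i + s * v i)) = cmod (s' - s) * (w i * cmod (v i - 0))"
        by (simp add: norm_mult)
    qed
    have "cmod (s' - s) * N \<le> cmod (s' - s) * (N + 1)" by (intro mult_left_mono) auto
    also have "\<dots> < \<delta>" using s' N by (simp add: field_simps)
    finally have "(\<lambda>i. z i + s' * v i) \<in> wball w d (\<lambda>i. z i + s * v i) \<delta>"
      using z v dist by (intro wballI) (auto simp: Cspace_def)
    then have 1: "cmod (g (\<lambda>i. z i + s' * v i) - g (\<lambda>i. z i + s * v i) -
        (\<Sum>i<d. L i * (z i + s' * v i - (z i + s * v i)))) \<le> e / (N + 1) * (cmod (s' - s) * N)"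
      using \<delta>(2) dist by fastforce
    have 2: "(\<Sum>i<d. L i * (z i + s' * v i - (z i + s * v i))) = (\<Sum>i<d. L i * v i) * (s' - s)"
      unfolding sum_distrib_right by (rule sum.cong) (auto simp: algebra_simps)
    have "e / (N + 1) * (cmod (s' - s) * N) = e * cmod (s' - s) * (N / (N + 1))" by simp
    also have "\<dots> \<le> e * cmod (s' - s) * 1" using e N by (intro mult_left_mono) auto
    finally show ?thesis using 1 unfolding 2 by simp
  qed
  moreover have "\<delta> / (N + 1) > 0" using \<delta>(1) N by simp
  ultimately show "\<exists>d'>0. \<forall>y. cmod (y - s) < d' \<longrightarrow>
     cmod (g (\<lambda>i. z i + y * v i) - g (\<lambda>i. z i + s * v i) - (\<Sum>i<d. L i * v i) * (y - s)) \<le> e * cmod (y - s)"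
    by blast
qed

text \<open>On the complex line through \<open>z\<close> and \<open>z'\<close>, the function \<open>g\<close> is holomorphic in a disc around \<open>z\<close> whose
radius is \<open>\<rho>\<close> times the distance of \<open>z\<close> and \<open>z'\<close>, because both points are well inside the ball. Schwarz's
lemma for the increment of \<open>g\<close> on this disc gives the estimate.\<close>
lemma bounded_holomorphic_lipschitz:
  assumes w: "positive_weights d w" and z0: "z0 \<in> Cspace d" and R: "R > 0" and c: "c > 0"
    and diff: "\<And>z. z \<in> wball w d z0 R \<Longrightarrow> complex_differentiable_at d g z"
    and bound: "\<And>z. z \<in> wball w d z0 R \<Longrightarrow> cmod (g z) \<le> c"
    and z: "z \<in> wball w d z0 (R / 4)" "z' \<in> wball w d z0 (R / 4)"
  shows "cmod (g z' - g z) \<le> 4 * c / R * wdist w d z z'"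
proof (cases "z = z'")
  case False
  define D where "D = wdist w d z z'"
  have zC: "z \<in> Cspace d" "z' \<in> Cspace d" using z by (auto simp: wball_def)
  have D: "D > 0"
    using wdist_eq_0_imp_eq[OF w zC] False unfolding D_def by (meson not_le)
  have D2: "D < R / 2"
    using wdist_triangle[OF w, of z z' z0] z by (simp add: wball_def D_def wdist_commute)
  define \<rho> where "\<rho> = 3 * R / (4 * D)"
  have \<rho>: "\<rho> > 1" using D D2 by (simp add: \<rho>_def field_simps)
  define v where "v i = z' i - z i" for i
  have vC: "v \<in> Cspace d" using zC by (simp add: v_def Cspace_def)
  define \<phi> where "\<phi> s = g (\<lambda>i. z i + s * v i)" for s
  have pt: "(\<lambda>i. z i + s * v i) \<in> wball w d z0 R" if s: "cmod s < \<rho>" for s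
  proof (rule wballI)
    have "wdist w d z (\<lambda>i. z i + s * v i) = cmod s * D"
      unfolding wdist_def D_def sum_distrib_left by (rule sum.cong) (auto simp: v_def norm_mult)
    also have "\<dots> < \<rho> * D" using s D by (intro mult_strict_right_mono)
    also have "\<dots> = 3 * R / 4" using D by (simp add: \<rho>_def)
    finally show "wdist w d z0 (\<lambda>i. z i + s * v i) < R"
      using wdist_triangle[OF w, of z0 "\<lambda>i. z i + s * v i" z] z(1) by (simp add: wball_def)
  qed (use zC vC in \<open>auto simp: Cspace_def\<close>)
  have \<phi>_diff: "\<phi> field_differentiable (at s)" if s: "cmod s < \<rho>" for s
  proof -
    have "(\<lambda>i. z i + s * v i) \<in> Cspace d" using pt[OF s] by (simp add: wball_def)
    then obtain L where "has_C_derivative w d g L (\<lambda>i. z i + s * v i)"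
      using diff[OF pt[OF s]] complex_differentiable_at_iff[OF w] by blast
    then show ?thesis
      unfolding \<phi>_def field_differentiable_def using has_field_derivative_line[OF w vC zC(1)] by blast
  qed
  \<comment> \<open>The factor \<open>3\<close> in place of \<open>2\<close> gives the strict bound that Schwarz's lemma asks for.\<close>
  define \<psi> where "\<psi> \<xi> = (\<phi> (of_real \<rho> * \<xi>) - \<phi> 0) / of_real (3 * c)" for \<xi>
  have small: "cmod (of_real \<rho> * \<xi>) < \<rho>" if "cmod \<xi> < 1" for \<xi>
    using that \<rho> by (simp add: norm_mult)
  have "\<psi> field_differentiable (at \<xi>)" if "cmod \<xi> < 1" for \<xi>
  proof -
    have "(\<lambda>\<xi>. \<phi> (of_real \<rho> * \<xi>)) field_differentiable (at \<xi>)"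
      using field_differentiable_compose[of "\<lambda>\<xi>. of_real \<rho> * \<xi>" \<xi> \<phi>] \<phi>_diff[OF small[OF that]]
      by (simp add: o_def field_differentiable_mult field_differentiable_ident field_differentiable_const)
    then show ?thesis unfolding \<psi>_def
      using c by (intro field_differentiable_divide field_differentiable_diff field_differentiable_const) auto
  qed
  then have "\<psi> holomorphic_on ball 0 1"
    by (auto simp: holomorphic_on_def intro: field_differentiable_at_within)
  moreover have "\<psi> 0 = 0" by (simp add: \<psi>_def)
  moreover have "cmod (\<psi> \<xi>) < 1" if "cmod \<xi> < 1" for \<xi>
  proof -
    have "cmod (\<phi> (of_real \<rho> * \<xi>)) \<le> c" "cmod (\<phi> 0) \<le> c"
      using bound[OF pt[OF small[OF that]]] bound[OF pt[of 0]] \<rho> by (auto simp: \<phi>_def)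
    then have "cmod (\<phi> (of_real \<rho> * \<xi>) - \<phi> 0) \<le> 2 * c"
      using norm_triangle_ineq4[of "\<phi> (of_real \<rho> * \<xi>)" "\<phi> 0"] by linarith
    then show ?thesis using c by (simp add: \<psi>_def norm_divide)
  qed
  moreover have "cmod (1 / of_real \<rho>) < 1" using \<rho> by (simp add: norm_divide)
  ultimately have "cmod (\<psi> (1 / of_real \<rho>)) \<le> cmod (1 / of_real \<rho>)"
    by (rule Schwarz_Lemma(1))
  then have "cmod (\<phi> 1 - \<phi> 0) / (3 * c) \<le> 1 / \<rho>" using \<rho> c by (simp add: \<psi>_def norm_divide)
  then have "cmod (\<phi> 1 - \<phi> 0) \<le> 3 * c / \<rho>" using \<rho> c by (simp add: field_simps)
  also have "\<dots> = 4 * c / R * D" using D R by (simp add: \<rho>_def field_simps)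
  finally show ?thesis by (simp add: \<phi>_def v_def D_def)
qed simp

section \<open>Stability of germs with a left inverse\<close>

lemma open_in_C_Cspace [simp]: "open_in_C d (Cspace d)"
  by simp

lemma zero_in_Cspace [simp]: "(\<lambda>_. 0) \<in> Cspace d"
  by (simp add: Cspace_def)

lemma pair_in_Cspace: "x \<in> Cspace n \<Longrightarrow> pair r t x \<in> Cspace (r + n)"
  by (auto simp: pair_def Cspace_def)

definition drop_coords :: "nat \<Rightarrow> (nat \<Rightarrow> complex) \<Rightarrow> nat \<Rightarrow> complex"
  where "drop_coords r z = (\<lambda>i. z (r + i))"

lemma drop_coords_in_Cspace: "z \<in> Cspace (r + p) \<Longrightarrow> drop_coords r z \<in> Cspace p"
  by (auto simp: drop_coords_def Cspace_def)

lemma drop_coords_pair [simp]: "drop_coords r (pair r t y) = y"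
  by (simp add: drop_coords_def pair_def)

lemma pair_drop_coords [simp]: "pair r z (drop_coords r z) = z"
  by (auto simp: drop_coords_def pair_def)

lemma pair_pair [simp]: "pair r (pair r t y) x = pair r t x"
  by (auto simp: pair_def)

lemma id_times_eq: "id_times r f z = pair r z (f (drop_coords r z))"
  by (simp add: id_times_def drop_coords_def)

lemma holomorphic_map_drop_coords: "holomorphic_map (r + p) p (Cspace (r + p)) (drop_coords r)"
  unfolding holomorphic_map_def
  using drop_coords_in_Cspace complex_differentiable_coordinate[of _ "r + p"]
  by (auto simp: drop_coords_def)

lemma holomorphic_map_pair_const:
  assumes h: "holomorphic_map d n \<Omega> h"
  shows "holomorphic_map d (r + n) \<Omega> (\<lambda>z. pair r t (h z))"
  unfolding holomorphic_map_def
proof (intro conjI ballI allI impI)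
  show "open_in_C d \<Omega>" using h by (simp add: holomorphic_map_def)
  then have \<Omega>: "\<Omega> \<subseteq> Cspace d" by (rule openin_imp_subset)
  show "(\<lambda>z. pair r t (h z)) ` \<Omega> \<subseteq> Cspace (r + n)"
    using h by (auto simp: holomorphic_map_def intro: pair_in_Cspace)
  fix z i assume z: "z \<in> \<Omega>" and i: "i < r + n"
  show "complex_differentiable_at d (\<lambda>y. pair r t (h y) i) z"
  proof (cases "i < r")
    case True
    then show ?thesis using complex_differentiable_const[of z d] z \<Omega> by (auto simp: pair_def)
  next
    case False
    then have "i - r < n" using i by linarith
    then show ?thesis using h z False by (simp add: pair_def holomorphic_map_def)
  qed
qed

lemma holomorphic_map_pair:
  assumes h: "holomorphic_map d n \<Omega> h" and r: "r \<le> d"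
  shows "holomorphic_map d (r + n) \<Omega> (\<lambda>z. pair r z (h z))"
  unfolding holomorphic_map_def
proof (intro conjI ballI allI impI)
  show "open_in_C d \<Omega>" using h by (simp add: holomorphic_map_def)
  then have \<Omega>: "\<Omega> \<subseteq> Cspace d" by (rule openin_imp_subset)
  show "(\<lambda>z. pair r z (h z)) ` \<Omega> \<subseteq> Cspace (r + n)"
    using h by (auto simp: holomorphic_map_def intro: pair_in_Cspace)
  fix z i assume z: "z \<in> \<Omega>" and i: "i < r + n"
  show "complex_differentiable_at d (\<lambda>y. pair r y (h y) i) z"
  proof (cases "i < r")
    case True
    then show ?thesis using complex_differentiable_coordinate[of z d i] z \<Omega> r by (auto simp: pair_def)
  next
    case False
    then have "i - r < n" using i by linarith
    then show ?thesis using h z False by (simp add: pair_def holomorphic_map_def)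
  qed
qed

lemma holomorphic_map_compose:
  assumes h: "holomorphic_map n p U h" and g: "holomorphic_map p q V g" and sub: "h ` U \<subseteq> V"
  shows "holomorphic_map n q U (\<lambda>x. g (h x))"
  unfolding holomorphic_map_def
proof (intro conjI ballI allI impI)
  show U: "open_in_C n U" using h by (simp add: holomorphic_map_def)
  show "(\<lambda>x. g (h x)) ` U \<subseteq> Cspace q" using g sub by (auto simp: holomorphic_map_def)
  fix x j assume x: "x \<in> U" and j: "j < q"
  show "complex_differentiable_at n (\<lambda>x. g (h x) j) x"
  proof (rule complex_differentiable_compose[where h = h and g = "\<lambda>y. g y j"])
    show "x \<in> Cspace n" using U x openin_imp_subset by blast
    show "h ` U \<subseteq> Cspace p" using h by (simp add: holomorphic_map_def)
    show "complex_differentiable_at p (\<lambda>y. g y j) (h x)"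
      using g sub x j by (auto simp: holomorphic_map_def)
  qed (use h x U in \<open>auto simp: holomorphic_map_def\<close>)
qed

lemma holomorphic_map_subset:
  "holomorphic_map n p U h \<Longrightarrow> open_in_C n U' \<Longrightarrow> U' \<subseteq> U \<Longrightarrow> holomorphic_map n p U' h"
  unfolding holomorphic_map_def by blast

lemma holomorphic_map_id: "open_in_C d U \<Longrightarrow> holomorphic_map d d U id"
  unfolding holomorphic_map_def using openin_imp_subset complex_differentiable_coordinate
  by (auto simp: subset_iff)

lemma biholomorphic_germ_id:
  assumes "S \<subseteq> Cspace d"
  shows "biholomorphic_germ d S S id"
  unfolding biholomorphic_germ_def
proof (intro conjI exI[of _ "Cspace d"])
  have inv: "inv_into (Cspace d) id x = x" if "x \<in> Cspace d" for x
    using inv_into_f_f[of id "Cspace d" x] that by simp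
  have "holomorphic_map d d (Cspace d) (inv_into (Cspace d) id)"
    unfolding holomorphic_map_def
  proof (intro conjI ballI allI impI)
    fix x j assume x: "x \<in> Cspace d" and j: "j < d"
    show "complex_differentiable_at d (\<lambda>y. inv_into (Cspace d) id y j) x"
      by (rule complex_differentiable_cong[OF open_in_C_Cspace x _ complex_differentiable_coordinate[OF x j]])
         (simp add: inv)
  qed (use inv in auto)
  then show "holomorphic_map d d (id ` Cspace d) (inv_into (Cspace d) id)" by simp
qed (use assms holomorphic_map_id[OF open_in_C_Cspace] in auto)

lemma unfolding_of_id:
  assumes "finite S" "S \<subseteq> Cspace n"
  shows "unfolding_of r n n S S id id"
  unfolding unfolding_of_def
proof (intro conjI exI[of _ "Cspace (r + n)"] exI[of _ "\<lambda>t x. x"])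
  have "zero_times r S \<subseteq> Cspace (r + n)"
    using assms by (auto simp: zero_times_def intro: pair_in_Cspace)
  then show "multigerm (r + n) (r + n) (zero_times r S) (zero_times r S) id"
    unfolding multigerm_def using assms(1) holomorphic_map_id[OF open_in_C_Cspace]
    by (intro conjI exI[of _ "Cspace (r + n)"]) (auto simp: zero_times_def)
  show "zero_times r S \<subseteq> Cspace (r + n)" by fact
  show "germ_eq n S (\<lambda>x. x) id"
    unfolding germ_eq_def using assms by (intro exI[of _ "Cspace n"]) auto
qed auto

text \<open>The condition to be met in the source is empty, so the identities trivialise every unfolding.\<close>
lemma stable_multigerm_empty:
  assumes y: "y \<in> Cspace p"
  shows "stable_multigerm n p {} y f"
  unfolding stable_multigerm_def
proof (intro conjI allI impI)
  have emp: "holomorphic_map k l {} g" for k l g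
    by (simp add: holomorphic_map_def)
  show "multigerm n p {} {y} f"
    unfolding multigerm_def using y emp by blast
  fix r F assume "unfolding_of r n p {} {y} f F"
  have z: "zero_times r {} = {}" by (simp add: zero_times_def)
  have C: "zero_times r {y} \<subseteq> Cspace (r + p)"
    using y by (auto simp: zero_times_def intro: pair_in_Cspace)
  show "trivial_unfolding r n p {} {y} f F"
    unfolding trivial_unfolding_def A_equivalent_via_def
  proof (intro exI conjI)
    show "unfolding_of r n n {} {} id id" by (rule unfolding_of_id) auto
    show "unfolding_of r p p {y} {y} id id" using y by (intro unfolding_of_id) auto
    show "biholomorphic_germ (r + n) (zero_times r {}) (zero_times r {}) id"
      unfolding z by (rule biholomorphic_germ_id) simp
    show "biholomorphic_germ (r + p) (zero_times r {y}) (zero_times r {y}) id"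
      by (rule biholomorphic_germ_id[OF C])
    show "germ_eq (r + n) (zero_times r {}) F (id \<circ> id_times r f \<circ> id)"
      unfolding germ_eq_def z by (intro exI[of _ "{}"]) auto
  qed
qed

text \<open>As \<open>u(0,y) = 0\<close>, the first-order expansion of \<open>u\<close> at \<open>(0,y0)\<close> gives \<open>u(t,y)\<close>, up to the remainders at
\<open>(t,y)\<close> and \<open>(0,y)\<close>, as a linear function of \<open>t\<close>. On the ball of radius \<open>R\<close> for the distance with weight \<open>K\<close> in the directions of
\<open>t\<close>, the size of \<open>t\<close> is at most \<open>R / K\<close>; if \<open>K\<close> is large, this makes \<open>u\<close> at most \<open>3 * e * R\<close> with a
constant \<open>e\<close> that may be fixed in advance. Schwarz's lemma turns this into the Lipschitz constant \<open>12 * e\<close>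
for each of the \<open>p\<close> components of \<open>u\<close> that are not identically zero.\<close>
lemma parametric_perturbation_biholomorphic:
  assumes \<Omega>: "open_in_C (r + p) \<Omega>" "pair r (\<lambda>_. 0) y0 \<in> \<Omega>" and y0: "y0 \<in> Cspace p"
    and u_low: "\<And>z i. i < r \<or> i \<ge> r + p \<Longrightarrow> u z i = 0"
    and u_zero: "\<And>y. u (pair r (\<lambda>_. 0) y) = (\<lambda>_. 0)"
    and diff: "\<And>z i. z \<in> \<Omega> \<Longrightarrow> i < r + p \<Longrightarrow> complex_differentiable_at (r + p) (\<lambda>z. u z i) z"
  shows "biholomorphic_germ (r + p) {pair r (\<lambda>_. 0) y0} {pair r (\<lambda>_. 0) y0} (\<lambda>z i. z i + u z i)"
proof -
  define Y where "Y = pair r (\<lambda>_. 0) y0"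
  have YC: "Y \<in> Cspace (r + p)" unfolding Y_def by (rule pair_in_Cspace[OF y0])
  have uY: "u Y = (\<lambda>_. 0)" by (simp add: Y_def u_zero)
  let ?one = "\<lambda>_::nat. 1::real"
  have "\<exists>L. has_C_derivative ?one (r + p) (\<lambda>z. u z i) L Y" if "i < r + p" for i
    using diff[OF \<Omega>(2) that] YC by (simp add: complex_differentiable_at_iff_one Y_def)
  then obtain L where L: "\<And>i. i < r + p \<Longrightarrow> has_C_derivative ?one (r + p) (\<lambda>z. u z i) (L i) Y" by metis
  \<comment> \<open>Chosen so that \<open>12 * e * p\<close> is at most \<open>1 / 2\<close>.\<close>
  define e :: real where "e = 1 / (24 * (real p + 1))"
  have e: "e > 0" by (simp add: e_def)
  obtain \<delta>1 where \<delta>1: "\<delta>1 > 0" "\<forall>i<r + p. \<forall>z\<in>wball ?one (r + p) Y \<delta>1.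
      cmod (u z i - u Y i - (\<Sum>l<r + p. L i l * (z l - Y l))) \<le> e * wdist ?one (r + p) Y z"
    by (rule has_C_derivative_uniform[where u = u and B = L, OF L e])
  obtain \<delta>2 where \<delta>2: "\<delta>2 > 0" "wball ?one (r + p) Y \<delta>2 \<subseteq> \<Omega>"
    using open_in_C_contains_wball[OF positive_weights_one \<Omega>] unfolding Y_def by blast
  define R where "R = min \<delta>1 \<delta>2"
  have R: "R > 0" using \<delta>1 \<delta>2 by (simp add: R_def)
  define C where "C = (\<Sum>i<r + p. \<Sum>l<r. cmod (L i l))"
  have C: "C \<ge> 0" by (simp add: C_def sum_nonneg)
  define K where "K = 1 + C / e"
  have K: "K \<ge> 1" "C \<le> e * K" using C e by (auto simp: K_def field_simps)
  define w where "w i = (if i < r then K else 1)" for i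
  have w: "positive_weights (r + p) w" using K by (simp add: positive_weights_def w_def)
  have w1: "wdist ?one (r + p) x y \<le> wdist w (r + p) x y" for x y
    unfolding wdist_def
  proof (rule sum_mono)
    fix i
    have "1 * cmod (y i - x i) \<le> w i * cmod (y i - x i)"
      using K by (intro mult_right_mono) (auto simp: w_def)
    then show "1 * cmod (y i - x i) \<le> w i * cmod (y i - x i)" .
  qed
  have sub1: "wball w (r + p) Y R \<subseteq> wball ?one (r + p) Y R"
  proof
    fix z assume "z \<in> wball w (r + p) Y R"
    then show "z \<in> wball ?one (r + p) Y R" using w1[of Y z] by (simp add: wball_def)
  qed
  have sub\<Omega>: "wball w (r + p) Y R \<subseteq> \<Omega>"
  proof -
    have "R \<le> \<delta>2" by (simp add: R_def)
    then have "wball ?one (r + p) Y R \<subseteq> wball ?one (r + p) Y \<delta>2" by (rule wball_mono)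
    then show ?thesis using sub1 \<delta>2(2) by (meson subset_trans)
  qed
  have bound: "cmod (u z i) \<le> 3 * e * R" if z: "z \<in> wball w (r + p) Y R" and i: "i < r + p" for z i
  proof -
    define z' where "z' = pair r (\<lambda>_. 0) (drop_coords r z)"
    have zC: "z \<in> Cspace (r + p)" and dz: "wdist w (r + p) Y z < R" using z by (auto simp: wball_def)
    have dz1: "wdist ?one (r + p) Y z < R" using w1[of Y z] dz by linarith
    have z'C: "z' \<in> Cspace (r + p)" unfolding z'_def by (intro pair_in_Cspace drop_coords_in_Cspace zC)
    have z'l: "z' l = (if l < r then 0 else z l)" and Yl: "l < r \<Longrightarrow> Y l = 0" for l
      by (auto simp: z'_def Y_def pair_def drop_coords_def)
    have dz'1: "wdist ?one (r + p) Y z' < R"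
    proof -
      have "wdist ?one (r + p) Y z' \<le> wdist ?one (r + p) Y z"
        unfolding wdist_def by (rule sum_mono) (auto simp: z'l Yl)
      then show ?thesis using dz1 by linarith
    qed
    have est: "cmod (u x i - (\<Sum>l<r + p. L i l * (x l - Y l))) \<le> e * R"
      if x: "x \<in> Cspace (r + p)" "wdist ?one (r + p) Y x < R" for x
    proof -
      have "x \<in> wball ?one (r + p) Y \<delta>1" using x by (auto simp: wball_def R_def)
      then have "cmod (u x i - (\<Sum>l<r + p. L i l * (x l - Y l))) \<le> e * wdist ?one (r + p) Y x"
        using \<delta>1(2) i uY by fastforce
      also have "\<dots> \<le> e * R" using x e by (intro mult_left_mono) auto
      finally show ?thesis .
    qed
    have "u z' i = 0" by (simp add: z'_def u_zero)
    then have est': "cmod (\<Sum>l<r + p. L i l * (z' l - Y l)) \<le> e * R"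
      using est[OF z'C dz'1] by simp
    have "(\<Sum>l<r + p. L i l * (z l - Y l)) - (\<Sum>l<r + p. L i l * (z' l - Y l)) =
        (\<Sum>l<r + p. if l < r then L i l * z l else 0)"
      unfolding sum_subtractf[symmetric] by (rule sum.cong) (auto simp: z'l Yl)
    also have "\<dots> = (\<Sum>l<r. L i l * z l)"
      by (rule sum.mono_neutral_cong_right) auto
    finally have diffs: "(\<Sum>l<r + p. L i l * (z l - Y l)) =
        (\<Sum>l<r + p. L i l * (z' l - Y l)) + (\<Sum>l<r. L i l * z l)" by (simp add: algebra_simps)
    have "cmod (\<Sum>l<r. L i l * z l) \<le> (\<Sum>l<r. cmod (L i l) * (R / K))"
    proof (rule sum_norm_le)
      fix l assume l: "l \<in> {..<r}"
      have "K * cmod (z l) < R"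
        using coordinate_le_wdist[OF w, of l z Y] dz l Yl[of l] by (simp add: w_def)
      then have "cmod (z l) \<le> R / K" using K by (simp add: field_simps)
      then show "cmod (L i l * z l) \<le> cmod (L i l) * (R / K)"
        unfolding norm_mult by (intro mult_left_mono) auto
    qed
    also have "\<dots> = (\<Sum>l<r. cmod (L i l)) * (R / K)" by (simp only: sum_distrib_right)
    also have "\<dots> \<le> C * (R / K)"
    proof (rule mult_right_mono)
      show "(\<Sum>l<r. cmod (L i l)) \<le> C" unfolding C_def using i
        by (intro member_le_sum[of i "{..<r + p}" "\<lambda>i. \<Sum>l<r. cmod (L i l)"]) (auto intro: sum_nonneg)
    qed (use R K in auto)
    also have "\<dots> \<le> e * K * (R / K)" using K R by (intro mult_right_mono) auto
    also have "\<dots> = e * R" using K by simp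
    finally have low: "cmod (\<Sum>l<r. L i l * z l) \<le> e * R" .
    define a where "a = (\<Sum>l<r + p. L i l * (z' l - Y l))"
    define b where "b = (\<Sum>l<r. L i l * z l)"
    have "cmod (u z i - (a + b)) \<le> e * R" using est[OF zC dz1] unfolding diffs a_def b_def .
    moreover have "cmod (u z i) \<le> cmod (u z i - (a + b)) + cmod (a + b)"
      using norm_triangle_ineq[of "u z i - (a + b)" "a + b"] by simp
    moreover have "cmod (a + b) \<le> cmod a + cmod b" by (rule norm_triangle_ineq)
    ultimately show ?thesis using est' low unfolding a_def b_def by linarith
  qed
  have lip: "wdist w (r + p) (u z) (u z') \<le> wdist w (r + p) z z' / 2"
    if z: "z \<in> wball w (r + p) Y (R / 4)" "z' \<in> wball w (r + p) Y (R / 4)" for z z'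
  proof -
    have coord: "w i * cmod (u z' i - u z i) \<le> (if i < r then 0 else 12 * e * wdist w (r + p) z z')"
      if i: "i < r + p" for i
    proof (cases "i < r")
      case False
      have "cmod (u z' i - u z i) \<le> 4 * (3 * e * R) / R * wdist w (r + p) z z'"
      proof (rule bounded_holomorphic_lipschitz[where g = "\<lambda>z. u z i", OF w YC R _ _ _ z])
        show "3 * e * R > 0" using e R by simp
      qed (use diff sub\<Omega> bound i in auto)
      then show ?thesis using False R by (simp add: w_def)
    qed (simp add: u_low)
    have "wdist w (r + p) (u z) (u z') \<le> (\<Sum>i<r + p. if i < r then 0 else 12 * e * wdist w (r + p) z z')"
      unfolding wdist_def[of w "r + p" "u z"] by (rule sum_mono) (use coord in auto)
    also have "\<dots> = (\<Sum>i\<in>{r..<r + p}. 12 * e * wdist w (r + p) z z')"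
      by (rule sum.mono_neutral_cong_right) auto
    also have "\<dots> = (12 * e * real p) * wdist w (r + p) z z'" by simp
    also have "\<dots> \<le> 1 / 2 * wdist w (r + p) z z'"
      by (intro mult_right_mono wdist_nonneg[OF w]) (simp add: e_def field_simps)
    finally show ?thesis by simp
  qed
  have "biholomorphic_germ (r + p) {Y} {Y} (\<lambda>z i. z i + u z i)"
  proof (rule near_identity_biholomorphic[OF w YC _ uY _ lip])
    show "R / 4 > 0" using R by simp
    show "u z \<in> Cspace (r + p)" for z using u_low by (simp add: Cspace_def)
    fix z i assume "z \<in> wball w (r + p) Y (R / 4)" "i < r + p"
    moreover from this have "z \<in> \<Omega>" using sub\<Omega> wball_mono[of "R / 4" R w "r + p" Y] R by auto
    ultimately show "complex_differentiable_at (r + p) (\<lambda>y. u y i) z" using diff by blast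
  qed
  then show ?thesis by (simp add: Y_def)
qed

text \<open>With the coordinate change \<open>\<Psi>(t,y) = (t, y + f\<^sub>t(g(y)) - f\<^sub>0(g(y)))\<close> of the target, one has
\<open>\<Psi>(t,f(x)) = (t,f\<^sub>t(x))\<close>, because \<open>g(f(x)) = x\<close> and \<open>f\<^sub>0 = f\<close>. The coordinate change of the source is the identity.\<close>
lemma stable_of_left_inverse:
  assumes f: "multigerm n p {x0} {y0} f"
    and V: "y0 \<in> V" and g: "holomorphic_map p n V g"
    and U0: "open_in_C n U0" "x0 \<in> U0" and gf: "\<And>x. x \<in> U0 \<Longrightarrow> g (f x) = x"
  shows "stable_multigerm n p {x0} y0 f"
  unfolding stable_multigerm_def
proof (intro conjI allI impI)
  show "multigerm n p {x0} {y0} f" by (rule f)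
  have x0C: "x0 \<in> Cspace n" and y0C: "y0 \<in> Cspace p" and fx0: "f x0 = y0"
    using f by (auto simp: multigerm_def)
  obtain Uf where Uf: "x0 \<in> Uf" "holomorphic_map n p Uf f"
    using f by (auto simp: multigerm_def)
  have gy0: "g y0 = x0" using gf[OF U0(2)] fx0 by simp
  fix r F
  assume unf: "unfolding_of r n p {x0} {y0} f F"
  define X where "X = pair r (\<lambda>_. 0) x0"
  define Y where "Y = pair r (\<lambda>_. 0) y0"
  have zX: "zero_times r {x0} = {X}" and zY: "zero_times r {y0} = {Y}"
    by (auto simp: zero_times_def X_def Y_def)
  have XC: "X \<in> Cspace (r + n)" and YC: "Y \<in> Cspace (r + p)"
    using pair_in_Cspace[OF x0C] pair_in_Cspace[OF y0C] by (auto simp: X_def Y_def)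
  have F: "multigerm (r + n) (r + p) {X} {Y} F"
    using unf unfolding unfolding_of_def zX zY by blast
  obtain W fam where W: "open_in_C (r + n) W" "X \<in> W"
    "\<And>t x. t \<in> Cspace r \<Longrightarrow> x \<in> Cspace n \<Longrightarrow> pair r t x \<in> W \<Longrightarrow> F (pair r t x) = pair r t (fam t x)"
    and fam0: "germ_eq n {x0} (fam (\<lambda>_. 0)) f"
    using unf unfolding unfolding_of_def zX by auto
  obtain U1 where U1: "open_in_C n U1" "x0 \<in> U1" "\<And>x. x \<in> U1 \<Longrightarrow> fam (\<lambda>_. 0) x = f x"
    using fam0 unfolding germ_eq_def by auto
  obtain UF where UF: "X \<in> UF" "holomorphic_map (r + n) (r + p) UF F"
    using F by (auto simp: multigerm_def)
  have openUF: "open_in_C (r + n) UF" using UF by (simp add: holomorphic_map_def)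

  \<comment> \<open>For \<open>z = (t,y)\<close>, the points \<open>a z = (t, g(y))\<close> and \<open>b z = (0, g(y))\<close> are those at which \<open>F\<close> is compared.\<close>
  define a where "a z = pair r z (g (drop_coords r z))" for z
  define b where "b z = pair r (\<lambda>_. 0) (g (drop_coords r z))" for z
  define u where "u z i = (if r \<le> i \<and> i < r + p then F (a z) i - F (b z) i else 0)" for z i
  define \<Psi> where "\<Psi> z = (\<lambda>i. z i + u z i)" for z

  define \<Omega>1 where "\<Omega>1 = {z \<in> Cspace (r + p). drop_coords r z \<in> V}"
  have "open_in_C p V" using g by (simp add: holomorphic_map_def)
  then have open1: "open_in_C (r + p) \<Omega>1"
    unfolding \<Omega>1_def by (rule holomorphic_map_open_preimage[OF holomorphic_map_drop_coords])
  have hol_g: "holomorphic_map (r + p) n \<Omega>1 (\<lambda>z. g (drop_coords r z))"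
    by (rule holomorphic_map_compose[OF _ g])
       (use holomorphic_map_subset[OF holomorphic_map_drop_coords open1] in \<open>auto simp: \<Omega>1_def\<close>)
  have hol_a: "holomorphic_map (r + p) (r + n) \<Omega>1 a"
    unfolding a_def by (rule holomorphic_map_pair[OF hol_g]) simp
  have hol_b: "holomorphic_map (r + p) (r + n) \<Omega>1 b"
    unfolding b_def by (rule holomorphic_map_pair_const[OF hol_g])
  define \<Omega> where "\<Omega> = {z \<in> \<Omega>1. a z \<in> UF} \<inter> {z \<in> \<Omega>1. b z \<in> UF}"
  have open\<Omega>: "open_in_C (r + p) \<Omega>"
    unfolding \<Omega>_def
    by (intro openin_Int holomorphic_map_open_preimage[OF hol_a openUF] holomorphic_map_open_preimage[OF hol_b openUF])
  have \<Omega>1: "\<Omega> \<subseteq> \<Omega>1" by (auto simp: \<Omega>_def)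
  have aY: "a Y = X" and bY: "b Y = X" by (auto simp: a_def b_def Y_def X_def gy0)
  have Y\<Omega>: "Y \<in> \<Omega>" using V UF(1) YC by (simp add: \<Omega>_def \<Omega>1_def aY bY) (simp add: Y_def)
  have Fa: "holomorphic_map (r + p) (r + p) \<Omega> (\<lambda>z. F (a z))"
    by (rule holomorphic_map_compose[OF holomorphic_map_subset[OF hol_a open\<Omega> \<Omega>1] UF(2)]) (auto simp: \<Omega>_def)
  have Fb: "holomorphic_map (r + p) (r + p) \<Omega> (\<lambda>z. F (b z))"
    by (rule holomorphic_map_compose[OF holomorphic_map_subset[OF hol_b open\<Omega> \<Omega>1] UF(2)]) (auto simp: \<Omega>_def)
  have \<Omega>C: "z \<in> Cspace (r + p)" if "z \<in> \<Omega>" for z using that by (auto simp: \<Omega>_def \<Omega>1_def)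
  have u_diff: "complex_differentiable_at (r + p) (\<lambda>z. u z i) z" if z: "z \<in> \<Omega>" and i: "i < r + p" for z i
  proof (cases "r \<le> i")
    case True
    then have "(\<lambda>z. u z i) = (\<lambda>z. F (a z) i - F (b z) i)" using i by (simp add: u_def)
    moreover have "complex_differentiable_at (r + p) (\<lambda>z. F (a z) i - F (b z) i) z"
      using Fa Fb z i by (intro complex_differentiable_diff \<Omega>C[OF z]) (auto simp: holomorphic_map_def)
    ultimately show ?thesis by simp
  next
    case False
    then have "(\<lambda>z. u z i) = (\<lambda>z. 0)" by (auto simp: u_def)
    then show ?thesis using complex_differentiable_const[OF \<Omega>C[OF z]] by simp
  qed
  have u_low: "u z i = 0" if "i < r \<or> i \<ge> r + p" for z i using that by (auto simp: u_def)
  have u_zero: "u (pair r (\<lambda>_. 0) y) = (\<lambda>_. 0)" for y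
    by (auto simp: u_def a_def b_def)
  have \<Psi>_bihol: "biholomorphic_germ (r + p) {Y} {Y} \<Psi>"
    using parametric_perturbation_biholomorphic[OF open\<Omega> Y\<Omega>[unfolded Y_def] y0C u_low u_zero u_diff]
    unfolding \<Psi>_def Y_def by blast
  have \<Psi>Y: "\<Psi> Y = Y" unfolding \<Psi>_def Y_def u_zero by simp
  have \<Psi>C: "\<Psi> z \<in> Cspace (r + p)" if "z \<in> Cspace (r + p)" for z
    using that u_low by (simp add: \<Psi>_def Cspace_def)
  have \<Psi>_hol: "holomorphic_map (r + p) (r + p) \<Omega> \<Psi>"
    unfolding holomorphic_map_def
  proof (intro conjI ballI allI impI)
    fix z j assume "z \<in> \<Omega>" "j < r + p"
    then show "complex_differentiable_at (r + p) (\<lambda>y. \<Psi> y j) z"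
      unfolding \<Psi>_def
      by (intro complex_differentiable_add complex_differentiable_coordinate u_diff \<Omega>C)
  qed (use open\<Omega> \<Psi>C \<Omega>C in auto)
  have \<Psi>_unf: "unfolding_of r p p {y0} {y0} id \<Psi>"
    unfolding unfolding_of_def zY
  proof (intro conjI exI[of _ "Cspace (r + p)"] exI[of _ "\<lambda>t y. drop_coords r (\<Psi> (pair r t y))"] ballI impI)
    show "multigerm (r + p) (r + p) {Y} {Y} \<Psi>"
      unfolding multigerm_def using YC \<Psi>Y \<Psi>_hol Y\<Omega> by auto
    show "\<Psi> (pair r t y) = pair r t (drop_coords r (\<Psi> (pair r t y)))" for t y
      by (auto simp: \<Psi>_def pair_def drop_coords_def u_low)
    show "germ_eq p {y0} (\<lambda>y. drop_coords r (\<Psi> (pair r (\<lambda>_. 0) y))) id"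
      unfolding germ_eq_def \<Psi>_def u_zero using y0C by (intro exI[of _ "Cspace p"]) auto
  qed (use YC in auto)

  have drop_hol: "holomorphic_map (r + n) n (Cspace (r + n)) (drop_coords r)"
    by (rule holomorphic_map_drop_coords)
  define \<Theta> where "\<Theta> = ({z \<in> Cspace (r + n). drop_coords r z \<in> U0 \<inter> U1 \<inter> Uf} \<inter> (W \<inter> UF)) \<inter>
    {z \<in> Cspace (r + n). pair r (\<lambda>_. 0) (drop_coords r z) \<in> W}"
  have "open_in_C n Uf" using Uf by (simp add: holomorphic_map_def)
  then have open\<Theta>: "open_in_C (r + n) \<Theta>"
    unfolding \<Theta>_def
    by (intro openin_Int holomorphic_map_open_preimage[OF drop_hol]
        holomorphic_map_open_preimage[OF holomorphic_map_pair_const[OF drop_hol]] W(1) openUF U0(1) U1(1))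
  have X\<Theta>: "X \<in> \<Theta>"
    using XC W(2) UF(1) U0(2) U1(2) Uf(1) by (simp add: \<Theta>_def) (simp add: X_def)
  have factor: "F z = \<Psi> (id_times r f z)" if z: "z \<in> \<Theta>" for z
  proof -
    define x where "x = drop_coords r z"
    define t where "t i = (if i < r then z i else 0)" for i
    have zz: "z = pair r t x" by (auto simp: t_def x_def pair_def drop_coords_def)
    have tC: "t \<in> Cspace r" by (simp add: t_def Cspace_def)
    have zC: "z \<in> Cspace (r + n)" using z by (simp add: \<Theta>_def)
    then have xC: "x \<in> Cspace n" unfolding x_def by (rule drop_coords_in_Cspace)
    have x: "x \<in> U0" "x \<in> U1" "x \<in> Uf" "pair r (\<lambda>_. 0) x \<in> W" "z \<in> W" "z \<in> UF"
      using z by (auto simp: \<Theta>_def x_def)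
    have Fz: "F z = pair r t (fam t x)" unfolding zz by (rule W(3)[OF tC xC]) (use x zz in simp)
    have F0: "F (pair r (\<lambda>_. 0) x) = pair r (\<lambda>_. 0) (f x)"
      using W(3)[OF zero_in_Cspace xC x(4)] U1(3)[OF x(2)] by simp
    have fxC: "f x \<in> Cspace p" using Uf(2) x(3) by (auto simp: holomorphic_map_def)
    have FzC: "F z \<in> Cspace (r + p)" using UF(2) x(6) by (auto simp: holomorphic_map_def)
    define Z where "Z = pair r z (f x)"
    have gZ: "g (drop_coords r Z) = x" by (simp add: Z_def gf[OF x(1)])
    have aZ: "a Z = z" unfolding a_def gZ by (simp add: Z_def x_def)
    have bZ: "b Z = pair r (\<lambda>_. 0) x" unfolding b_def gZ ..
    have "F z i = \<Psi> Z i" for i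
    proof -
      consider "i < r" | "r \<le> i" "i < r + p" | "i \<ge> r + p" by linarith
      then show ?thesis
      proof cases
        case 1
        then show ?thesis unfolding Fz by (simp add: \<Psi>_def u_low Z_def pair_def t_def)
      next
        case 2
        then show ?thesis unfolding \<Psi>_def u_def aZ bZ F0 by (simp add: Z_def pair_def)
      next
        case 3
        then show ?thesis using FzC fxC by (simp add: \<Psi>_def u_low Z_def pair_def Cspace_def)
      qed
    qed
    then show ?thesis unfolding id_times_eq Z_def x_def by blast
  qed
  show "trivial_unfolding r n p {x0} {y0} f F"
    unfolding trivial_unfolding_def A_equivalent_via_def zX zY
  proof (intro exI conjI)
    show "unfolding_of r n n {x0} {x0} id id" using x0C by (intro unfolding_of_id) auto
    show "unfolding_of r p p {y0} {y0} id \<Psi>" by (rule \<Psi>_unf)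
    show "biholomorphic_germ (r + n) {X} {X} id" using XC by (intro biholomorphic_germ_id) auto
    show "biholomorphic_germ (r + p) {Y} {Y} \<Psi>" by (rule \<Psi>_bihol)
    show "germ_eq (r + n) {X} F (\<Psi> \<circ> id_times r f \<circ> id)"
      unfolding germ_eq_def using open\<Theta> X\<Theta> factor by (intro exI[of _ \<Theta>]) auto
  qed
qed

section \<open>A-finiteness of the power map\<close>

lemma continuous_on_lin_form: "continuous_on UNIV (lin_form n H k)"
  unfolding lin_form_def by (intro continuous_intros continuous_on_product_coordinates)

lemma power_map_coordinate:
  assumes "length m = n" "length r = n"
  shows "power_map n H m r x k = (if k < 2 * n then lin_form n H k x ^ ((m @ r) ! k) else 0)"
  using power_map_eq_lin_form_power[OF assms] by (auto simp: power_map_def)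

lemma continuous_on_power_map:
  assumes "length m = n" "length r = n"
  shows "continuous_on UNIV (power_map n H m r)"
proof (rule continuous_on_coordinatewise_then_product)
  fix k
  show "continuous_on UNIV (\<lambda>x. power_map n H m r x k)"
    unfolding power_map_coordinate[OF assms]
    by (cases "k < 2 * n") (auto intro!: continuous_intros continuous_on_lin_form)
qed

lemma power_map_in_Cspace: "power_map n H m r x \<in> Cspace (2 * n)"
  by (simp add: power_map_def Cspace_def)

lemma holomorphic_power_map:
  assumes "length m = n" "length r = n"
  shows "holomorphic_map n (2 * n) (Cspace n) (power_map n H m r)"
  unfolding holomorphic_map_def
proof (intro conjI ballI allI impI)
  fix x k assume x: "x \<in> Cspace n" and k: "k < 2 * n"
  have lin: "complex_differentiable_at n (\<lambda>x. lin_form n H k x) x"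
    unfolding lin_form_def
    by (intro complex_differentiable_sum complex_differentiable_cmult complex_differentiable_coordinate x) auto
  have "complex_differentiable_at n (\<lambda>x. lin_form n H k x ^ ((m @ r) ! k)) x"
    by (rule complex_differentiable_compose_field[OF x lin])
       (intro field_differentiable_power field_differentiable_ident)
  then show "complex_differentiable_at n (\<lambda>x. power_map n H m r x k) x"
    unfolding power_map_coordinate[OF assms] using k by simp
qed (auto simp: power_map_in_Cspace)

lemma open_finite_less:
  fixes h :: "nat \<Rightarrow> 'a :: topological_space \<Rightarrow> real"
  assumes "\<And>k. k < n \<Longrightarrow> continuous_on UNIV (h k)"
  shows "open {x. \<forall>k<n. h k x < \<eta> k}"
proof -
  have "{x. \<forall>k<n. h k x < \<eta> k} = (\<Inter>k\<in>{..<n}. {x. h k x < \<eta> k})" by auto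
  also have "open \<dots>" using assms by (intro open_INT ballI open_Collect_less continuous_on_const) auto
  finally show ?thesis .
qed

lemma compact_polydisc: "compact {x :: nat \<Rightarrow> complex. \<forall>i. cmod (x i) \<le> R i}"
proof -
  have "compactin (product_topology (\<lambda>_. euclidean) UNIV) (Pi\<^sub>E UNIV (\<lambda>i. cball (0 :: complex) (R i)))"
    unfolding compactin_PiE by auto
  moreover have "Pi\<^sub>E UNIV (\<lambda>i. cball (0 :: complex) (R i)) = {x. \<forall>i. cmod (x i) \<le> R i}"
    by (auto simp: PiE_def Pi_def)
  ultimately show ?thesis by (simp add: euclidean_product_topology)
qed

text \<open>A neighbourhood of a point \<open>y\<close> of the target has its preimage inside a compact polydisc, since the components
\<open>x\<^sub>i^m\<^sub>i\<close> bound the \<open>x\<^sub>i\<close>. Near \<open>y\<close>, the image of a closed set is therefore contained in the image of a compact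
part of it.\<close>
lemma closed_map_power_map:
  assumes len: "length m = n" "length r = n" and pos: "\<forall>i<n. m ! i > 0"
  shows "closed_map (top_of_set (Cspace n)) (top_of_set (Cspace (2 * n))) (power_map n H m r)"
  unfolding closed_map_def
proof (intro allI impI)
  let ?f = "power_map n H m r"
  fix C assume "closedin (top_of_set (Cspace n)) C"
  then obtain T where T: "closed T" "C = Cspace n \<inter> T" by (auto simp: closedin_closed)
  have "Cspace (2 * n) \<inter> closure (?f ` C) \<subseteq> ?f ` C"
  proof
    fix y assume y: "y \<in> Cspace (2 * n) \<inter> closure (?f ` C)"
    define R where "R i = (if i < n then cmod (y i) + 1 else 0)" for i
    define B where "B = {x :: nat \<Rightarrow> complex. \<forall>i. cmod (x i) \<le> R i}"
    define O' where "O' = {z :: nat \<Rightarrow> complex. \<forall>i<n. cmod (z i) < cmod (y i) + 1}"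
    have BC: "B \<subseteq> Cspace n"
    proof
      fix x assume "x \<in> B"
      then have "cmod (x i) \<le> 0" if "i \<ge> n" for i using that by (auto simp: B_def R_def dest: spec[of _ i])
      then show "x \<in> Cspace n" by (simp add: Cspace_def)
    qed
    have "compact (T \<inter> B)" unfolding B_def by (intro closed_Int_compact T compact_polydisc)
    then have "compact (?f ` (T \<inter> B))"
      by (intro compact_continuous_image continuous_on_subset[OF continuous_on_power_map[OF len]]) auto
    then have closed: "closed (?f ` (T \<inter> B))" by (rule compact_imp_closed)
    have "open O'" unfolding O'_def
      by (intro open_finite_less continuous_intros continuous_on_product_coordinates)
    moreover have "y \<in> O'" by (simp add: O'_def)
    ultimately have "y \<in> closure (O' \<inter> ?f ` C)" using y open_Int_closure_subset[of O' "?f ` C"] by blast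
    moreover have "O' \<inter> ?f ` C \<subseteq> ?f ` (T \<inter> B)"
    proof
      fix z assume z: "z \<in> O' \<inter> ?f ` C"
      then obtain x where x: "x \<in> Cspace n" "x \<in> T" "z = ?f x" using T by auto
      have "cmod (x i) \<le> R i" for i
      proof (cases "i < n")
        case True
        show ?thesis
        proof (rule ccontr)
          assume "\<not> cmod (x i) \<le> R i"
          then have big: "cmod (x i) > cmod (y i) + 1" using True by (simp add: R_def)
          then have "cmod (x i) \<ge> 1" using norm_ge_zero[of "y i"] by linarith
          then have "cmod (x i) ^ 1 \<le> cmod (x i) ^ (m ! i)"
            using pos True by (intro power_increasing) auto
          also have "\<dots> = cmod (z i)" using True x(3) by (simp add: power_map_def norm_power)
          also have "\<dots> < cmod (y i) + 1" using z True by (simp add: O'_def)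
          finally show False using big by simp
        qed
      next
        case False
        then show ?thesis using x(1) by (simp add: R_def Cspace_def)
      qed
      then show "z \<in> ?f ` (T \<inter> B)" using x by (auto simp: B_def)
    qed
    ultimately have "y \<in> ?f ` (T \<inter> B)" using closure_minimal[OF _ closed] by blast
    then show "y \<in> ?f ` C" using T BC by blast
  qed
  moreover have "?f ` C \<subseteq> Cspace (2 * n)" using power_map_in_Cspace by blast
  ultimately have "?f ` C = Cspace (2 * n) \<inter> closure (?f ` C)" using closure_subset[of "?f ` C"] by blast
  then show "closedin (top_of_set (Cspace (2 * n))) (?f ` C)"
    by (subst closedin_closed) (use closed_closure in blast)
qed

text \<open>The branch \<open>c * exp (Ln (y / c ^ d) / d)\<close> of the root, which takes the value \<open>c\<close> at \<open>c ^ d\<close>, inverts the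
power near \<open>c\<close> because there \<open>Ln\<close> of a power of \<open>l / c\<close> is the multiple of its \<open>Ln\<close>.\<close>
lemma local_root:
  fixes c :: complex
  assumes c: "c \<noteq> 0" and d: "d > 0"
  obtains \<rho> \<eta> where "\<eta> > 0" "\<And>y. cmod (y / c ^ d - 1) < 1 \<Longrightarrow> \<rho> field_differentiable (at y)"
    "\<And>l. cmod (l / c - 1) < \<eta> \<Longrightarrow> \<rho> (l ^ d) = l"
proof -
  define \<rho> where "\<rho> y = c * exp (Ln (y / c ^ d) / of_nat d)" for y
  have "\<rho> field_differentiable (at y)" if "cmod (y / c ^ d - 1) < 1" for y
  proof -
    have "y / c ^ d \<notin> \<real>\<^sub>\<le>\<^sub>0"
    proof
      assume "y / c ^ d \<in> \<real>\<^sub>\<le>\<^sub>0"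
      then have "Re (y / c ^ d) \<le> 0" by (auto simp: complex_nonpos_Reals_iff)
      then have "1 \<le> \<bar>Re (y / c ^ d - 1)\<bar>" by simp
      also have "\<dots> \<le> cmod (y / c ^ d - 1)" by (rule abs_Re_le_cmod)
      finally show False using that by simp
    qed
    then have "\<rho> holomorphic_on {z. z / c ^ d \<notin> \<real>\<^sub>\<le>\<^sub>0}" "y \<in> {z. z / c ^ d \<notin> \<real>\<^sub>\<le>\<^sub>0}"
      unfolding \<rho>_def using c d by (auto intro!: holomorphic_intros)
    moreover have "open {z. z / c ^ d \<notin> \<real>\<^sub>\<le>\<^sub>0}"
    proof -
      have "open ((\<lambda>z. z / c ^ d) -` (- \<real>\<^sub>\<le>\<^sub>0))"
        using c by (intro continuous_open_vimage) (auto intro!: continuous_intros)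
      moreover have "(\<lambda>z. z / c ^ d) -` (- \<real>\<^sub>\<le>\<^sub>0) = {z. z / c ^ d \<notin> \<real>\<^sub>\<le>\<^sub>0}" by auto
      ultimately show ?thesis by simp
    qed
    ultimately show ?thesis using holomorphic_on_imp_differentiable_at by blast
  qed
  moreover have "\<exists>\<eta>>0. \<forall>w. cmod (w - 1) < \<eta> \<longrightarrow> w \<noteq> 0 \<and> \<bar>Im (of_nat d * Ln w)\<bar> < pi"
  proof -
    have "isCont (\<lambda>w. Im (of_nat d * Ln w)) 1" by (intro continuous_Im continuous_mult continuous_const continuous_at_Ln) auto
    then obtain \<eta> where \<eta>: "\<eta> > 0" "\<And>w. dist w 1 < \<eta> \<Longrightarrow> dist (Im (of_nat d * Ln w)) (Im (of_nat d * Ln 1)) < pi"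
      using pi_gt_zero unfolding continuous_at_eps_delta by blast
    have "w \<noteq> 0 \<and> \<bar>Im (of_nat d * Ln w)\<bar> < pi" if "cmod (w - 1) < min \<eta> 1" for w
    proof -
      have "w \<noteq> 0" using that by auto
      moreover have "dist (Im (of_nat d * Ln w)) (Im (of_nat d * Ln 1)) < pi"
        using that by (intro \<eta>(2)) (simp add: dist_norm)
      ultimately show ?thesis by (simp add: dist_norm)
    qed
    then show ?thesis using \<eta>(1) by (intro exI[of _ "min \<eta> 1"]) auto
  qed
  then obtain \<eta> where \<eta>: "\<eta> > 0" "\<And>w. cmod (w - 1) < \<eta> \<Longrightarrow> w \<noteq> 0 \<and> \<bar>Im (of_nat d * Ln w)\<bar> < pi" by blast
  have "\<rho> (l ^ d) = l" if "cmod (l / c - 1) < \<eta>" for l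
  proof -
    define w where "w = l / c"
    have w: "w \<noteq> 0" "\<bar>Im (of_nat d * Ln w)\<bar> < pi" using \<eta>(2)[of w] that by (auto simp: w_def)
    have "l ^ d / c ^ d = w ^ d" by (simp add: w_def power_divide)
    also have "\<dots> = exp (of_nat d * Ln w)" using w(1) by (simp add: exp_of_nat_mult)
    finally have "Ln (l ^ d / c ^ d) = of_nat d * Ln w"
      using w(2) by (simp add: Ln_exp abs_less_iff)
    then have "\<rho> (l ^ d) = c * w" using d w(1) by (simp add: \<rho>_def)
    then show ?thesis using c by (simp add: w_def)
  qed
  ultimately show thesis using that[of \<eta> \<rho>] \<eta>(1) by blast
qed

text \<open>Fewer than \<open>n\<close> of the forms vanish at \<open>x0\<close>, so at least \<open>n\<close> do not. Near \<open>x0\<close> their values are recovered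
from their powers by branches of roots, and \<open>x\<close> is recovered from their values by linear algebra.\<close>
lemma power_map_local_left_inverse:
  assumes H: "H \<in> carrier_mat n n" and rk: "all_submatrices_maximal_rank H"
    and len: "length m = n" "length r = n" and pos: "\<forall>k < length (m @ r). (m @ r) ! k > 0"
    and x0: "x0 \<in> Cspace n" "x0 \<noteq> (\<lambda>_. 0)"
  obtains V U g where "power_map n H m r x0 \<in> V" "holomorphic_map (2 * n) n V g"
    "open_in_C n U" "x0 \<in> U" "\<And>x. x \<in> U \<Longrightarrow> g (power_map n H m r x) = x"
proof -
  let ?f = "power_map n H m r"
  define d where "d k = (m @ r) ! k" for k
  have d: "d k > 0" if "k < 2 * n" for k using pos len that by (simp add: d_def)
  have gp: "general_position n (\<lambda>k j. of_rat (form_coeff n H k j))"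
    by (rule general_position_forms[OF H rk])
  define Z where "Z = {k. k < 2 * n \<and> lin_form n H k x0 = 0}"
  have "card Z < n"
  proof (rule ccontr)
    assume "\<not> card Z < n"
    then have "n \<le> card Z" by simp
    then obtain A where A: "A \<subseteq> Z" "card A = n" by (rule obtain_subset_with_card_n)
    have "x0 j = 0" for j
    proof (cases "j < n")
      case True
      then show ?thesis using A
        by (intro general_positionD[OF gp _ A(2), of x0]) (auto simp: Z_def lin_form_def)
    qed (use x0 in \<open>simp add: Cspace_def\<close>)
    then show False using x0(2) by blast
  qed
  moreover have "card ({..<2 * n} - Z) = 2 * n - card Z"
    by (subst card_Diff_subset) (auto simp: Z_def)
  ultimately have "n \<le> card ({..<2 * n} - Z)" by linarith
  then obtain A where A: "A \<subseteq> {..<2 * n} - Z" "card A = n" "finite A"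
    by (rule obtain_subset_with_card_n)
  obtain s where s: "bij_betw s {0..<n} A" using ex_bij_betw_nat_finite[OF A(3)] A(2) by auto
  have sA: "s k < 2 * n" "lin_form n H (s k) x0 \<noteq> 0" if "k < n" for k
    using s that A by (auto simp: bij_betw_def Z_def)
  have ker: "\<forall>j<n. x j = 0" if "\<And>k. k < n \<Longrightarrow> (\<Sum>j<n. of_rat (form_coeff n H (s k) j) * x j) = 0"
    for x :: "nat \<Rightarrow> complex"
  proof (intro allI impI)
    fix j assume "j < n"
    show "x j = 0"
    proof (rule general_positionD[OF gp _ A(2) _ \<open>j < n\<close>])
      fix k assume "k \<in> A"
      then obtain i where "i < n" "k = s i" using s by (auto simp: bij_betw_def)
      then show "(\<Sum>j<n. of_rat (form_coeff n H k j) * x j) = 0" using that by simp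
    qed (use A in auto)
  qed
  obtain M where M: "\<And>x i. i < n \<Longrightarrow> (\<Sum>k<n. M i k * lin_form n H (s k) x) = x i"
    unfolding lin_form_def
    by (rule left_inverse_of_trivial_kernel[of n "\<lambda>k j. complex_of_rat (form_coeff n H (s k) j)", OF ker]) (blast, blast)
  define c where "c k = lin_form n H (s k) x0" for k
  define D where "D k = d (s k)" for k
  have "\<exists>\<rho> \<eta>. \<eta> > 0 \<and> (\<forall>y. cmod (y / c k ^ D k - 1) < 1 \<longrightarrow> \<rho> field_differentiable (at y)) \<and>
      (\<forall>l. cmod (l / c k - 1) < \<eta> \<longrightarrow> \<rho> (l ^ D k) = l)" if k: "k < n" for k
    by (rule local_root[of "c k" "D k"]) (use sA[OF k] d in \<open>auto simp: c_def D_def\<close>)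
  then obtain \<rho> \<eta> where \<eta>: "\<And>k. k < n \<Longrightarrow> \<eta> k > 0"
    and \<rho>: "\<And>k y. k < n \<Longrightarrow> cmod (y / c k ^ D k - 1) < 1 \<Longrightarrow> \<rho> k field_differentiable (at y)"
      "\<And>k l. k < n \<Longrightarrow> cmod (l / c k - 1) < \<eta> k \<Longrightarrow> \<rho> k (l ^ D k) = l"
    by metis
  define g where "g y i = (if i < n then \<Sum>k<n. M i k * \<rho> k (y (s k)) else 0)" for y :: "nat \<Rightarrow> complex" and i
  define V where "V = Cspace (2 * n) \<inter> {y. \<forall>k<n. cmod (y (s k) / c k ^ D k - 1) < 1}"
  define U where "U = Cspace n \<inter> {x. \<forall>k<n. cmod (lin_form n H (s k) x / c k - 1) < \<eta> k}"
  have c0: "c k \<noteq> 0" if "k < n" for k using sA[OF that] by (simp add: c_def)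
  have fk: "?f x (s k) = lin_form n H (s k) x ^ D k" if "k < n" for x k
    using power_map_eq_lin_form_power[OF len sA(1)[OF that]] by (simp add: D_def d_def)
  have "open_in_C n U" unfolding U_def
    using c0 by (intro openin_open_Int open_finite_less continuous_intros continuous_on_lin_form) auto
  moreover have "x0 \<in> U" using x0 c0 \<eta> by (simp add: U_def flip: c_def)
  moreover have "?f x0 \<in> V" using power_map_in_Cspace c0 by (simp add: V_def fk flip: c_def)
  moreover have "g (?f x) = x" if x: "x \<in> U" for x
  proof
    fix i show "g (?f x) i = x i"
    proof (cases "i < n")
      case True
      have "\<rho> k (?f x (s k)) = lin_form n H (s k) x" if "k < n" for k
        unfolding fk[OF that] using x that by (intro \<rho>(2)) (auto simp: U_def)
      then show ?thesis using True M[OF True, of x] by (simp add: g_def)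
    next
      case False
      then show ?thesis using x by (simp add: g_def U_def Cspace_def)
    qed
  qed
  moreover have "holomorphic_map (2 * n) n V g"
    unfolding holomorphic_map_def
  proof (intro conjI ballI allI impI)
    show "open_in_C (2 * n) V" unfolding V_def
      using c0 by (intro openin_open_Int open_finite_less continuous_intros continuous_on_product_coordinates) auto
    show "g ` V \<subseteq> Cspace n" by (auto simp: g_def Cspace_def)
    fix y i assume y: "y \<in> V" and i: "i < n"
    have yC: "y \<in> Cspace (2 * n)" using y by (simp add: V_def)
    have "complex_differentiable_at (2 * n) (\<lambda>y. \<Sum>k<n. M i k * \<rho> k (y (s k))) y"
    proof (intro complex_differentiable_sum complex_differentiable_cmult yC)
      fix k assume "k \<in> {..<n}"
      then have k: "k < n" by simp
      show "complex_differentiable_at (2 * n) (\<lambda>y. \<rho> k (y (s k))) y"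
        by (rule complex_differentiable_compose_field[OF yC complex_differentiable_coordinate[OF yC sA(1)[OF k]]])
           (use y k in \<open>auto simp: V_def intro: \<rho>(1)\<close>)
    qed
    then show "complex_differentiable_at (2 * n) (\<lambda>y. g y i) y" using i by (simp add: g_def)
  qed
  ultimately show thesis using that by blast
qed

theorem theorem9p5:
  fixes n :: nat and H :: "rat mat" and m r :: "nat list"
  assumes "H \<in> carrier_mat n n"
    and "all_submatrices_maximal_rank H"
    and "length m = n" and "length r = n"
    and "\<forall>k < length (m @ r). (m @ r) ! k > 0"
    and "\<forall>k < length (m @ r). \<forall>l < length (m @ r). k \<noteq> l \<longrightarrow> coprime ((m @ r) ! k) ((m @ r) ! l)"
  shows "A_finite n (2 * n) (power_map n H m r)"
proof -
  let ?f = "power_map n H m r"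
  note len = assms(3,4)
  have inj: "x = x'" if "x \<in> Cspace n" "x' \<in> Cspace n" "?f x = ?f x'" for x x'
    using power_map_injective[OF assms] that by blast
  have mpos: "m ! i > 0" if "i < n" for i
    using assms(5)[rule_format, of i] assms(3) that by (simp add: nth_append)
  have f0: "?f (\<lambda>_. 0) = (\<lambda>_. 0)"
  proof
    fix k show "?f (\<lambda>_. 0) k = 0"
      using assms(5) len by (simp add: power_map_coordinate[OF len] lin_form_def zero_power)
  qed
  have germ: "multigerm n (2 * n) {x} {?f x} ?f" if "x \<in> Cspace n" for x
    unfolding multigerm_def
    by (intro conjI exI[of _ "Cspace n"] holomorphic_power_map[OF len]) (use that power_map_in_Cspace in auto)
  have small: "\<exists>U V. U \<subseteq> N \<and> finite_representative n (2 * n) ?f U V \<and>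
      (\<forall>y\<in>V. y \<noteq> (\<lambda>_. 0) \<longrightarrow> stable_multigerm n (2 * n) {x\<in>U. ?f x = y} y ?f)"
    if N: "open_in_C n N" "(\<lambda>_. 0) \<in> N" for N
  proof -
    obtain e where e: "e > 0" "wball (\<lambda>_. 1) n (\<lambda>_. 0) e \<subseteq> N"
      using open_in_C_contains_wball[OF positive_weights_one N] by blast
    \<comment> \<open>The polydisc of radius \<open>\<epsilon>\<close> lies in the ball of radius \<open>e\<close> for the sum distance, also if \<open>n = 0\<close>.\<close>
    define \<epsilon> where "\<epsilon> = e / (real n + 1)"
    have \<epsilon>: "\<epsilon> > 0" using e by (simp add: \<epsilon>_def)
    define V where "V = Cspace (2 * n) \<inter> {y. \<forall>i<n. cmod (y i) < \<epsilon> ^ (m ! i)}"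
    define U where "U = {x \<in> Cspace n. ?f x \<in> V}"
    have openV: "open_in_C (2 * n) V" unfolding V_def
      by (intro openin_open_Int open_finite_less continuous_intros continuous_on_product_coordinates)
    have openU: "open_in_C n U"
      unfolding U_def by (rule holomorphic_map_open_preimage[OF holomorphic_power_map[OF len] openV])
    have V0: "(\<lambda>_. 0) \<in> V" using \<epsilon> by (simp add: V_def)
    have "U \<subseteq> N"
    proof
      fix x assume x: "x \<in> U"
      have "cmod (x i) < \<epsilon>" if "i < n" for i
      proof -
        have "cmod (?f x i) < \<epsilon> ^ (m ! i)" using x that by (simp add: U_def V_def)
        then have "cmod (x i) ^ (m ! i) < \<epsilon> ^ (m ! i)" using that by (simp add: power_map_def norm_power)
        then show ?thesis by (rule power_less_imp_less_base) (use \<epsilon> in simp)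
      qed
      then have "wdist (\<lambda>_. 1) n (\<lambda>_. 0) x \<le> (\<Sum>i<n. \<epsilon>)"
        unfolding wdist_def by (intro sum_mono) (auto simp: less_imp_le)
      also have "\<dots> < e" using e by (simp add: \<epsilon>_def field_simps)
      finally show "x \<in> N" using x e(2) by (auto simp: wball_def U_def)
    qed
    moreover have "finite_representative n (2 * n) ?f U V"
      unfolding finite_representative_def
    proof (intro conjI ballI)
      show "(\<lambda>_. 0) \<in> U" using V0 f0 by (simp add: U_def)
      show "holomorphic_map n (2 * n) U ?f"
        by (rule holomorphic_map_subset[OF holomorphic_power_map[OF len] openU]) (auto simp: U_def)
      show "?f ` U \<subseteq> V" by (auto simp: U_def)
      have "closed_map (subtopology (top_of_set (Cspace n)) U) (subtopology (top_of_set (Cspace (2 * n))) V) ?f"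
        by (rule closed_map_restriction[OF closed_map_power_map[OF len]]) (auto simp: U_def mpos)
      moreover have "Cspace n \<inter> U = U" "Cspace (2 * n) \<inter> V = V" by (auto simp: U_def V_def)
      ultimately show "closed_map (top_of_set U) (top_of_set V) ?f" by (simp add: subtopology_subtopology)
      fix y
      show "finite {x \<in> U. ?f x = y}"
      proof (cases "{x \<in> U. ?f x = y} = {}")
        case True
        then show ?thesis by (simp only: finite.emptyI)
      next
        case False
        then obtain x where "x \<in> U" "?f x = y" by blast
        then have "{x \<in> U. ?f x = y} \<subseteq> {x}" using inj by (auto simp: U_def)
        then show ?thesis by (rule finite_subset) simp
      qed
    qed (use V0 openV in auto)
    moreover have "stable_multigerm n (2 * n) {x\<in>U. ?f x = y} y ?f" if y: "y \<in> V" "y \<noteq> (\<lambda>_. 0)" for y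
    proof (cases "{x \<in> U. ?f x = y} = {}")
      case True
      show ?thesis unfolding True using y by (intro stable_multigerm_empty) (simp add: V_def)
    next
      case False
      then obtain x where x: "x \<in> U" "?f x = y" by blast
      have xC: "x \<in> Cspace n" using x by (simp add: U_def)
      have fib: "{x \<in> U. ?f x = y} = {x}" using inj x by (auto simp: U_def)
      have "x \<noteq> (\<lambda>_. 0)" using x y(2) f0 by auto
      then obtain W U' g where "?f x \<in> W" "holomorphic_map (2 * n) n W g" "open_in_C n U'" "x \<in> U'"
          "\<And>x. x \<in> U' \<Longrightarrow> g (?f x) = x"
        by (rule power_map_local_left_inverse[OF assms(1-5) xC]) blast
      then have "stable_multigerm n (2 * n) {x} (?f x) ?f"
        by (intro stable_of_left_inverse[OF germ[OF xC]])
      then show ?thesis unfolding fib x(2) .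
    qed
    ultimately show ?thesis by blast
  qed
  have "finite_germ n (2 * n) ?f"
    unfolding finite_germ_def
    using germ[OF zero_in_Cspace] small[OF open_in_C_Cspace zero_in_Cspace] f0 by auto
  then show ?thesis unfolding A_finite_def using small by blast
qed

end
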